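(* Let $n$ be a non-negative integer. If $F:\mathcal{J}^{\mathbf R}\to C_2\mathsf{Top}_*$ is a fibrant functor in the cofree model for calculus with Reality, then there is a levelwise weak equivalence of orthogonal functors $$c^*(D_n^{\mathbf R}F)^{C_2}\longrightarrow D_n^{\mathbf O}(c^*F^{C_2}).$$
   Context: Spaces are based compactly generated weak Hausdorff. $\mathcal{J}^{\mathbf O}$ is the topological category of finite-dimensional real inner product subspaces of $\mathbb{R}^\infty$ and linear isometries (disjoint basepoint added to morphism spaces); an orthogonal functor is a continuous functor $\mathcal{J}^{\mathbf O}\to\mathsf{Top}_*$. $\mathcal{J}^{\mathbf R}$ is the analogous category of finite-dimensional complex inner product subspaces of $\mathbb{C}\otimes\mathbb{R}^\infty$, enriched in based $C_2$-spaces with $C_2$ acting by complex conjugation; the inputs of calculus with Reality are the $C_2$-equivariant continuous functors $\mathcal{J}^{\mathbf R}\to C_2\mathsf{Top}_*$. Complexification gives $c:\mathcal{J}^{\mathbf O}\to\mathcal{J}^{\mathbf R}$, $V\mapsto V_{\mathbb C}=\mathbb{C}\otimes V$, and $c^*F^{C_2}$ denotes the orthogonal functor $V\mapsto F(V_{\mathbb C})^{C_2}$. The cofree model structure on $C_2\mathsf{Top}_*$ has as weak equivalences the underlying weak equivalences and as cofibrations those of the fine model structure (weak equivalences and fibrations detected on all fixed points); its fibrant objects are the cofree $C_2$-spaces, those $X$ for which $X^{C_2}\to X^{hC_2}=\mathsf{Map}_*((EC_2)_+,X)^{C_2}$ is a weak equivalence. A fibrant functor in the cofree model is one that is fibrant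 in the projective model structure on functors into $C_2\mathsf{Top}_*^{\mathsf{cofree}}$, i.e. levelwise cofree. $\mathbf{O}_{\le n+1}$ is the topological poset of non-zero subspaces of $\mathbb{R}^{n+1}$; $\mathbf{R}_{\le n+1}$ is the topological poset of non-zero subspaces of $\mathbb{C}\otimes\mathbb{R}^{n+1}$ of the form $U_{\mathbb C}=\mathbb{C}\otimes U$ with $U\in\mathbf{O}_{\le n+1}$. Put $\tau_n^{\mathbf O}E(V)=\operatorname{holim}_{U\in\mathbf{O}_{\le n+1}}E(V\oplus U)$, $\tau_n^{\mathbf R}F(V)=\operatorname{holim}_{U_{\mathbb C}\in\mathbf{R}_{\le n+1}}F(V\oplus U_{\mathbb C})$; $T_n$ is the sequential homotopy colimit of $\mathrm{Id}\to\tau_n\to(\tau_n)^2\to\cdots$, and $D_n=\operatorname{hofib}(T_n\to T_{n-1})$ (with $T_{-1}$ the terminal functor), the map being induced by the inclusion of the first $n$ coordinates. *)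

theory Defs
  imports "HOL-Analysis.Analysis" "HOL-Homology.Homology" "HOL-Library.Function_Algebras"
begin

section \<open>Compactly generated weak Hausdorff spaces\<close>

text \<open>
  Test maps start from compact Hausdorff spaces on the type \<^typ>\<open>'a set set\<close>.  This bound loses
  nothing: if the image of some test map to \<open>X\<close> is not closed, then so is the image of a test map
  whose domain is the closure of one preimage per point, hence of a test map from the space of
  ultrafilters on a set of points of \<open>X\<close>; and in a weak Hausdorff space the test maps may be
  taken to be the inclusions of the compact Hausdorff subspaces.
\<close>

definition test_map :: "'a set set topology \<Rightarrow> 'a topology \<Rightarrow> ('a set set \<Rightarrow> 'a) \<Rightarrow> bool" where
  "test_map C X u \<longleftrightarrow> compact_space C \<and> Hausdorff_space C \<and> continuous_map C X u"

definition weak_Hausdorff :: "'a topology \<Rightarrow> bool" where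
  "weak_Hausdorff X \<longleftrightarrow> (\<forall>C u. test_map C X u \<longrightarrow> closedin X (u ` topspace C))"

definition k_open :: "'a topology \<Rightarrow> 'a set \<Rightarrow> bool" where
  "k_open X W \<longleftrightarrow> W \<subseteq> topspace X \<and>
     (\<forall>C u. test_map C X u \<longrightarrow> openin C {c \<in> topspace C. u c \<in> W})"

text \<open>
  The library constant \<^const>\<open>kification\<close> tests on all compact subsets, Hausdorff or not, and is
  therefore a different operation in general.
\<close>

definition kify :: "'a topology \<Rightarrow> 'a topology" where
  "kify X = topology (k_open X)"

definition cgwh :: "'a topology \<Rightarrow> bool" where
  "cgwh X \<longleftrightarrow> kify X = X \<and> weak_Hausdorff X"

lemma istopology_k_open: "istopology (k_open X)"
  unfolding istopology_def
proof (intro conjI allI impI)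
  fix S T
  assume S: "k_open X S" and T: "k_open X T"
  show "k_open X (S \<inter> T)"
    unfolding k_open_def
  proof (intro conjI allI impI)
    show "S \<inter> T \<subseteq> topspace X" using S by (auto simp: k_open_def)
    fix C u assume tm: "test_map C X u"
    have "{c \<in> topspace C. u c \<in> S \<inter> T}
        = {c \<in> topspace C. u c \<in> S} \<inter> {c \<in> topspace C. u c \<in> T}" by auto
    then show "openin C {c \<in> topspace C. u c \<in> S \<inter> T}"
      using S T tm by (auto simp: k_open_def)
  qed
next
  fix K assume K: "\<forall>S\<in>K. k_open X S"
  show "k_open X (\<Union>K)"
    unfolding k_open_def
  proof (intro conjI allI impI)
    show "\<Union>K \<subseteq> topspace X" using K by (auto simp: k_open_def)
    fix C u assume tm: "test_map C X u"
    have "{c \<in> topspace C. u c \<in> \<Union>K} = (\<Union>S\<in>K. {c \<in> topspace C. u c \<in> S})" by auto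
    then show "openin C {c \<in> topspace C. u c \<in> \<Union>K}"
      using K tm by (auto simp: k_open_def)
  qed
qed

lemma openin_kify: "openin (kify X) W \<longleftrightarrow> k_open X W"
  by (simp add: kify_def topology_inverse' [OF istopology_k_open])

text \<open>The final topology on \<open>S\<close> for a family of maps \<open>p i : X i \<rightarrow> S\<close>.\<close>

definition final_topology ::
    "'b set \<Rightarrow> 'i set \<Rightarrow> ('i \<Rightarrow> 'a topology) \<Rightarrow> ('i \<Rightarrow> 'a \<Rightarrow> 'b) \<Rightarrow> 'b topology" where
  "final_topology S I X p = topology (\<lambda>W. W \<subseteq> S \<and>
     (\<forall>i\<in>I. openin (X i) {x \<in> topspace (X i). p i x \<in> W}))"

lemma openin_final_topology:
  "openin (final_topology S I X p) W \<longleftrightarrow>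
     W \<subseteq> S \<and> (\<forall>i\<in>I. openin (X i) {x \<in> topspace (X i). p i x \<in> W})"
proof -
  have "istopology (\<lambda>W. W \<subseteq> S \<and> (\<forall>i\<in>I. openin (X i) {x \<in> topspace (X i). p i x \<in> W}))"
    unfolding istopology_def
  proof (intro conjI allI impI ballI)
    fix A B i
    assume A: "A \<subseteq> S \<and> (\<forall>i\<in>I. openin (X i) {x \<in> topspace (X i). p i x \<in> A})"
      and B: "B \<subseteq> S \<and> (\<forall>i\<in>I. openin (X i) {x \<in> topspace (X i). p i x \<in> B})"
    show "A \<inter> B \<subseteq> S" using A by auto
    assume i: "i \<in> I"
    have "{x \<in> topspace (X i). p i x \<in> A \<inter> B}
        = {x \<in> topspace (X i). p i x \<in> A} \<inter> {x \<in> topspace (X i). p i x \<in> B}" by auto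
    then show "openin (X i) {x \<in> topspace (X i). p i x \<in> A \<inter> B}"
      using A B i by auto
  next
    fix K i
    assume K: "\<forall>W\<in>K. W \<subseteq> S \<and> (\<forall>i\<in>I. openin (X i) {x \<in> topspace (X i). p i x \<in> W})"
    show "\<Union>K \<subseteq> S" using K by auto
    assume i: "i \<in> I"
    have "{x \<in> topspace (X i). p i x \<in> \<Union>K} = (\<Union>W\<in>K. {x \<in> topspace (X i). p i x \<in> W})"
      by auto
    then show "openin (X i) {x \<in> topspace (X i). p i x \<in> \<Union>K}"
      using K i by auto
  qed
  then show ?thesis
    by (simp add: final_topology_def topology_inverse')
qed

text \<open>The homeomorphic copy of a space along an injective map.\<close>

definition transport :: "('a \<Rightarrow> 'b) \<Rightarrow> 'a topology \<Rightarrow> 'b topology" where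
  "transport e X = final_topology (e ` topspace X) {()} (\<lambda>_. X) (\<lambda>_. e)"

text \<open>
  The compact-open topology, before k-ification.  A map is represented by a function that is
  \<^const>\<open>undefined\<close> outside its domain.  Mapping spaces of compactly generated spaces are the
  k-ifications of subspaces of this space.
\<close>

definition compact_open_topology :: "'a topology \<Rightarrow> 'b topology \<Rightarrow> ('a \<Rightarrow> 'b) topology" where
  "compact_open_topology A B = topology_generated_by
     {{f \<in> extensional (topspace A). continuous_map A B f \<and> f ` K \<subseteq> W} | K W.
        compactin A K \<and> Hausdorff_space (subtopology A K) \<and> openin B W}"

definition based_mapping_space ::
    "'a topology \<Rightarrow> 'a \<Rightarrow> 'b topology \<Rightarrow> 'b \<Rightarrow> ('a \<Rightarrow> 'b) topology" where
  "based_mapping_space A a B b = kify (subtopology (compact_open_topology A B) {f. f a = b})"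

section \<open>Weak equivalences\<close>

definition cube :: "nat \<Rightarrow> (nat \<Rightarrow> real) topology" where
  "cube n = product_topology (\<lambda>_. top_of_set {0..1}) {..<n}"

definition cube_boundary :: "nat \<Rightarrow> (nat \<Rightarrow> real) set" where
  "cube_boundary n = {p \<in> topspace (cube n). \<exists>i<n. p i = 0 \<or> p i = 1}"

definition spheroids :: "nat \<Rightarrow> 'a topology \<Rightarrow> 'a \<Rightarrow> ((nat \<Rightarrow> real) \<Rightarrow> 'a) set" where
  "spheroids n X x = {a. continuous_map (cube n) X a \<and> a ` cube_boundary n \<subseteq> {x}}"

definition spheroid_homotopy ::
    "nat \<Rightarrow> 'a topology \<Rightarrow> 'a \<Rightarrow> (((nat \<Rightarrow> real) \<Rightarrow> 'a) \<times> ((nat \<Rightarrow> real) \<Rightarrow> 'a)) set" where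
  "spheroid_homotopy n X x =
     {(a, b). a \<in> spheroids n X x \<and> b \<in> spheroids n X x \<and>
        homotopic_with (\<lambda>h. h ` cube_boundary n \<subseteq> {x}) (cube n) X a b}"

text \<open>For \<open>n = 0\<close> this is the set of path components, whatever \<open>x\<close> is.\<close>

definition htpy_group :: "nat \<Rightarrow> 'a topology \<Rightarrow> 'a \<Rightarrow> ((nat \<Rightarrow> real) \<Rightarrow> 'a) set set" where
  "htpy_group n X x = spheroids n X x // spheroid_homotopy n X x"

definition htpy_group_map ::
    "nat \<Rightarrow> 'b topology \<Rightarrow> ('a \<Rightarrow> 'b) \<Rightarrow> 'a
       \<Rightarrow> ((nat \<Rightarrow> real) \<Rightarrow> 'a) set \<Rightarrow> ((nat \<Rightarrow> real) \<Rightarrow> 'b) set" where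
  "htpy_group_map n Y f x c = (\<Union>a\<in>c. spheroid_homotopy n Y (f x) `` {f \<circ> a})"

definition weak_equivalence :: "'a topology \<Rightarrow> 'b topology \<Rightarrow> ('a \<Rightarrow> 'b) \<Rightarrow> bool" where
  "weak_equivalence X Y f \<longleftrightarrow>
     continuous_map X Y f \<and> (topspace X = {} \<longrightarrow> topspace Y = {}) \<and>
     (\<forall>n. \<forall>x\<in>topspace X.
        bij_betw (htpy_group_map n Y f x) (htpy_group n X x) (htpy_group n Y (f x)))"

section \<open>Inner product spaces and linear isometries\<close>

text \<open>
  The scalar type \<^typ>\<open>'k\<close> is \<^typ>\<open>real\<close> or \<^typ>\<open>complex\<close>.  \<open>\<real>\<^sup>\<infinity>\<close> and \<open>\<complex> \<otimes> \<real>\<^sup>\<infinity>\<close> consist of the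
  finitely supported sequences.
\<close>

type_synonym 'k coords = "nat \<Rightarrow> 'k"

definition scl :: "'k \<Rightarrow> 'k::real_normed_field coords \<Rightarrow> 'k coords" where
  "scl c x = (\<lambda>i. c * x i)"

definition sq_norm :: "'k::real_normed_field coords \<Rightarrow> real" where
  "sq_norm x = (\<Sum>i | x i \<noteq> 0. (norm (x i))\<^sup>2)"

lemma module_scl: "Modules.module (scl :: 'k::real_normed_field \<Rightarrow> _)"
  by unfold_locales (auto simp: scl_def fun_eq_iff algebra_simps)

definition fd_subspace :: "'k::real_normed_field coords set \<Rightarrow> bool" where
  "fd_subspace V \<longleftrightarrow> (\<exists>B. finite B \<and> (\<forall>b\<in>B. finite {i. b i \<noteq> 0}) \<and> V = Modules.module.span scl B)"

text \<open>The linear isometries \<open>V \<rightarrow> W\<close>, extended by \<open>0\<close> outside \<open>V\<close>.\<close>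

definition mor :: "'k::real_normed_field coords set \<Rightarrow> 'k coords set \<Rightarrow> ('k coords \<Rightarrow> 'k coords) set" where
  "mor V W = {f. f ` V \<subseteq> W \<and>
     (\<forall>x\<in>V. \<forall>y\<in>V. f (x + y) = f x + f y) \<and>
     (\<forall>c. \<forall>x\<in>V. f (scl c x) = scl c (f x)) \<and>
     (\<forall>x\<in>V. sq_norm (f x) = sq_norm x) \<and>
     (\<forall>x. x \<notin> V \<longrightarrow> f x = 0)}"

text \<open>
  The topology of pointwise convergence, which is the usual one since \<open>V\<close> and \<open>W\<close> are finite
  dimensional.
\<close>

definition mor_space ::
    "'k::real_normed_field coords set \<Rightarrow> 'k coords set \<Rightarrow> ('k coords \<Rightarrow> 'k coords) topology" where
  "mor_space V W = top_of_set (mor V W)"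

definition incl :: "'k::real_normed_field coords set \<Rightarrow> 'k coords \<Rightarrow> 'k coords" where
  "incl V x = (if x \<in> V then x else 0)"

text \<open>\<open>V \<oplus> W\<close> is a subspace of the same sequence space by way of
  \<open>\<k>\<^sup>\<infinity> \<oplus> \<k>\<^sup>\<infinity> \<cong> \<k>\<^sup>\<infinity>\<close>, the two summands using the even and the odd coordinates.\<close>

definition join :: "'k coords \<Rightarrow> 'k coords \<Rightarrow> 'k coords" where
  "join v w = (\<lambda>i. if even i then v (i div 2) else w (i div 2))"

definition dsum :: "'k coords set \<Rightarrow> 'k coords set \<Rightarrow> 'k coords set" (infixr \<open>\<oplus>\<^sub>v\<close> 65) where
  "V \<oplus>\<^sub>v W = {join v w | v w. v \<in> V \<and> w \<in> W}"

definition dsum_mor ::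
    "'k::real_normed_field coords set \<Rightarrow> 'k coords set \<Rightarrow> ('k coords \<Rightarrow> 'k coords)
       \<Rightarrow> ('k coords \<Rightarrow> 'k coords) \<Rightarrow> 'k coords \<Rightarrow> 'k coords" where
  "dsum_mor V W f g x =
     (if x \<in> V \<oplus>\<^sub>v W then join (f (\<lambda>i. x (2 * i))) (g (\<lambda>i. x (2 * i + 1))) else 0)"

definition dsum_in1 :: "'k::real_normed_field coords set \<Rightarrow> 'k coords \<Rightarrow> 'k coords" where
  "dsum_in1 V x = (if x \<in> V then join x 0 else 0)"

text \<open>\<open>\<k> \<otimes> U\<close> for a real subspace \<open>U\<close>; for \<open>\<k> = \<real>\<close> this is \<open>U\<close> itself, see \<open>ext_real\<close>, and for
  \<open>\<k> = \<complex>\<close> the complexification, see \<open>ext_complex\<close>.\<close>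

definition ext :: "real coords set \<Rightarrow> 'k::real_normed_field coords set" where
  "ext U = Modules.module.span scl ((\<lambda>u i. of_real (u i)) ` U)"

definition cplx_mor ::
    "real coords set \<Rightarrow> (real coords \<Rightarrow> real coords) \<Rightarrow> complex coords \<Rightarrow> complex coords" where
  "cplx_mor V f z =
     (if z \<in> ext V then (\<lambda>i. Complex (f (Re \<circ> z) i) (f (Im \<circ> z) i)) else 0)"

definition conjv :: "complex coords \<Rightarrow> complex coords" where
  "conjv z = cnj \<circ> z"

text \<open>
  The objects of \<open>\<J>\<^sup>R\<close>.  Conjugation sends linear isometries \<open>V \<rightarrow> W\<close> to linear isometries between
  the conjugate subspaces, so it acts on the morphism spaces between the conjugation-invariant ones,
  which are the complexifications of the objects of \<open>\<J>\<^sup>O\<close>.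
\<close>

definition reality_object :: "complex coords set \<Rightarrow> bool" where
  "reality_object V \<longleftrightarrow> fd_subspace V \<and> conjv ` V = V"

lemma ext_real:
  assumes "Modules.module.subspace scl (U :: real coords set)"
  shows "ext U = U"
proof -
  interpret Modules.module "scl :: real \<Rightarrow> _" by (rule module_scl)
  have "(\<lambda>u i. of_real (u i)) ` U = U" by (simp add: image_def)
  then show ?thesis using assms by (simp add: ext_def span_eq_iff)
qed

lemma ext_complex:
  assumes "Modules.module.subspace scl U"
  shows "ext U = {\<lambda>i. Complex (x i) (y i) | x y. x \<in> U \<and> y \<in> U}" (is "_ = ?C")
proof
  interpret r: Modules.module "scl :: real \<Rightarrow> _" by (rule module_scl)
  interpret c: Modules.module "scl :: complex \<Rightarrow> _" by (rule module_scl)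
  have sub: "c.subspace ?C"
  proof (rule c.subspaceI)
    have "(0 :: complex coords) = (\<lambda>i. Complex ((0 :: real coords) i) ((0 :: real coords) i))"
      by (auto simp: fun_eq_iff complex_eq_iff)
    then show "0 \<in> ?C" using r.subspace_0[OF assms] by blast
  next
    fix a b assume "a \<in> ?C" "b \<in> ?C"
    then obtain x y x' y' where *: "a = (\<lambda>i. Complex (x i) (y i))" "b = (\<lambda>i. Complex (x' i) (y' i))"
      "x \<in> U" "y \<in> U" "x' \<in> U" "y' \<in> U" by auto
    have "a + b = (\<lambda>i. Complex ((x + x') i) ((y + y') i))"
      by (auto simp: * fun_eq_iff complex_eq_iff)
    then show "a + b \<in> ?C" using * r.subspace_add[OF assms] by blast
  next
    fix k a assume "a \<in> ?C"
    then obtain x y where *: "a = (\<lambda>i. Complex (x i) (y i))" "x \<in> U" "y \<in> U" by auto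
    have "scl k a = (\<lambda>i. Complex ((scl (Re k) x + scl (- Im k) y) i)
                                 ((scl (Re k) y + scl (Im k) x) i))"
      by (auto simp: * scl_def fun_eq_iff complex_eq_iff)
    moreover have "scl (Re k) x + scl (- Im k) y \<in> U" "scl (Re k) y + scl (Im k) x \<in> U"
      using * by (blast intro: r.subspace_add[OF assms] r.subspace_scale[OF assms])+
    ultimately show "scl k a \<in> ?C" by blast
  qed
  have "(\<lambda>i. of_real (u i)) = (\<lambda>i. Complex (u i) ((0 :: real coords) i))" for u
    by (auto simp: fun_eq_iff complex_eq_iff)
  then have "(\<lambda>u i. of_real (u i)) ` U \<subseteq> ?C"
    using r.subspace_0[OF assms] by blast
  then show "ext U \<subseteq> ?C" unfolding ext_def by (rule c.span_minimal[OF _ sub])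
  show "?C \<subseteq> ext U"
  proof
    fix a assume "a \<in> ?C"
    then obtain x y where *: "a = (\<lambda>i. Complex (x i) (y i))" "x \<in> U" "y \<in> U" by auto
    have "a = (\<lambda>i. of_real (x i)) + scl \<i> (\<lambda>i. of_real (y i))"
      by (auto simp: * scl_def fun_eq_iff complex_eq_iff)
    then show "a \<in> ext U" using * unfolding ext_def
      by (metis (no_types, lifting) c.span_add c.span_scale c.span_base imageI)
  qed
qed

section \<open>Functors\<close>

text \<open>
  A universe of points.  It contains the points of an arbitrary type and is closed under the
  constructions below: families indexed by simplices and flags of subspaces (for homotopy limits),
  telescopes and homotopy fibres.  A functor with values in spaces on the type \<^typ>\<open>'a\<close> becomes one
  with values in spaces on \<open>'a univ\<close> through the constructor \<open>Atom\<close>.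
\<close>

datatype 'a univ =
    Atom 'a
  | Star
  | Fam "nat \<Rightarrow> (nat \<Rightarrow> real) \<Rightarrow> (nat \<Rightarrow> real coords set) \<Rightarrow> 'a univ"
  | Tel nat real "'a univ"
  | HFib "'a univ" "real \<Rightarrow> 'a univ"

record ('k, 'u) fctr =
  Sp :: "'k coords set \<Rightarrow> 'u topology"
  Pt :: "'k coords set \<Rightarrow> 'u"
  Mp :: "'k coords set \<Rightarrow> 'k coords set \<Rightarrow> ('k coords \<Rightarrow> 'k coords) \<Rightarrow> 'u \<Rightarrow> 'u"

text \<open>
  Based maps out of a space with a disjoint basepoint are the same as unbased maps, so no basepoint
  is added to the morphism spaces.  The objects of the source category are given by \<open>ob\<close>.
\<close>

definition continuous_functor ::
    "('k::real_normed_field coords set \<Rightarrow> bool) \<Rightarrow> ('k, 'u) fctr \<Rightarrow> bool" where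
  "continuous_functor ob E \<longleftrightarrow>
     (\<forall>V. ob V \<longrightarrow> cgwh (Sp E V) \<and> Pt E V \<in> topspace (Sp E V)) \<and>
     (\<forall>V. ob V \<longrightarrow> (\<forall>x\<in>topspace (Sp E V). Mp E V V (incl V) x = x)) \<and>
     (\<forall>V W X. ob V \<and> ob W \<and> ob X \<longrightarrow>
        (\<forall>f\<in>mor V W. \<forall>g\<in>mor W X. \<forall>x\<in>topspace (Sp E V).
           Mp E V X (g \<circ> f) x = Mp E W X g (Mp E V W f x))) \<and>
     (\<forall>V W. ob V \<and> ob W \<longrightarrow>
        continuous_map (mor_space V W)
          (based_mapping_space (Sp E V) (Pt E V) (Sp E W) (Pt E W))
          (\<lambda>f. restrict (Mp E V W f) (topspace (Sp E V))))"

definition levelwise_weak_equivalence ::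
    "(real, 'u) fctr \<Rightarrow> (real, 'v) fctr \<Rightarrow> (real coords set \<Rightarrow> 'u \<Rightarrow> 'v) \<Rightarrow> bool" where
  "levelwise_weak_equivalence E E' \<alpha> \<longleftrightarrow>
     (\<forall>V. fd_subspace V \<longrightarrow> \<alpha> V (Pt E V) = Pt E' V \<and> weak_equivalence (Sp E V) (Sp E' V) (\<alpha> V)) \<and>
     (\<forall>V W. fd_subspace V \<and> fd_subspace W \<longrightarrow>
        (\<forall>f\<in>mor V W. \<forall>x\<in>topspace (Sp E V). \<alpha> W (Mp E V W f x) = Mp E' V W f (\<alpha> V x)))"

text \<open>
  A functor to \<open>C\<^sub>2\<close>-spaces is a functor to spaces with involutions of its values.  The group acts on
  morphism spaces, as well as on spaces of maps, by conjugation.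
\<close>

type_synonym 'u reality_fctr = "(complex, 'u) fctr \<times> (complex coords set \<Rightarrow> 'u \<Rightarrow> 'u)"

fun reality_functor :: "'u reality_fctr \<Rightarrow> bool" where
  "reality_functor (F, \<sigma>) \<longleftrightarrow>
     continuous_functor reality_object F \<and>
     (\<forall>V. reality_object V \<longrightarrow>
        continuous_map (Sp F V) (Sp F V) (\<sigma> V) \<and>
        (\<forall>x\<in>topspace (Sp F V). \<sigma> V (\<sigma> V x) = x) \<and>
        \<sigma> V (Pt F V) = Pt F V) \<and>
     (\<forall>V W. reality_object V \<and> reality_object W \<longrightarrow>
        (\<forall>f\<in>mor V W. \<forall>x\<in>topspace (Sp F V).
           Mp F V W (conjv \<circ> f \<circ> conjv) x = \<sigma> W (Mp F V W f (\<sigma> V x))))"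

definition fixed_space :: "'u topology \<Rightarrow> ('u \<Rightarrow> 'u) \<Rightarrow> 'u topology" where
  "fixed_space X s = subtopology X {x. s x = x}"

text \<open>The functor \<open>c\<^sup>*F\<^sup>C\<^sup>2\<close>, sending \<open>V\<close> to the fixed points of \<open>F\<close> at the complexification of \<open>V\<close>.\<close>

fun c_star_fixed :: "'u reality_fctr \<Rightarrow> (real, 'u) fctr" where
  "c_star_fixed (F, \<sigma>) =
     \<lparr> Sp = (\<lambda>V. fixed_space (Sp F (ext V)) (\<sigma> (ext V))),
       Pt = (\<lambda>V. Pt F (ext V)),
       Mp = (\<lambda>V W f. Mp F (ext V) (ext W) (cplx_mor V f)) \<rparr>"

section \<open>Cofree spaces\<close>

text \<open>\<open>EC\<^sub>2\<close> is the infinite sphere \<open>S(\<real>\<^sup>\<infinity>)\<close> with the antipodal action.\<close>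

definition EC2 :: "(nat \<Rightarrow> real) topology" where
  "EC2 = final_topology (\<Union>k. topspace (nsphere k)) UNIV nsphere (\<lambda>_ x. x)"

definition antipode :: "(nat \<Rightarrow> real) \<Rightarrow> nat \<Rightarrow> real" where
  "antipode x = (\<lambda>i. - x i)"

definition disjoint_basepoint :: "'a topology \<Rightarrow> 'a option topology" where
  "disjoint_basepoint X = final_topology (insert None (Some ` topspace X)) {()} (\<lambda>_. X) (\<lambda>_. Some)"

definition homotopy_fixed_space :: "'u topology \<Rightarrow> 'u \<Rightarrow> ('u \<Rightarrow> 'u) \<Rightarrow> ((nat \<Rightarrow> real) option \<Rightarrow> 'u) topology" where
  "homotopy_fixed_space X x0 s =
     subtopology (based_mapping_space (disjoint_basepoint EC2) None X x0)
       {g. \<forall>e \<in> topspace EC2. g (Some (antipode e)) = s (g (Some e))}"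

definition cofree :: "'u topology \<Rightarrow> 'u \<Rightarrow> ('u \<Rightarrow> 'u) \<Rightarrow> bool" where
  "cofree X x0 s \<longleftrightarrow>
     weak_equivalence (fixed_space X s) (homotopy_fixed_space X x0 s)
       (\<lambda>x. restrict (case_option x0 (\<lambda>_. x)) (topspace (disjoint_basepoint EC2)))"

fun fibrant_in_cofree_model :: "'u reality_fctr \<Rightarrow> bool" where
  "fibrant_in_cofree_model (F, \<sigma>) \<longleftrightarrow>
     (\<forall>V. reality_object V \<longrightarrow> cofree (Sp F V) (Pt F V) (\<sigma> V))"

section \<open>Homotopy limits over topological posets\<close>

text \<open>
  A diagram on a topological poset \<open>P\<close> consists of a space \<open>E\<close> of pairs \<open>(p, x)\<close>, where \<open>x\<close> ranges
  over the value at \<open>p\<close>, and of transition maps \<open>tr p q\<close> for \<open>p \<le> q\<close>.  Its homotopy limit is the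
  totalization of the cosimplicial space that in degree \<open>k\<close> consists of the sections, over the space
  of chains \<open>p\<^sub>0 \<le> \<dots> \<le> p\<^sub>k\<close>, of the values at \<open>p\<^sub>k\<close>.  So a point is a sequence \<open>h\<close> of maps
  \<open>\<Delta>\<^sup>k \<times> {chains} \<rightarrow> E\<close> over \<open>P\<close> compatible with all monotone \<open>\<theta> : [j] \<rightarrow> [k]\<close>.
  All posets used below are compact Hausdorff, so that their finite products and the products
  with simplices need no k-ification.
\<close>

definition simplex_space :: "nat \<Rightarrow> (nat \<Rightarrow> real) topology" where
  "simplex_space k = subtopology (powertop_real UNIV) (standard_simplex k)"

definition simplex_push :: "nat \<Rightarrow> (nat \<Rightarrow> nat) \<Rightarrow> (nat \<Rightarrow> real) \<Rightarrow> nat \<Rightarrow> real" where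
  "simplex_push j \<theta> t = (\<lambda>i. \<Sum>l | l \<le> j \<and> \<theta> l = i. t l)"

definition chain_space :: "'p::order topology \<Rightarrow> nat \<Rightarrow> (nat \<Rightarrow> 'p) topology" where
  "chain_space P k =
     subtopology (product_topology (\<lambda>_. P) {..k}) {u. \<forall>i<k. u i \<le> u (Suc i)}"

definition holim ::
    "'p::order topology \<Rightarrow> ('p \<times> 'u) topology \<Rightarrow> ('p \<Rightarrow> 'p \<Rightarrow> 'u \<Rightarrow> 'u)
       \<Rightarrow> (nat \<Rightarrow> (nat \<Rightarrow> real) \<times> (nat \<Rightarrow> 'p) \<Rightarrow> 'p \<times> 'u) topology" where
  "holim P E tr = kify (subtopology
     (product_topology
        (\<lambda>k. compact_open_topology (prod_topology (simplex_space k) (chain_space P k)) E) UNIV)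
     {h. (\<forall>k. \<forall>t\<in>topspace (simplex_space k). \<forall>u\<in>topspace (chain_space P k).
            fst (h k (t, u)) = u k) \<and>
         (\<forall>j k \<theta>. \<theta> ` {..j} \<subseteq> {..k} \<and> mono_on {..j} \<theta> \<longrightarrow>
            (\<forall>t\<in>topspace (simplex_space j). \<forall>u\<in>topspace (chain_space P k).
               snd (h k (simplex_push j \<theta> t, u)) =
               tr (u (\<theta> j)) (u k) (snd (h j (t, restrict (u \<circ> \<theta>) {..j})))))})"

section \<open>The functors \<open>\<tau>\<^sub>n\<close>\<close>

definition std_space :: "nat \<Rightarrow> 'k::real_normed_field coords set" where
  "std_space i = {x. \<forall>j\<ge>i. x j = 0}"

text \<open>The isometries \<open>\<k>\<^sup>i \<rightarrow> \<k>\<^sup>m\<close> with real matrix, that is the extensions of those \<open>\<real>\<^sup>i \<rightarrow> \<real>\<^sup>m\<close>.\<close>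

definition real_frames :: "nat \<Rightarrow> nat \<Rightarrow> ('k::real_normed_field coords \<Rightarrow> 'k coords) set" where
  "real_frames i m = {f \<in> mor (std_space i) (std_space m).
     \<forall>x\<in>std_space i. (\<forall>l. x l \<in> \<real>) \<longrightarrow> (\<forall>l. f x l \<in> \<real>)}"

definition nonzero_subspaces :: "nat \<Rightarrow> real coords set set" where
  "nonzero_subspaces m = {U. Modules.module.subspace scl U \<and> U \<noteq> {0} \<and> U \<subseteq> std_space m}"

text \<open>
  The poset \<open>O\<^sub>\<le>\<^sub>m\<close> for real and \<open>R\<^sub>\<le>\<^sub>m\<close> for complex scalars, topologized as a quotient of the spaces
  of frames.
\<close>

definition subspace_poset :: "nat \<Rightarrow> 'k::real_normed_field coords set topology" where
  "subspace_poset m = final_topology (ext ` nonzero_subspaces m) {1..m}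
     (\<lambda>i. top_of_set (real_frames i m)) (\<lambda>i f. f ` std_space i)"

text \<open>
  The space of all pairs \<open>(U, x)\<close> with \<open>x\<close> in \<open>E(V \<oplus> U)\<close>.  Over the subspaces of dimension \<open>i\<close> it is
  the bundle with fibre \<open>E(V \<oplus> \<k>\<^sup>i)\<close> associated to the principal bundle of frames.
\<close>

definition total_space ::
    "nat \<Rightarrow> ('k::real_normed_field, 'u) fctr \<Rightarrow> 'k coords set \<Rightarrow> ('k coords set \<times> 'u) topology" where
  "total_space m E V = final_topology
     (SIGMA U:topspace (subspace_poset m). topspace (Sp E (V \<oplus>\<^sub>v U))) {1..m}
     (\<lambda>i. prod_topology (top_of_set (real_frames i m)) (Sp E (V \<oplus>\<^sub>v std_space i)))
     (\<lambda>i (f, x). (f ` std_space i,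
        Mp E (V \<oplus>\<^sub>v std_space i) (V \<oplus>\<^sub>v f ` std_space i)
          (dsum_mor V (std_space i) (incl V) f) x))"

definition in_index :: "nat \<Rightarrow> nat \<Rightarrow> (nat \<Rightarrow> real) \<Rightarrow> (nat \<Rightarrow> real coords set) \<Rightarrow> bool" where
  "in_index m k t u \<longleftrightarrow>
     t \<in> topspace (simplex_space k) \<and> u \<in> topspace (chain_space (subspace_poset m) k)"

text \<open>
  A point of the homotopy limit is stored as the family of its values.  Chains in \<open>R\<^sub>\<le>\<^sub>m\<close> are
  named by the corresponding chains in \<open>O\<^sub>\<le>\<^sub>m\<close>, and the arbitrary value \<open>Star\<close> is taken off the index
  set.
\<close>

definition enc ::
    "nat \<Rightarrow> (nat \<Rightarrow> (nat \<Rightarrow> real) \<times> (nat \<Rightarrow> 'k::real_normed_field coords set)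
                  \<Rightarrow> 'k coords set \<times> 'a univ) \<Rightarrow> 'a univ" where
  "enc m h = Fam (\<lambda>k t u.
     if in_index m k t u then snd (h k (t, restrict (\<lambda>i. ext (u i)) {..k})) else Star)"

text \<open>Apply a family of maps \<open>\<phi> U\<close>, one for each index \<open>U\<close>, to a point of a homotopy limit.\<close>

fun fam_map ::
    "nat \<Rightarrow> ('k::real_normed_field coords set \<Rightarrow> 'a univ \<Rightarrow> 'a univ) \<Rightarrow> 'a univ \<Rightarrow> 'a univ" where
  "fam_map m \<phi> (Fam g) =
     Fam (\<lambda>k t u. if in_index m k t u then \<phi> (ext (u k)) (g k t u) else Star)"
| "fam_map m \<phi> _ = Star"

definition tau :: "nat \<Rightarrow> ('k::real_normed_field, 'a univ) fctr \<Rightarrow> ('k, 'a univ) fctr" where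
  "tau n E =
     \<lparr> Sp = (\<lambda>V. transport (enc (n + 1))
         (holim (subspace_poset (n + 1)) (total_space (n + 1) E V)
           (\<lambda>U U'. Mp E (V \<oplus>\<^sub>v U) (V \<oplus>\<^sub>v U') (incl (V \<oplus>\<^sub>v U))))),
       Pt = (\<lambda>V. Fam (\<lambda>k t u.
         if in_index (n + 1) k t u then Pt E (V \<oplus>\<^sub>v ext (u k)) else Star)),
       Mp = (\<lambda>V W f. fam_map (n + 1)
         (\<lambda>U. Mp E (V \<oplus>\<^sub>v U) (W \<oplus>\<^sub>v U) (dsum_mor V U f (incl U)))) \<rparr>"

text \<open>The effect of \<open>\<tau>\<^sub>n\<close> on a natural transformation.\<close>

definition tau_map ::
    "nat \<Rightarrow> ('k::real_normed_field coords set \<Rightarrow> 'a univ \<Rightarrow> 'a univ)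
         \<Rightarrow> 'k coords set \<Rightarrow> 'a univ \<Rightarrow> 'a univ" where
  "tau_map n \<phi> V = fam_map (n + 1) (\<lambda>U. \<phi> (V \<oplus>\<^sub>v U))"

definition eta ::
    "nat \<Rightarrow> ('k::real_normed_field, 'a univ) fctr \<Rightarrow> 'k coords set \<Rightarrow> 'a univ \<Rightarrow> 'a univ" where
  "eta n E V x = Fam (\<lambda>k t u.
     if in_index (n + 1) k t u then Mp E V (V \<oplus>\<^sub>v ext (u k)) (dsum_in1 V) x else Star)"

text \<open>Restriction of homotopy limits from \<open>n + 1\<close> to the first \<open>n\<close> coordinates; maps \<open>\<tau>\<^sub>n\<close> to \<open>\<tau>\<^sub>n\<^sub>-\<^sub>1\<close>.\<close>

fun fam_restrict :: "nat \<Rightarrow> 'a univ \<Rightarrow> 'a univ" where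
  "fam_restrict n (Fam g) = Fam (\<lambda>k t u. if in_index n k t u then g k t u else Star)"
| "fam_restrict n _ = Star"

section \<open>The functors \<open>T\<^sub>n\<close>\<close>

text \<open>
  Sequential homotopy colimits are reduced mapping telescopes: in the union of the
  \<open>[k, k + 1] \<times> X k\<close> the point \<open>(k, 1, x)\<close> is identified with \<open>(k + 1, 0, e k x)\<close>, and all points
  over the basepoints \<open>p k\<close> are identified.  We choose normal forms with \<open>t < 1\<close>; \<open>Star\<close> is the
  basepoint.
\<close>

definition tel_point ::
    "(nat \<Rightarrow> 'a univ) \<Rightarrow> (nat \<Rightarrow> 'a univ \<Rightarrow> 'a univ) \<Rightarrow> nat \<Rightarrow> real \<Rightarrow> 'a univ \<Rightarrow> 'a univ" where
  "tel_point p e k t x =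
     (if x = p k then Star
      else if t < 1 then Tel k t x
      else if e k x = p (Suc k) then Star
      else Tel (Suc k) 0 (e k x))"

definition telescope ::
    "(nat \<Rightarrow> 'a univ topology) \<Rightarrow> (nat \<Rightarrow> 'a univ) \<Rightarrow> (nat \<Rightarrow> 'a univ \<Rightarrow> 'a univ) \<Rightarrow> 'a univ topology" where
  "telescope X p e = final_topology
     (\<Union>k. (\<lambda>(t, x). tel_point p e k t x) ` ({0..1} \<times> topspace (X k))) UNIV
     (\<lambda>k. prod_topology (top_of_set {0..1}) (X k))
     (\<lambda>k (t, x). tel_point p e k t x)"

text \<open>The map induced by maps \<open>\<phi> k\<close> into the stages of the telescope given by \<open>p\<close> and \<open>e\<close>.\<close>

fun tel_map ::
    "(nat \<Rightarrow> 'a univ) \<Rightarrow> (nat \<Rightarrow> 'a univ \<Rightarrow> 'a univ) \<Rightarrow> (nat \<Rightarrow> 'a univ \<Rightarrow> 'a univ) \<Rightarrow> 'a univ \<Rightarrow> 'a univ" where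
  "tel_map p e \<phi> (Tel k t x) = tel_point p e k t (\<phi> k x)"
| "tel_map p e \<phi> _ = Star"

definition tau_iter :: "nat \<Rightarrow> ('k::real_normed_field, 'a univ) fctr \<Rightarrow> nat \<Rightarrow> ('k, 'a univ) fctr" where
  "tau_iter n E k = (tau n ^^ k) E"

abbreviation tau_points where
  "tau_points n E V \<equiv> \<lambda>k. Pt (tau_iter n E k) V"

abbreviation tau_steps where
  "tau_steps n E V \<equiv> \<lambda>k. eta n (tau_iter n E k) V"

definition T :: "nat \<Rightarrow> ('k::real_normed_field, 'a univ) fctr \<Rightarrow> ('k, 'a univ) fctr" where
  "T n E =
     \<lparr> Sp = (\<lambda>V. telescope (\<lambda>k. Sp (tau_iter n E k) V) (tau_points n E V) (tau_steps n E V)),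
       Pt = (\<lambda>V. Star),
       Mp = (\<lambda>V W f. tel_map (tau_points n E W) (tau_steps n E W)
               (\<lambda>k. Mp (tau_iter n E k) V W f)) \<rparr>"

text \<open>The effect of \<open>T\<^sub>n\<close> on a natural transformation \<open>\<phi>\<close> with target \<open>E\<close>.\<close>

definition T_map ::
    "nat \<Rightarrow> ('k::real_normed_field, 'a univ) fctr \<Rightarrow> ('k coords set \<Rightarrow> 'a univ \<Rightarrow> 'a univ)
         \<Rightarrow> 'k coords set \<Rightarrow> 'a univ \<Rightarrow> 'a univ" where
  "T_map n E \<phi> V = tel_map (tau_points n E V) (tau_steps n E V) (\<lambda>k. (tau_map n ^^ k) \<phi> V)"

text \<open>
  The map from the \<open>k\<close>-th power of \<open>\<tau>\<^sub>n\<^sub>+\<^sub>1\<close> to the \<open>k\<close>-th power of \<open>\<tau>\<^sub>n\<close> that restricts in every variable.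
\<close>

primrec iter_restrict ::
    "nat \<Rightarrow> nat \<Rightarrow> 'k::real_normed_field coords set \<Rightarrow> 'a univ \<Rightarrow> 'a univ" where
  "iter_restrict n 0 V x = x"
| "iter_restrict n (Suc k) V x = tau_map n (iter_restrict n k) V (fam_restrict (n + 1) x)"

section \<open>The functors \<open>D\<^sub>n\<close>\<close>

definition terminal :: "('k, 'a univ) fctr" where
  "terminal = \<lparr> Sp = (\<lambda>V. discrete_topology {Star}), Pt = (\<lambda>V. Star), Mp = (\<lambda>V W f x. Star) \<rparr>"

text \<open>\<open>T\<^sub>n\<^sub>-\<^sub>1\<close>, its effect on natural transformations, and the map from \<open>T\<^sub>n\<close> to it.\<close>

primrec T_pred :: "nat \<Rightarrow> ('k::real_normed_field, 'a univ) fctr \<Rightarrow> ('k, 'a univ) fctr" where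
  "T_pred 0 E = terminal"
| "T_pred (Suc n) E = T n E"

primrec T_pred_map ::
    "nat \<Rightarrow> ('k::real_normed_field, 'a univ) fctr \<Rightarrow> ('k coords set \<Rightarrow> 'a univ \<Rightarrow> 'a univ)
         \<Rightarrow> 'k coords set \<Rightarrow> 'a univ \<Rightarrow> 'a univ" where
  "T_pred_map 0 E \<phi> V = (\<lambda>x. Star)"
| "T_pred_map (Suc n) E \<phi> V = T_map n E \<phi> V"

primrec T_down ::
    "nat \<Rightarrow> ('k::real_normed_field, 'a univ) fctr \<Rightarrow> 'k coords set \<Rightarrow> 'a univ \<Rightarrow> 'a univ" where
  "T_down 0 E V = (\<lambda>x. Star)"
| "T_down (Suc n) E V =
     tel_map (tau_points n E V) (tau_steps n E V) (\<lambda>k. iter_restrict n k V)"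

definition hofib ::
    "'a univ topology \<Rightarrow> 'a univ topology \<Rightarrow> 'a univ \<Rightarrow> ('a univ \<Rightarrow> 'a univ) \<Rightarrow> 'a univ topology" where
  "hofib X Y y0 f = transport (\<lambda>(x, \<gamma>). HFib x \<gamma>)
     (kify (subtopology (prod_topology X (compact_open_topology (top_of_set {0..1}) Y))
        {(x, \<gamma>). \<gamma> 0 = f x \<and> \<gamma> 1 = y0}))"

fun hofib_map :: "('a univ \<Rightarrow> 'a univ) \<Rightarrow> ('a univ \<Rightarrow> 'a univ) \<Rightarrow> 'a univ \<Rightarrow> 'a univ" where
  "hofib_map \<phi> \<psi> (HFib x \<gamma>) = HFib (\<phi> x) (restrict (\<psi> \<circ> \<gamma>) {0..1})"
| "hofib_map \<phi> \<psi> _ = Star"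

definition D :: "nat \<Rightarrow> ('k::real_normed_field, 'a univ) fctr \<Rightarrow> ('k, 'a univ) fctr" where
  "D n E =
     \<lparr> Sp = (\<lambda>V. hofib (Sp (T n E) V) (Sp (T_pred n E) V) (Pt (T_pred n E) V) (T_down n E V)),
       Pt = (\<lambda>V. HFib (Pt (T n E) V) (restrict (\<lambda>_. Pt (T_pred n E) V) {0..1})),
       Mp = (\<lambda>V W f. hofib_map (Mp (T n E) V W f) (Mp (T_pred n E) V W f)) \<rparr>"

definition D_map ::
    "nat \<Rightarrow> ('k::real_normed_field, 'a univ) fctr \<Rightarrow> ('k coords set \<Rightarrow> 'a univ \<Rightarrow> 'a univ)
         \<Rightarrow> 'k coords set \<Rightarrow> 'a univ \<Rightarrow> 'a univ" where
  "D_map n E \<phi> V = hofib_map (T_map n E \<phi> V) (T_pred_map n E \<phi> V)"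

definition D_orthogonal :: "nat \<Rightarrow> (real, 'a univ) fctr \<Rightarrow> (real, 'a univ) fctr" where
  "D_orthogonal = D"

text \<open>
  The group acts on all homotopy limits, telescopes and homotopy fibres through its action on the
  values of \<open>F\<close>; it acts trivially on the poset \<open>R\<^sub>\<le>\<^sub>n\<^sub>+\<^sub>1\<close>, whose elements are conjugation-invariant.
\<close>

fun D_reality :: "nat \<Rightarrow> 'a univ reality_fctr \<Rightarrow> 'a univ reality_fctr" where
  "D_reality n (F, \<sigma>) = (D n F, D_map n F \<sigma>)"

end

theory Submission
  imports Defs
begin

text \<open>
  The map is the identity.  Fixed points commute strictly with all constructions: fixed sets are
  closed (at level zero because the values are weak Hausdorff, and then inductively), and
  restriction to a closed subset commutes with k-ification, with final topologies, with mapping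
  spaces and, since the maps \<open>eta\<close> are continuous, with telescopes.  The poset \<open>R\<^sub>\<le>\<^sub>m\<close> is fixed
  pointwise, so the argument has two independent halves.  First, \<open>D\<^sub>n\<close> commutes with restriction
  along complexification: frames with real matrix are complexified real frames, and the encoding
  \<^const>\<open>enc\<close> makes the two homotopy limits literally equal.  Second, for an orthogonal functor with
  an involution, \<open>D\<^sub>n\<close> commutes with fixed points.
\<close>

section \<open>Final topologies and transport\<close>

text \<open>Restricting a quotient map, a k-ification or a telescope can go wrong over a subset that
  is not closed. Closedness of fixed sets is therefore an assumption of
  \<open>regular_action\<close> that is proved again for \<open>tau n G\<close>; compact generation
  and continuity of each single map travel in the same way, in place of the full notion of a
  continuous functor. Two obstacles shape the rest. The k-ification of a space tests with spaces on
  a type built from the type of its points, so functor values and homotopy limits, and limits over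
  real and over complex posets, can be compared only along injections between these types. And
  \<open>eta\<close> has values in sections of a bundle that is defined as a quotient; the product
  of a quotient map with a space need not be a quotient map, and it is the openness of the passage
  from frames to subspaces that makes \<open>eta\<close> continuous.\<close>

lemma topology_eq_closedin:
  assumes "topspace X = topspace Y" "\<And>B. B \<subseteq> topspace X \<Longrightarrow> closedin X B \<longleftrightarrow> closedin Y B"
  shows "X = Y"
proof -
  have "openin X W \<longleftrightarrow> openin Y W" for W
    using assms(2)[of "topspace X - W"] assms(1)
    by (metis Diff_subset openin_closedin_eq)
  then show ?thesis by (simp add: topology_eq)
qed

lemma subtopology_cong:
  "topspace X \<inter> A = topspace X \<inter> B \<Longrightarrow> subtopology X A = subtopology X B"
  using subtopology_restrict[of X A] subtopology_restrict[of X B] by simp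

lemma topspace_final_topology:
  assumes "\<forall>i\<in>I. p i \<in> topspace (X i) \<rightarrow> S"
  shows "topspace (final_topology S I X p) = S"
proof -
  have "openin (final_topology S I X p) S"
  proof -
    have "{x \<in> topspace (X i). p i x \<in> S} = topspace (X i)" if "i \<in> I" for i
      using assms that by auto
    then show ?thesis by (simp add: openin_final_topology)
  qed
  then have "S \<subseteq> topspace (final_topology S I X p)" by (rule openin_subset)
  moreover have "topspace (final_topology S I X p) \<subseteq> S"
    using openin_topspace[of "final_topology S I X p"] unfolding openin_final_topology by blast
  ultimately show ?thesis by blast
qed

lemma closedin_final_topology:
  assumes "\<forall>i\<in>I. p i \<in> topspace (X i) \<rightarrow> S"
  shows "closedin (final_topology S I X p) B \<longleftrightarrow>
    B \<subseteq> S \<and> (\<forall>i\<in>I. closedin (X i) {x \<in> topspace (X i). p i x \<in> B})"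
proof -
  have "{x \<in> topspace (X i). p i x \<in> S - B} = topspace (X i) - {x \<in> topspace (X i). p i x \<in> B}"
    if "i \<in> I" for i using assms that by auto
  then show ?thesis
    by (auto simp: closedin_def topspace_final_topology[OF assms] openin_final_topology)
qed

lemma continuous_map_into_final_topology:
  assumes "\<forall>i\<in>I. p i \<in> topspace (X i) \<rightarrow> S" "i \<in> I"
  shows "continuous_map (X i) (final_topology S I X p) (p i)"
  using assms by (auto simp: continuous_map_def topspace_final_topology openin_final_topology)

lemma continuous_map_from_final_topology:
  assumes "\<forall>i\<in>I. p i \<in> topspace (X i) \<rightarrow> S"
    and "\<And>x. x \<in> S \<Longrightarrow> g x \<in> topspace Y"
    and "\<And>i. i \<in> I \<Longrightarrow> continuous_map (X i) Y (\<lambda>x. g (p i x))"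
  shows "continuous_map (final_topology S I X p) Y g"
proof -
  have ts: "topspace (final_topology S I X p) = S"
    by (rule topspace_final_topology) (rule assms(1))
  show ?thesis
    unfolding continuous_map_def ts
  proof (intro conjI allI impI)
    fix U assume U: "openin Y U"
    have "{x \<in> topspace (X i). p i x \<in> {x \<in> S. g x \<in> U}} = {x \<in> topspace (X i). g (p i x) \<in> U}"
      if "i \<in> I" for i using assms(1) that by auto
    then show "openin (final_topology S I X p) {x \<in> S. g x \<in> U}"
      using openin_continuous_map_preimage[OF assms(3) U] by (auto simp: openin_final_topology)
  qed (use assms(2) in auto)
qed

text \<open>Subsets of a closed set are closed in it exactly when they are closed in the whole
  space. This applies below to the set cut out by \<open>Q\<close> and above to its preimages, which
  are closed as well. A predicate is used because the sets that define fixed spaces are not confined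
  to the carrier.\<close>

lemma subtopology_final_topology:
  assumes p: "\<forall>i\<in>I. p i \<in> topspace (X i) \<rightarrow> S"
    and A: "closedin (final_topology S I X p) {y \<in> S. Q y}"
  shows "subtopology (final_topology S I X p) {y. Q y}
       = final_topology {y \<in> S. Q y} I (\<lambda>i. subtopology (X i) {x. Q (p i x)}) p"
proof (rule topology_eq_closedin)
  let ?F = "final_topology S I X p" and ?A = "{y \<in> S. Q y}"
  let ?X = "\<lambda>i. subtopology (X i) {x. Q (p i x)}"
  have cA: "\<forall>i\<in>I. closedin (X i) {x \<in> topspace (X i). p i x \<in> ?A}"
    using A unfolding closedin_final_topology[OF p] by blast
  have q: "\<forall>i\<in>I. p i \<in> topspace (?X i) \<rightarrow> ?A" using p by auto
  note ts = topspace_final_topology[OF p] topspace_final_topology[OF q]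
  show "topspace (subtopology ?F {y. Q y}) = topspace (final_topology ?A I ?X p)"
    by (auto simp: ts)
  fix B assume "B \<subseteq> topspace (subtopology ?F {y. Q y})"
  then have BA: "B \<subseteq> ?A" by (auto simp: ts)
  have *: "closedin (?X i) {x \<in> topspace (?X i). p i x \<in> B}
      \<longleftrightarrow> closedin (X i) {x \<in> topspace (X i). p i x \<in> B}" if i: "i \<in> I" for i
  proof -
    have 1: "{x \<in> topspace (?X i). p i x \<in> B} = {x \<in> topspace (X i). p i x \<in> B}"
      using BA by auto
    have 2: "?X i = subtopology (X i) {x \<in> topspace (X i). p i x \<in> ?A}"
      by (rule subtopology_cong) (use p i in auto)
    have 3: "closedin (X i) {x \<in> topspace (X i). p i x \<in> ?A}" using cA i by blast
    show ?thesis unfolding 1 unfolding 2 closedin_closed_subtopology[OF 3] using BA by blast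
  qed
  have 4: "subtopology ?F {y. Q y} = subtopology ?F ?A"
    by (rule subtopology_cong) (auto simp: ts)
  show "closedin (subtopology ?F {y. Q y}) B \<longleftrightarrow> closedin (final_topology ?A I ?X p) B"
    unfolding 4 closedin_closed_subtopology[OF A] closedin_final_topology[OF p]
      closedin_final_topology[OF q] using * BA by blast
qed

lemma final_topology_cong:
  assumes "S = S'" "\<And>i. i \<in> I \<Longrightarrow> X i = X' i"
    "\<And>i x. i \<in> I \<Longrightarrow> x \<in> topspace (X i) \<Longrightarrow> p i x = p' i x"
  shows "final_topology S I X p = final_topology S' I X' p'"
proof -
  have "{x \<in> topspace (X i). p i x \<in> W} = {x \<in> topspace (X' i). p' i x \<in> W}" if "i \<in> I" for i W
    using assms that by auto
  then show ?thesis using assms(1,2) by (auto simp: final_topology_def)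
qed

lemma topspace_transport [simp]: "topspace (transport e X) = e ` topspace X"
  unfolding transport_def by (rule topspace_final_topology) auto

lemma openin_transport:
  "openin (transport e X) W \<longleftrightarrow> W \<subseteq> e ` topspace X \<and> openin X {x \<in> topspace X. e x \<in> W}"
  by (simp add: transport_def openin_final_topology)

lemma closedin_transport:
  "closedin (transport e X) W \<longleftrightarrow> W \<subseteq> e ` topspace X \<and> closedin X {x \<in> topspace X. e x \<in> W}"
  unfolding transport_def by (subst closedin_final_topology) auto

lemma continuous_map_transport: "continuous_map X (transport e X) e"
  unfolding transport_def
  using continuous_map_into_final_topology[of "{()}" "\<lambda>_. e" "\<lambda>_. X" "e ` topspace X" "()"]
  by simp

lemma subtopology_transport:
  assumes "closedin (transport e X) {y \<in> topspace (transport e X). Q y}"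
  shows "subtopology (transport e X) {y. Q y} = transport e (subtopology X {x. Q (e x)})"
proof -
  have *: "e ` topspace (subtopology X {x. Q (e x)}) = {y \<in> e ` topspace X. Q y}" by auto
  have A: "closedin (final_topology (e ` topspace X) {()} (\<lambda>_. X) (\<lambda>_. e)) {y \<in> e ` topspace X. Q y}"
    using assms unfolding topspace_transport unfolding transport_def .
  show ?thesis unfolding transport_def *
    by (rule subtopology_final_topology[OF _ A]) auto
qed

lemma continuous_map_from_transport:
  assumes "continuous_map X Y (\<lambda>x. m (e x))"
  shows "continuous_map (transport e X) Y m"
  unfolding transport_def
  by (rule continuous_map_from_final_topology)
    (use assms in \<open>auto simp: continuous_map_def\<close>)

lemma topology_eqI:
  assumes a: "continuous_map X Y (\<lambda>x. x)" and b: "continuous_map Y X (\<lambda>x. x)"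
  shows "X = Y"
proof -
  have ts: "topspace X = topspace Y"
    using a b unfolding continuous_map_def by blast
  have "openin X W \<longleftrightarrow> openin Y W" for W
  proof
    assume W: "openin X W"
    then have "openin Y {x \<in> topspace Y. x \<in> W}" by (rule openin_continuous_map_preimage[OF b])
    moreover have "{x \<in> topspace Y. x \<in> W} = W" using ts openin_subset[OF W] by auto
    ultimately show "openin Y W" by simp
  next
    assume W: "openin Y W"
    then have "openin X {x \<in> topspace X. x \<in> W}" by (rule openin_continuous_map_preimage[OF a])
    moreover have "{x \<in> topspace X. x \<in> W} = W" using ts openin_subset[OF W] by auto
    ultimately show "openin X W" by simp
  qed
  then show ?thesis by (simp add: topology_eq)
qed

text \<open>Meant for two homotopy limits on different types with the same encodings: maps in both
  directions that respect the encodings make the identity continuous both ways.\<close>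

lemma transport_eqI:
  assumes \<phi>: "continuous_map X X' \<phi>" "\<And>x. x \<in> topspace X \<Longrightarrow> e' (\<phi> x) = e x"
    and \<psi>: "continuous_map X' X \<psi>" "\<And>x. x \<in> topspace X' \<Longrightarrow> e (\<psi> x) = e' x"
  shows "transport e X = transport e' X'"
proof -
  have "continuous_map (transport e X) (transport e' X') (\<lambda>x. x)"
    by (rule continuous_map_from_transport, rule continuous_map_eq
        [OF continuous_map_compose[OF \<phi>(1) continuous_map_transport]]) (use \<phi>(2) in auto)
  moreover have "continuous_map (transport e' X') (transport e X) (\<lambda>x. x)"
    by (rule continuous_map_from_transport, rule continuous_map_eq
        [OF continuous_map_compose[OF \<psi>(1) continuous_map_transport]]) (use \<psi>(2) in auto)
  ultimately show ?thesis by (rule topology_eqI)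
qed

lemma homeomorphic_map_transport:
  assumes "inj_on e (topspace X)"
  shows "homeomorphic_map X (transport e X) e"
proof -
  have "{x \<in> topspace X. e x \<in> e ` U} = U" if "openin X U" for U
    using openin_subset[OF that] assms by (auto dest: inj_onD)
  then have "open_map X (transport e X) e"
    unfolding open_map_def by (auto simp: openin_transport dest: openin_subset)
  then show ?thesis
    using assms by (auto intro: bijective_open_imp_homeomorphic_map continuous_map_transport)
qed

section \<open>k-ification with test spaces on an arbitrary type\<close>

text \<open>
  Test spaces may live on any type here.  Enlarging the type only adds tests, so k-ifications of
  spaces on different types can be compared along an injection of the types.
\<close>

definition tests_open :: "'t itself \<Rightarrow> 'a topology \<Rightarrow> 'a set \<Rightarrow> bool" where
  "tests_open ty X W \<longleftrightarrow> W \<subseteq> topspace X \<and>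
     (\<forall>(C :: 't topology) u. compact_space C \<and> Hausdorff_space C \<and> continuous_map C X u \<longrightarrow>
        openin C {c \<in> topspace C. u c \<in> W})"

lemma k_open_tests_open: "k_open X W \<longleftrightarrow> tests_open TYPE('a set set) (X :: 'a topology) W"
  by (auto simp: k_open_def tests_open_def test_map_def)

text \<open>\<open>transport j\<close> makes a homeomorphic copy of a test space on the larger type,
  and a test map factors through the copy.\<close>

lemma tests_open_inj:
  fixes j :: "'s \<Rightarrow> 't"
  assumes j: "inj j" and W: "tests_open TYPE('t) X W"
  shows "tests_open TYPE('s) X W"
  unfolding tests_open_def
proof (intro conjI allI impI)
  show "W \<subseteq> topspace X" using W by (simp add: tests_open_def)
  fix C :: "'s topology" and u
  assume C: "compact_space C \<and> Hausdorff_space C \<and> continuous_map C X u"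
  let ?C = "transport j C"
  have h: "homeomorphic_map C ?C j"
    using j by (intro homeomorphic_map_transport) (auto intro: inj_on_subset)
  then have hs: "C homeomorphic_space ?C"
    unfolding homeomorphic_space_def homeomorphic_map_maps by blast
  obtain i where i: "homeomorphic_maps C ?C j i" using h homeomorphic_map_maps by blast
  have "openin ?C {c \<in> topspace ?C. (u \<circ> i) c \<in> W}"
  proof -
    have "compact_space ?C" "Hausdorff_space ?C"
      using C hs homeomorphic_compact_space homeomorphic_Hausdorff_space by blast+
    moreover have "continuous_map ?C X (u \<circ> i)"
      using i C by (auto simp: homeomorphic_maps_def intro: continuous_map_compose)
    ultimately show ?thesis using W unfolding tests_open_def by blast
  qed
  then have "openin C {c \<in> topspace C. j c \<in> {c \<in> topspace ?C. (u \<circ> i) c \<in> W}}"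
    by (rule openin_continuous_map_preimage[OF homeomorphic_imp_continuous_map[OF h]])
  moreover have "{c \<in> topspace C. j c \<in> {c \<in> topspace ?C. (u \<circ> i) c \<in> W}}
      = {c \<in> topspace C. u c \<in> W}"
    using i by (auto simp: homeomorphic_maps_def)
  ultimately show "openin C {c \<in> topspace C. u c \<in> W}" by simp
qed

lemma tests_open_preimage:
  fixes ty :: "'t itself"
  assumes f: "continuous_map X Y f" and W: "tests_open ty Y W"
  shows "tests_open ty X {x \<in> topspace X. f x \<in> W}"
  unfolding tests_open_def
proof (intro conjI allI impI)
  fix C :: "'t topology" and u
  assume C: "compact_space C \<and> Hausdorff_space C \<and> continuous_map C X u"
  then have "continuous_map C Y (f \<circ> u)" using f continuous_map_compose by blast
  then have "openin C {c \<in> topspace C. (f \<circ> u) c \<in> W}"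
    using W C unfolding tests_open_def by blast
  moreover have "{c \<in> topspace C. (f \<circ> u) c \<in> W}
      = {c \<in> topspace C. u c \<in> {x \<in> topspace X. f x \<in> W}}"
    using C by (auto simp: continuous_map_def)
  ultimately show "openin C {c \<in> topspace C. u c \<in> {x \<in> topspace X. f x \<in> W}}" by simp
qed auto

lemma openin_imp_tests_open: "openin X W \<Longrightarrow> tests_open ty X W"
  by (auto simp: tests_open_def openin_subset openin_continuous_map_preimage)

text \<open>Compact generation without any separation axiom. The type is a parameter since the
  condition gets weaker as the type of the tests grows.\<close>

definition test_generated :: "'t itself \<Rightarrow> 'a topology \<Rightarrow> bool" where
  "test_generated ty X \<longleftrightarrow> (\<forall>W. tests_open ty X W \<longrightarrow> openin X W)"

lemma topspace_kify [simp]: "topspace (kify X) = topspace X"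
proof
  show "topspace (kify X) \<subseteq> topspace X"
    using openin_topspace[of "kify X"] unfolding openin_kify k_open_def by blast
  have "openin (kify X) (topspace X)"
    unfolding openin_kify k_open_tests_open by (rule openin_imp_tests_open) simp
  then show "topspace X \<subseteq> topspace (kify X)" by (rule openin_subset)
qed

lemma openin_kifyI: "openin X W \<Longrightarrow> openin (kify X) W"
  unfolding openin_kify k_open_tests_open by (rule openin_imp_tests_open)

lemma closedin_kifyI: "closedin X W \<Longrightarrow> closedin (kify X) W"
  unfolding closedin_def by (simp add: openin_kifyI)

lemma continuous_map_kify_id: "continuous_map (kify X) X (\<lambda>x. x)"
proof -
  have "{x \<in> topspace X. x \<in> U} = U" if "openin X U" for U using openin_subset[OF that] by auto
  then show ?thesis by (auto simp: continuous_map_def openin_kifyI)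
qed

lemma inj_image: "inj j \<Longrightarrow> inj (image j)"
  by (simp add: inj_on_def inj_image_eq_iff)

text \<open>The preimage of a k-open set passes all tests from the type that belongs to
  \<open>Y\<close>, and \<open>X\<close> recognizes such sets as open.\<close>

lemma continuous_map_into_kify:
  fixes X :: "'a topology" and Y :: "'b topology"
  assumes f: "continuous_map X Y f" and X: "test_generated TYPE('b set set) X"
  shows "continuous_map X (kify Y) f"
  unfolding continuous_map_def
proof (intro conjI allI impI)
  fix U assume "openin (kify Y) U"
  then show "openin X {x \<in> topspace X. f x \<in> U}"
    using tests_open_preimage[OF f] X
    unfolding openin_kify k_open_tests_open test_generated_def by blast
qed (use f in \<open>auto simp: continuous_map_def\<close>)

text \<open>A test map into \<open>X\<close> is automatically continuous into \<open>kify X\<close>,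
  so both spaces have the same tests.\<close>

lemma test_generated_kify: "test_generated TYPE('a set set) (kify (X :: 'a topology))"
  unfolding test_generated_def openin_kify k_open_tests_open tests_open_def
proof (intro allI impI conjI)
  fix W C and u :: "'a set set \<Rightarrow> 'a"
  assume W: "W \<subseteq> topspace (kify X) \<and> (\<forall>(C :: 'a set set topology) u. compact_space C \<and>
      Hausdorff_space C \<and> continuous_map C (kify X) u \<longrightarrow> openin C {c \<in> topspace C. u c \<in> W})"
  assume C: "compact_space C \<and> Hausdorff_space C \<and> continuous_map C X u"
  have "continuous_map C (kify X) u"
    unfolding continuous_map_def
  proof (intro conjI allI impI)
    fix U assume "openin (kify X) U"
    then show "openin C {x \<in> topspace C. u x \<in> U}"
      using C unfolding openin_kify k_open_def test_map_def by blast
  qed (use C in \<open>auto simp: continuous_map_def\<close>)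
  then show "openin C {c \<in> topspace C. u c \<in> W}" using W C by blast
qed auto

lemma test_generated_inj:
  fixes j :: "'s \<Rightarrow> 't"
  assumes "inj j" "test_generated TYPE('s) X"
  shows "test_generated TYPE('t) X"
  using assms tests_open_inj unfolding test_generated_def by blast

lemma continuous_map_kify:
  fixes X :: "'a topology" and Y :: "'b topology" and j :: "'a \<Rightarrow> 'b"
  assumes j: "inj j" and f: "continuous_map X Y f"
  shows "continuous_map (kify X) (kify Y) f"
proof (rule continuous_map_into_kify)
  show "continuous_map (kify X) Y f"
    using continuous_map_compose[OF continuous_map_kify_id f] by (simp add: comp_def)
  show "test_generated TYPE('b set set) (kify X)"
    \<comment> \<open>Tests live on double power sets, hence the injection is lifted through
      \<open>image\<close> twice.\<close>
    by (rule test_generated_inj[OF inj_image[OF inj_image[OF j]] test_generated_kify])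
qed

lemma test_generated_transport:
  assumes "test_generated ty X"
  shows "test_generated ty (transport e X)"
  unfolding test_generated_def
proof (intro allI impI)
  fix W assume W: "tests_open ty (transport e X) W"
  then have "openin X {x \<in> topspace X. e x \<in> W}"
    using tests_open_preimage[OF continuous_map_transport] assms test_generated_def by blast
  then show "openin (transport e X) W"
    using W by (simp add: openin_transport tests_open_def)
qed

text \<open>A test map into \<open>X\<close> restricts to a test map into \<open>A\<close> on the
  preimage of \<open>A\<close>; this preimage is again compact because \<open>A\<close> is
  closed.\<close>

lemma kify_subtopology:
  assumes A: "closedin X A"
  shows "kify (subtopology X A) = subtopology (kify X) A"
proof -
  have AX: "A \<subseteq> topspace X" using A closedin_subset by blast
  have cA: "closedin (kify X) A" by (rule closedin_kifyI[OF A])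
  \<comment> \<open>Adding the complement of \<open>A\<close> turns openness relative to the closed
    set \<open>A\<close> into openness in the whole space.\<close>
  have *: "openin (kify (subtopology X A)) W \<longleftrightarrow> openin (kify X) (W \<union> (topspace X - A))"
    if "W \<subseteq> A" for W
  proof
    assume W: "openin (kify (subtopology X A)) W"
    show "openin (kify X) (W \<union> (topspace X - A))"
      unfolding openin_kify k_open_def
    proof (intro conjI allI impI)
      show "W \<union> (topspace X - A) \<subseteq> topspace X" using that AX by auto
      fix C and u :: "_ \<Rightarrow> 'a" assume C: "test_map C X u"
      define CA where "CA = {c \<in> topspace C. u c \<in> A}"
      have clCA: "closedin C CA"
        using C A unfolding CA_def test_map_def by (auto intro: closedin_continuous_map_preimage)
      have "test_map (subtopology C CA) (subtopology X A) u"
        using C clCA unfolding test_map_def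
        by (auto simp: CA_def continuous_map_in_subtopology Hausdorff_space_subtopology
            closedin_compact_space compact_space_subtopology
            intro: continuous_map_from_subtopology)
      then have "openin (subtopology C CA) {c \<in> topspace (subtopology C CA). u c \<in> W}"
        using W unfolding openin_kify k_open_def by blast
      then have "closedin (subtopology C CA)
          (topspace (subtopology C CA) - {c \<in> topspace (subtopology C CA). u c \<in> W})"
        by blast
      then have "closedin C
          (topspace (subtopology C CA) - {c \<in> topspace (subtopology C CA). u c \<in> W})"
        using closedin_closed_subtopology[OF clCA] by blast
      then have "openin C (topspace C -
          (topspace (subtopology C CA) - {c \<in> topspace (subtopology C CA). u c \<in> W}))"
        by blast
      moreover have "topspace C -
          (topspace (subtopology C CA) - {c \<in> topspace (subtopology C CA). u c \<in> W})
          = {c \<in> topspace C. u c \<in> W \<union> (topspace X - A)}"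
        using C that unfolding CA_def test_map_def continuous_map_def by auto
      ultimately show "openin C {c \<in> topspace C. u c \<in> W \<union> (topspace X - A)}" by simp
    qed
  next
    assume W: "openin (kify X) (W \<union> (topspace X - A))"
    show "openin (kify (subtopology X A)) W"
      unfolding openin_kify k_open_def
    proof (intro conjI allI impI)
      show "W \<subseteq> topspace (subtopology X A)" using that AX by auto
      fix C and u :: "_ \<Rightarrow> 'a" assume C: "test_map C (subtopology X A) u"
      then have "test_map C X u" by (auto simp: test_map_def continuous_map_in_subtopology)
      then have "openin C {c \<in> topspace C. u c \<in> W \<union> (topspace X - A)}"
        using W unfolding openin_kify k_open_def by blast
      moreover have "{c \<in> topspace C. u c \<in> W \<union> (topspace X - A)} = {c \<in> topspace C. u c \<in> W}"
        using C unfolding test_map_def continuous_map_def by auto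
      ultimately show "openin C {c \<in> topspace C. u c \<in> W}" by simp
    qed
  qed
  show ?thesis
  proof (rule topology_eq_closedin)
    fix B assume B: "B \<subseteq> topspace (kify (subtopology X A))"
    have "closedin (kify (subtopology X A)) B \<longleftrightarrow> openin (kify (subtopology X A)) (A - B)"
      using B AX by (simp add: closedin_def Int_absorb1)
    also have "\<dots> \<longleftrightarrow> openin (kify X) ((A - B) \<union> (topspace X - A))" by (rule *) auto
    also have "(A - B) \<union> (topspace X - A) = topspace X - B" using B AX by auto
    also have "openin (kify X) (topspace X - B) \<longleftrightarrow> closedin (kify X) B"
      using B AX by (auto simp: closedin_def)
    finally show "closedin (kify (subtopology X A)) B \<longleftrightarrow> closedin (subtopology (kify X) A) B"
      using closedin_closed_subtopology[OF cA, of B] B by auto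
  qed auto
qed

section \<open>The compact-open topology\<close>

lemma topspace_compact_open:
  "topspace (compact_open_topology A B) = {f \<in> extensional (topspace A). continuous_map A B f}"
proof -
  let ?G = "{{f \<in> extensional (topspace A). continuous_map A B f \<and> f ` K \<subseteq> W} | K W.
        compactin A K \<and> Hausdorff_space (subtopology A K) \<and> openin B W}"
  \<comment> \<open>The empty compact set imposes no condition, so this subbasic set contains every
    continuous map.\<close>
  have "{f \<in> extensional (topspace A). continuous_map A B f \<and> f ` {} \<subseteq> topspace B} \<in> ?G"
    by (rule CollectI, intro exI[of _ "{}"] exI[of _ "topspace B"]) (auto simp: Hausdorff_space_def)
  then show ?thesis
    unfolding compact_open_topology_def topology_generated_by_topspace by auto
qed

lemma openin_compact_open:
  assumes "compactin A K" "Hausdorff_space (subtopology A K)" "openin B W"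
  shows "openin (compact_open_topology A B)
    {f \<in> extensional (topspace A). continuous_map A B f \<and> f ` K \<subseteq> W}"
  unfolding compact_open_topology_def by (rule topology_generated_by_Basis) (use assms in blast)

lemma continuous_map_into_compact_open:
  assumes "\<And>x. x \<in> topspace X \<Longrightarrow> g x \<in> extensional (topspace A) \<and> continuous_map A B (g x)"
    and "\<And>K W. compactin A K \<Longrightarrow> Hausdorff_space (subtopology A K) \<Longrightarrow> openin B W \<Longrightarrow>
      openin X {x \<in> topspace X. g x ` K \<subseteq> W}"
  shows "continuous_map X (compact_open_topology A B) g"
proof -
  have ts: "g ` topspace X \<subseteq> topspace (compact_open_topology A B)"
    using assms(1) by (auto simp: topspace_compact_open)
  show ?thesis
    unfolding compact_open_topology_def
  proof (rule continuous_on_generated_topo)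
    show "g ` topspace X \<subseteq> \<Union> {{f \<in> extensional (topspace A). continuous_map A B f \<and> f ` K \<subseteq> W} |K W.
         compactin A K \<and> Hausdorff_space (subtopology A K) \<and> openin B W}"
      using ts unfolding compact_open_topology_def topology_generated_by_topspace .
  next
    fix U assume "U \<in> {{f \<in> extensional (topspace A). continuous_map A B f \<and> f ` K \<subseteq> W} |K W.
         compactin A K \<and> Hausdorff_space (subtopology A K) \<and> openin B W}"
    then obtain K W where *: "U = {f \<in> extensional (topspace A). continuous_map A B f \<and> f ` K \<subseteq> W}"
      "compactin A K" "Hausdorff_space (subtopology A K)" "openin B W" by blast
    have "g -` U \<inter> topspace X = {x \<in> topspace X. g x ` K \<subseteq> W}"
      using assms(1) unfolding *(1) by auto
    then show "openin X (g -` U \<inter> topspace X)" using assms(2) * by simp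
  qed
qed

lemma continuous_map_compact_open_eval:
  assumes "a \<in> topspace A"
  shows "continuous_map (compact_open_topology A B) B (\<lambda>f. f a)"
  unfolding continuous_map_def
proof (intro conjI allI impI)
  fix U assume U: "openin B U"
  have "openin (compact_open_topology A B)
      {f \<in> extensional (topspace A). continuous_map A B f \<and> f ` {a} \<subseteq> U}"
    by (rule openin_compact_open) (use assms U in \<open>auto simp: Hausdorff_space_def\<close>)
  moreover have "{f \<in> extensional (topspace A). continuous_map A B f \<and> f ` {a} \<subseteq> U}
      = {f \<in> topspace (compact_open_topology A B). f a \<in> U}"
    by (auto simp: topspace_compact_open)
  ultimately show "openin (compact_open_topology A B)
      {f \<in> topspace (compact_open_topology A B). f a \<in> U}" by simp
qed (use assms in \<open>auto simp: topspace_compact_open continuous_map_def\<close>)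

text \<open>For maps with values in \<open>S\<close>, landing in the relatively open set
  \<open>W' \<inter> S\<close> is the same as landing in \<open>W'\<close>, so the two subbases
  correspond.\<close>

lemma compact_open_subtopology:
  "compact_open_topology A (subtopology B S)
     = subtopology (compact_open_topology A B) {f. f ` topspace A \<subseteq> S}" (is "?L = ?R")
proof -
  have ts: "topspace ?L = topspace ?R"
    by (auto simp: topspace_compact_open continuous_map_in_subtopology)
  have 1: "continuous_map ?R ?L (\<lambda>f. f)"
  proof (rule continuous_map_into_compact_open)
    fix K W assume K: "compactin A K" "Hausdorff_space (subtopology A K)" "openin (subtopology B S) W"
    then obtain W' where W': "openin B W'" "W = W' \<inter> S" by (auto simp: openin_subtopology)
    have "{f \<in> topspace ?R. f ` K \<subseteq> W}
      = {f \<in> extensional (topspace A). continuous_map A B f \<and> f ` K \<subseteq> W'} \<inter> {f. f ` topspace A \<subseteq> S}"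
      using compactin_subset_topspace[OF K(1)] unfolding W'(2) by (auto simp: topspace_compact_open)
    then show "openin ?R {f \<in> topspace ?R. f ` K \<subseteq> W}"
      using openin_compact_open[OF K(1,2) W'(1)] by (auto simp: openin_subtopology)
  qed (auto simp: topspace_compact_open continuous_map_in_subtopology)
  have 2: "continuous_map ?L (compact_open_topology A B) (\<lambda>f. f)"
  proof (rule continuous_map_into_compact_open)
    fix K W assume K: "compactin A K" "Hausdorff_space (subtopology A K)" "openin B W"
    have "{f \<in> topspace ?L. f ` K \<subseteq> W}
      = {f \<in> extensional (topspace A). continuous_map A (subtopology B S) f \<and> f ` K \<subseteq> W \<inter> S}"
      using compactin_subset_topspace[OF K(1)]
      by (auto simp: topspace_compact_open continuous_map_in_subtopology)
    then show "openin ?L {f \<in> topspace ?L. f ` K \<subseteq> W}"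
      using openin_compact_open[OF K(1,2), of "subtopology B S" "W \<inter> S"] K(3)
      by (auto simp: openin_subtopology)
  qed (auto simp: topspace_compact_open continuous_map_in_subtopology)
  have 3: "continuous_map ?L ?R (\<lambda>f. f)"
    using 2 by (auto simp: continuous_map_in_subtopology topspace_compact_open)
  show ?thesis by (rule topology_eqI[OF 3 1])
qed

text \<open>The subbasis uses only compact sets that are Hausdorff as subspaces. The image of such a
  \<open>K\<close> under \<open>r\<close> is compact, and the continuous left inverse
  \<open>s\<close> embeds it injectively into \<open>K\<close>, which shows that it is Hausdorff
  too.\<close>

lemma continuous_map_compact_open_compose:
  assumes r: "continuous_map A' A r" and s: "continuous_map A A' s" "\<And>a. a \<in> topspace A' \<Longrightarrow> s (r a) = a"
    and \<kappa>: "continuous_map B B' \<kappa>"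
  shows "continuous_map (compact_open_topology A B) (compact_open_topology A' B')
    (\<lambda>f. restrict (\<lambda>a. \<kappa> (f (r a))) (topspace A'))"
proof (rule continuous_map_into_compact_open)
  fix f assume "f \<in> topspace (compact_open_topology A B)"
  then have "continuous_map A' B' (\<lambda>a. \<kappa> (f (r a)))"
    using r \<kappa> continuous_map_compose[OF continuous_map_compose[OF r] \<kappa>]
    by (auto simp: topspace_compact_open comp_def)
  then show "restrict (\<lambda>a. \<kappa> (f (r a))) (topspace A') \<in> extensional (topspace A') \<and>
      continuous_map A' B' (restrict (\<lambda>a. \<kappa> (f (r a))) (topspace A'))"
    by (auto intro: continuous_map_eq)
next
  fix K W assume K: "compactin A' K" "Hausdorff_space (subtopology A' K)" "openin B' W"
  have KA: "K \<subseteq> topspace A'" using K(1) compactin_subset_topspace by blast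
  have "s ` (r ` K) \<subseteq> K" using s(2) KA by (auto simp: subset_iff)
  then have "continuous_map (subtopology A (r ` K)) (subtopology A' K) s"
    using continuous_map_from_subtopology[OF s(1)] by (auto simp: continuous_map_in_subtopology)
  moreover have "inj_on s (topspace (subtopology A (r ` K)))"
  proof (rule inj_onI)
    fix x y assume "x \<in> topspace (subtopology A (r ` K))" "y \<in> topspace (subtopology A (r ` K))"
      and e: "s x = s y"
    then obtain a b where "x = r a" "y = r b" "a \<in> K" "b \<in> K" by auto
    moreover from this have "s x = a" "s y = b" using s(2) KA by blast+
    ultimately show "x = y" using e by simp
  qed
  ultimately have "Hausdorff_space (subtopology A (r ` K))"
    using Hausdorff_space_injective_preimage[OF K(2)] by blast
  then have "openin (compact_open_topology A B) {f \<in> extensional (topspace A). continuous_map A B f \<and>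
      f ` (r ` K) \<subseteq> {b \<in> topspace B. \<kappa> b \<in> W}}"
    by (rule openin_compact_open[OF image_compactin[OF K(1) r] _
          openin_continuous_map_preimage[OF \<kappa> K(3)]])
  moreover have "{f \<in> extensional (topspace A). continuous_map A B f \<and>
      f ` (r ` K) \<subseteq> {b \<in> topspace B. \<kappa> b \<in> W}}
    = {f \<in> topspace (compact_open_topology A B). restrict (\<lambda>a. \<kappa> (f (r a))) (topspace A') ` K \<subseteq> W}"
  proof -
    have "f ` (r ` K) \<subseteq> {b \<in> topspace B. \<kappa> b \<in> W}
        \<longleftrightarrow> restrict (\<lambda>a. \<kappa> (f (r a))) (topspace A') ` K \<subseteq> W" if f: "continuous_map A B f" for f
    proof -
      have "f (r a) \<in> topspace B \<and> a \<in> topspace A'" if "a \<in> K" for a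
        using that KA continuous_map_image_subset_topspace[OF f]
          continuous_map_image_subset_topspace[OF r] by blast
      then show ?thesis by (simp add: image_subset_iff)
    qed
    note * = this
    show ?thesis
    proof (rule Collect_cong)
      fix f
      show "(f \<in> extensional (topspace A) \<and> continuous_map A B f \<and> f ` (r ` K) \<subseteq> {b \<in> topspace B. \<kappa> b \<in> W})
        \<longleftrightarrow> (f \<in> topspace (compact_open_topology A B) \<and> restrict (\<lambda>a. \<kappa> (f (r a))) (topspace A') ` K \<subseteq> W)"
        unfolding topspace_compact_open mem_Collect_eq using *[of f] by argo
    qed
  qed
  ultimately show "openin (compact_open_topology A B) {f \<in> topspace (compact_open_topology A B).
      restrict (\<lambda>a. \<kappa> (f (r a))) (topspace A') ` K \<subseteq> W}" by simp
qed

text \<open>This direction of the exponential law needs only the tube lemma: the open preimage of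
  \<open>W\<close> contains a tube around \<open>{x} \<times> K\<close>.\<close>

lemma continuous_map_curry:
  assumes g: "continuous_map (prod_topology X A) B g"
  shows "continuous_map X (compact_open_topology A B) (\<lambda>x. restrict (\<lambda>a. g (x, a)) (topspace A))"
proof (rule continuous_map_into_compact_open)
  fix x assume x: "x \<in> topspace X"
  then have "continuous_map A (prod_topology X A) (\<lambda>a. (x, a))"
    by (intro continuous_intros) auto
  then have "continuous_map A B (\<lambda>a. g (x, a))"
    using continuous_map_compose[OF _ g] by (auto simp: comp_def)
  then show "restrict (\<lambda>a. g (x, a)) (topspace A) \<in> extensional (topspace A) \<and>
      continuous_map A B (restrict (\<lambda>a. g (x, a)) (topspace A))"
    by (auto intro: continuous_map_eq)
next
  fix K W assume K: "compactin A K" "openin B W"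
  have KA: "K \<subseteq> topspace A" using K(1) compactin_subset_topspace by blast
  have op: "openin (prod_topology X A) {z \<in> topspace (prod_topology X A). g z \<in> W}"
    by (rule openin_continuous_map_preimage[OF g K(2)])
  show "openin X {x \<in> topspace X. (\<lambda>a\<in>topspace A. g (x, a)) ` K \<subseteq> W}"
  proof (subst openin_subopen, intro ballI)
    fix x assume x: "x \<in> {x \<in> topspace X. (\<lambda>a\<in>topspace A. g (x, a)) ` K \<subseteq> W}"
    let ?O = "{z \<in> topspace (prod_topology X A). g z \<in> W}"
    have xX: "x \<in> topspace X" using x by blast
    have xK: "{x} \<times> K \<subseteq> ?O" using KA x by auto
    obtain U V where UV: "openin X U" "openin A V" "x \<in> U" "K \<subseteq> V" "U \<times> V \<subseteq> ?O"
      using tube_lemma_right[OF op K(1) xX xK] by metis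
    have "U \<subseteq> {x \<in> topspace X. (\<lambda>a\<in>topspace A. g (x, a)) ` K \<subseteq> W}"
    proof
      fix y assume y: "y \<in> U"
      have "g (y, a) \<in> W" if "a \<in> K" for a using that y UV(4,5) by blast
      then show "y \<in> {x \<in> topspace X. (\<lambda>a\<in>topspace A. g (x, a)) ` K \<subseteq> W}"
        using y KA openin_subset[OF UV(1)] by (auto simp: image_subset_iff)
    qed
    then show "\<exists>T. openin X T \<and> x \<in> T \<and> T \<subseteq> {x \<in> topspace X. (\<lambda>a\<in>topspace A. g (x, a)) ` K \<subseteq> W}"
      using UV by blast
  qed
qed

section \<open>Subspaces and linear isometries\<close>

global_interpretation scl: vector_space "scl :: 'k::real_normed_field \<Rightarrow> 'k coords \<Rightarrow> 'k coords"
  by unfold_locales (auto simp: scl_def fun_eq_iff algebra_simps)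

lemma scl_apply [simp]: "scl c x i = c * x i"
  by (simp add: scl_def)

lemma fd_subspace_imp_subspace: "fd_subspace V \<Longrightarrow> scl.subspace V"
  by (auto simp: fd_subspace_def scl.subspace_span)

lemma fd_subspace_finite_support:
  assumes "fd_subspace V" "x \<in> V"
  shows "finite {i. x i \<noteq> 0}"
proof -
  obtain B where B: "\<forall>b\<in>B. finite {i. b i \<noteq> 0}" "V = scl.span B"
    using assms(1) by (auto simp: fd_subspace_def)
  have "scl.subspace {x :: 'a coords. finite {i. x i \<noteq> 0}}"
  proof (rule scl.subspaceI)
    fix x y :: "'a coords"
    assume "x \<in> {x. finite {i. x i \<noteq> 0}}" "y \<in> {x. finite {i. x i \<noteq> 0}}"
    then have "finite ({i. x i \<noteq> 0} \<union> {i. y i \<noteq> 0})" by simp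
    moreover have "{i. (x + y) i \<noteq> 0} \<subseteq> {i. x i \<noteq> 0} \<union> {i. y i \<noteq> 0}" by auto
    ultimately show "x + y \<in> {x. finite {i. x i \<noteq> 0}}"
      using finite_subset by blast
  next
    fix c and x :: "'a coords"
    assume "x \<in> {x. finite {i. x i \<noteq> 0}}"
    then show "scl c x \<in> {x. finite {i. x i \<noteq> 0}}"
      by simp
  qed simp
  moreover have "B \<subseteq> {x. finite {i. x i \<noteq> 0}}" using B(1) by auto
  ultimately have "V \<subseteq> {x. finite {i. x i \<noteq> 0}}" unfolding B(2) by (rule scl.span_minimal[rotated])
  then show ?thesis using assms(2) by auto
qed

text \<open>A maximal independent subset of \<open>U\<close> spans \<open>U\<close> and cannot have
  more elements than a finite generating set of \<open>V\<close>.\<close>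

lemma fd_subspace_subset:
  assumes V: "fd_subspace V" and U: "scl.subspace U" "U \<subseteq> V"
  shows "fd_subspace U"
proof -
  obtain C where C: "finite C" "V = scl.span C" using V by (auto simp: fd_subspace_def)
  obtain B where B: "B \<subseteq> U" "scl.independent B" "U \<subseteq> scl.span B"
    using scl.maximal_independent_subset by blast
  have "finite B" using scl.independent_span_bound[OF C(1) B(2)] B(1) U(2) C(2) by auto
  moreover have "U = scl.span B"
    using B(3) scl.span_minimal[OF B(1) U(1)] by auto
  moreover have "\<forall>b\<in>B. finite {i. b i \<noteq> 0}"
    using fd_subspace_finite_support[OF V] B(1) U(2) by blast
  ultimately show ?thesis unfolding fd_subspace_def by blast
qed

section \<open>Coordinate subspaces\<close>

definition unit_coords :: "nat \<Rightarrow> 'k::real_normed_field coords" where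
  "unit_coords j = (\<lambda>i. if i = j then 1 else 0)"

lemma unit_coords_in_std: "j < m \<Longrightarrow> unit_coords j \<in> std_space m"
  by (auto simp: unit_coords_def std_space_def)

lemma sum_coords_apply: "(\<Sum>j\<in>A. f j :: 'k::real_normed_field coords) i = (\<Sum>j\<in>A. f j i)"
  by (induction A rule: infinite_finite_induct) auto

lemma std_space_expand:
  assumes "x \<in> std_space m"
  shows "x = (\<Sum>j<m. scl (x j) (unit_coords j))"
proof
  fix i
  have "(\<Sum>j<m. x j * (if i = j then 1 else 0)) = (if i < m then x i else 0)"
    by (simp add: if_distrib[of "(*) _"] sum.delta' cong: if_cong)
  then show "x i = (\<Sum>j<m. scl (x j) (unit_coords j)) i"
    using assms by (simp add: sum_coords_apply unit_coords_def std_space_def)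
qed

lemma subspace_std_space: "scl.subspace (std_space m)"
  by (rule scl.subspaceI) (auto simp: std_space_def)

lemma std_space_eq_span: "(std_space m :: 'k::real_normed_field coords set) = scl.span (unit_coords ` {..<m})"
proof
  show "std_space m \<subseteq> (scl.span (unit_coords ` {..<m}) :: 'k coords set)"
  proof
    fix x :: "'k coords" assume "x \<in> std_space m"
    then have "x = (\<Sum>j<m. scl (x j) (unit_coords j))" by (rule std_space_expand)
    also have "\<dots> \<in> scl.span (unit_coords ` {..<m})"
      by (intro scl.span_sum scl.span_scale scl.span_base) auto
    finally show "x \<in> scl.span (unit_coords ` {..<m})" .
  qed
  show "scl.span (unit_coords ` {..<m}) \<subseteq> (std_space m :: 'k coords set)"
    by (rule scl.span_minimal[OF _ subspace_std_space]) (auto simp: unit_coords_in_std)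
qed

lemma fd_subspace_std_space: "fd_subspace (std_space m)"
  unfolding fd_subspace_def
  by (rule exI[of _ "unit_coords ` {..<m}"]) (auto simp: std_space_eq_span unit_coords_def)

section \<open>Direct sums of subspaces\<close>

lemma join_apply [simp]: "join v w (2 * i) = v i" "join v w (Suc (2 * i)) = w i"
  by (auto simp: join_def)

lemma join_evens_odds: "join (\<lambda>i. x (2 * i)) (\<lambda>i. x (2 * i + 1)) = x"
proof
  fix i show "join (\<lambda>i. x (2 * i)) (\<lambda>i. x (2 * i + 1)) i = x i"
    by (cases "even i") (auto simp: join_def elim: oddE)
qed

lemma join_eq_iff [simp]: "join v w = join v' w' \<longleftrightarrow> v = v' \<and> w = w'"
proof
  assume *: "join v w = join v' w'"
  have "v i = v' i" "w i = w' i" for i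
    using fun_cong[OF *, of "2 * i"] fun_cong[OF *, of "Suc (2 * i)"] by auto
  then show "v = v' \<and> w = w'" by auto
qed auto

lemma in_dsum_iff: "x \<in> V \<oplus>\<^sub>v W \<longleftrightarrow> (\<lambda>i. x (2 * i)) \<in> V \<and> (\<lambda>i. x (2 * i + 1)) \<in> W"
proof
  assume "x \<in> V \<oplus>\<^sub>v W" then show "(\<lambda>i. x (2 * i)) \<in> V \<and> (\<lambda>i. x (2 * i + 1)) \<in> W"
    by (auto simp: dsum_def)
next
  assume *: "(\<lambda>i. x (2 * i)) \<in> V \<and> (\<lambda>i. x (2 * i + 1)) \<in> W"
  show "x \<in> V \<oplus>\<^sub>v W" unfolding dsum_def
    using * join_evens_odds[of x, symmetric] by blast
qed

lemma join_in_dsum_iff [simp]: "join v w \<in> V \<oplus>\<^sub>v W \<longleftrightarrow> v \<in> V \<and> w \<in> W"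
  by (simp add: in_dsum_iff)

lemma join_add: "join (v + v') (w + w') = join v w + join v' (w' :: 'k::real_normed_field coords)"
  by (auto simp: join_def)

lemma join_scl: "join (scl c v) (scl c w) = scl c (join v w)"
  by (auto simp: join_def)

lemma join_zero [simp]: "join 0 0 = (0 :: 'k::real_normed_field coords)"
  by (auto simp: join_def)

lemma subspace_dsum:
  assumes "scl.subspace V" "scl.subspace W"
  shows "scl.subspace (V \<oplus>\<^sub>v W)"
proof (rule scl.subspaceI)
  show "0 \<in> V \<oplus>\<^sub>v W"
    unfolding in_dsum_iff using assms scl.subspace_0 by (auto simp: zero_fun_def)
next
  fix x y assume "x \<in> V \<oplus>\<^sub>v W" "y \<in> V \<oplus>\<^sub>v W"
  then show "x + y \<in> V \<oplus>\<^sub>v W"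
    using assms scl.subspace_add by (auto simp: dsum_def join_add[symmetric])
next
  fix c x assume "x \<in> V \<oplus>\<^sub>v W"
  then show "scl c x \<in> V \<oplus>\<^sub>v W"
    using assms scl.subspace_scale by (auto simp: dsum_def join_scl[symmetric])
qed

lemma finite_support_join:
  fixes v w :: "'k::real_normed_field coords"
  assumes "finite {i. v i \<noteq> 0}" "finite {i. w i \<noteq> 0}"
  shows "{i. join v w i \<noteq> 0} = (\<lambda>i. 2 * i) ` {i. v i \<noteq> 0} \<union> (\<lambda>i. Suc (2 * i)) ` {i. w i \<noteq> 0}"
    and "finite {i. join v w i \<noteq> 0}"
proof -
  show *: "{i. join v w i \<noteq> 0} = (\<lambda>i. 2 * i) ` {i. v i \<noteq> 0} \<union> (\<lambda>i. Suc (2 * i)) ` {i. w i \<noteq> 0}"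
  proof (rule Set.set_eqI)
    fix i show "i \<in> {i. join v w i \<noteq> 0}
      \<longleftrightarrow> i \<in> (\<lambda>i. 2 * i) ` {i. v i \<noteq> 0} \<union> (\<lambda>i. Suc (2 * i)) ` {i. w i \<noteq> 0}"
      by (cases "even i") (auto elim!: evenE oddE simp: Suc_double_not_eq_double double_not_eq_Suc_double)
  qed
  show "finite {i. join v w i \<noteq> 0}" unfolding * using assms by auto
qed

text \<open>The generators of both summands, padded with zeros, span a space containing the direct
  sum, and subspaces of finite-dimensional spaces are finite dimensional.\<close>

lemma fd_subspace_dsum:
  fixes V W :: "'k::real_normed_field coords set"
  assumes "fd_subspace V" "fd_subspace W"
  shows "fd_subspace (V \<oplus>\<^sub>v W)"
proof -
  obtain B where B: "finite B" "\<forall>b\<in>B. finite {i. b i \<noteq> 0}" "V = scl.span B"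
    using assms(1) by (auto simp: fd_subspace_def)
  obtain C where C: "finite C" "\<forall>b\<in>C. finite {i. b i \<noteq> 0}" "W = scl.span C"
    using assms(2) by (auto simp: fd_subspace_def)
  define G where "G = (\<lambda>b. join b 0) ` B \<union> (\<lambda>b. join 0 b) ` C"
  have fin: "\<forall>b\<in>G. finite {i. b i \<noteq> 0}"
    unfolding G_def using B(2) C(2) finite_support_join(2)[where w = 0] finite_support_join(2)[where v = 0]
    by auto
  have lin: "scl.span A \<subseteq> {v. L v \<in> scl.span G}"
    if "\<And>v w. L (v + w) = L v + L w" "\<And>c v. L (scl c v) = scl c (L v)" "L 0 = 0" "L ` A \<subseteq> G"
    for L :: "'k coords \<Rightarrow> 'k coords" and A
  proof (rule scl.span_minimal)
    show "A \<subseteq> {v. L v \<in> scl.span G}" using that(4) by (auto intro: scl.span_base)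
    show "scl.subspace {v. L v \<in> scl.span G}"
      by (rule scl.subspaceI)
        (simp_all only: mem_Collect_eq that(1-3) scl.span_zero scl.span_add scl.span_scale)
  qed
  have VG: "V \<subseteq> {v. join v 0 \<in> scl.span G}"
    unfolding B(3) using join_add[of _ _ 0 0] join_scl[of _ _ 0] by (intro lin) (auto simp: G_def)
  have WG: "W \<subseteq> {v. join 0 v \<in> scl.span G}"
    unfolding C(3) using join_add[of 0 0] join_scl[of _ 0] by (intro lin) (auto simp: G_def)
  have "V \<oplus>\<^sub>v W \<subseteq> scl.span G"
  proof
    fix x assume "x \<in> V \<oplus>\<^sub>v W"
    then obtain v w where x: "x = join v w" "v \<in> V" "w \<in> W" by (auto simp: dsum_def)
    have "join v w = join v 0 + join 0 w" by (simp flip: join_add)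
    moreover have "join v 0 \<in> scl.span G" "join 0 w \<in> scl.span G" using x VG WG by auto
    ultimately show "x \<in> scl.span G" using x(1) scl.span_add by metis
  qed
  moreover have "finite G" using B(1) C(1) by (simp add: G_def)
  then have "fd_subspace (scl.span G)"
    unfolding fd_subspace_def using fin by (intro exI[of _ G] conjI refl)
  moreover have "scl.subspace (V \<oplus>\<^sub>v W)"
    using assms by (intro subspace_dsum fd_subspace_imp_subspace)
  ultimately show ?thesis using fd_subspace_subset by blast
qed

section \<open>Norms and linear isometries\<close>

lemma sq_norm_superset:
  assumes "finite S" "{i. x i \<noteq> 0} \<subseteq> S"
  shows "sq_norm x = (\<Sum>i\<in>S. (norm (x i))\<^sup>2)"
  unfolding sq_norm_def by (rule sum.mono_neutral_left) (use assms in auto)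

lemma sq_norm_join:
  assumes "finite {i. v i \<noteq> 0}" "finite {i. w i \<noteq> 0}"
  shows "sq_norm (join v w) = sq_norm v + sq_norm (w :: 'k::real_normed_field coords)"
proof -
  have "sq_norm (join v w) = (\<Sum>i\<in>(\<lambda>i. 2 * i) ` {i. v i \<noteq> 0}. (norm (join v w i))\<^sup>2)
      + (\<Sum>i\<in>(\<lambda>i. Suc (2 * i)) ` {i. w i \<noteq> 0}. (norm (join v w i))\<^sup>2)"
    unfolding sq_norm_def finite_support_join(1)[OF assms]
    by (rule sum.union_disjoint) (use assms in \<open>auto simp: Suc_double_not_eq_double double_not_eq_Suc_double\<close>)
  also have "\<dots> = sq_norm v + sq_norm w"
    unfolding sq_norm_def by (subst (1 2) sum.reindex) (auto simp: inj_on_def)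
  finally show ?thesis .
qed

text \<open>A sum over an infinite support has the value 0 by convention, so finiteness of the
  support is what makes \<open>sq_norm\<close> definite.\<close>

lemma sq_norm_eq_0:
  assumes "finite {i. x i \<noteq> 0}" "sq_norm x = 0"
  shows "x = 0"
proof -
  have "\<forall>i\<in>{i. x i \<noteq> 0}. (norm (x i))\<^sup>2 = 0"
    using assms unfolding sq_norm_def by (subst (asm) sum_nonneg_eq_0_iff) auto
  then show ?thesis by (auto simp: fun_eq_iff)
qed

lemma sq_norm_zero [simp]: "sq_norm 0 = 0"
  by (simp add: sq_norm_def)

lemma mor_in: "f \<in> mor V W \<Longrightarrow> x \<in> V \<Longrightarrow> f x \<in> W"
  and mor_add: "f \<in> mor V W \<Longrightarrow> x \<in> V \<Longrightarrow> y \<in> V \<Longrightarrow> f (x + y) = f x + f y"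
  and mor_scl: "f \<in> mor V W \<Longrightarrow> x \<in> V \<Longrightarrow> f (scl c x) = scl c (f x)"
  and mor_sq_norm: "f \<in> mor V W \<Longrightarrow> x \<in> V \<Longrightarrow> sq_norm (f x) = sq_norm x"
  and mor_outside: "f \<in> mor V W \<Longrightarrow> x \<notin> V \<Longrightarrow> f x = 0"
  by (auto simp: mor_def)

text \<open>If 0 lies outside \<open>V\<close>, the default value decides. Together with the default
  this shows that composites of morphisms vanish outside their domain.\<close>

lemma mor_zero:
  assumes "f \<in> mor V W" shows "f 0 = 0"
proof (cases "0 \<in> V")
  case True
  then have "f (scl 0 0) = scl 0 (f 0)" using mor_scl[OF assms] by blast
  then show ?thesis by simp
qed (use mor_outside[OF assms] in auto)

lemma mor_comp:
  assumes "f \<in> mor V W" "g \<in> mor W X"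
  shows "g \<circ> f \<in> mor V X"
  using assms mor_zero[OF assms(2)] unfolding mor_def by (auto simp: image_subset_iff)

lemma incl_in_mor: "scl.subspace V \<Longrightarrow> V \<subseteq> W \<Longrightarrow> incl V \<in> mor V W"
  by (auto simp: mor_def incl_def scl.subspace_add scl.subspace_scale)

lemma dsum_mor_join [simp]:
  "v \<in> V \<Longrightarrow> w \<in> W \<Longrightarrow> dsum_mor V W f g (join v w) = join (f v) (g w)"
  by (simp add: dsum_mor_def)

lemma dsum_mor_outside: "x \<notin> V \<oplus>\<^sub>v W \<Longrightarrow> dsum_mor V W f g x = 0"
  by (simp add: dsum_mor_def)

lemma dsum_mor_in_mor:
  assumes f: "f \<in> mor V V'" and g: "g \<in> mor W W'"
    and fd: "fd_subspace V" "fd_subspace V'" "fd_subspace W" "fd_subspace W'"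
  shows "dsum_mor V W f g \<in> mor (V \<oplus>\<^sub>v W) (V' \<oplus>\<^sub>v W')"
proof -
  have V: "scl.subspace V" "scl.subspace W" using fd by (auto intro: fd_subspace_imp_subspace)
  have 1: "dsum_mor V W f g (join v w + join v' w')
      = dsum_mor V W f g (join v w) + dsum_mor V W f g (join v' w')"
    if "v \<in> V" "v' \<in> V" "w \<in> W" "w' \<in> W" for v v' w w'
    using that V f g
    by (simp add: join_add[symmetric] mor_add[OF f] mor_add[OF g] scl.subspace_add)
  have 2: "dsum_mor V W f g (scl c (join v w)) = scl c (dsum_mor V W f g (join v w))"
    if "v \<in> V" "w \<in> W" for c v w
    using that V f g
    by (simp add: join_scl[symmetric] mor_scl[OF f] mor_scl[OF g] scl.subspace_scale)
  have 3: "sq_norm (dsum_mor V W f g (join v w)) = sq_norm (join v w)" if "v \<in> V" "w \<in> W" for v w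
  proof -
    have "f v \<in> V'" "g w \<in> W'" using that f g by (auto intro: mor_in)
    then show ?thesis
      using that f g fd by (simp add: sq_norm_join fd_subspace_finite_support mor_sq_norm)
  qed
  show ?thesis unfolding mor_def mem_Collect_eq
  proof (intro conjI)
    show "dsum_mor V W f g ` (V \<oplus>\<^sub>v W) \<subseteq> V' \<oplus>\<^sub>v W'"
      by (auto simp: dsum_def[of V W] mor_in[OF f] mor_in[OF g])
    show "\<forall>x\<in>V \<oplus>\<^sub>v W. \<forall>y\<in>V \<oplus>\<^sub>v W. dsum_mor V W f g (x + y) = dsum_mor V W f g x + dsum_mor V W f g y"
      using 1 by (auto simp: dsum_def[of V W])
    show "\<forall>c. \<forall>x\<in>V \<oplus>\<^sub>v W. dsum_mor V W f g (scl c x) = scl c (dsum_mor V W f g x)"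
      using 2 by (auto simp: dsum_def[of V W])
    show "\<forall>x\<in>V \<oplus>\<^sub>v W. sq_norm (dsum_mor V W f g x) = sq_norm x"
      using 3 by (auto simp: dsum_def[of V W])
  qed (simp add: dsum_mor_outside)
qed

lemma dsum_mor_zero:
  assumes "f 0 = 0" "g 0 = 0"
  shows "dsum_mor V W f g (0 :: 'k::real_normed_field coords) = 0"
proof (cases "0 \<in> V \<oplus>\<^sub>v W")
  case True
  then show ?thesis
    using assms by (simp add: dsum_mor_def zero_fun_def[symmetric])
qed (simp add: dsum_mor_outside)

lemma dsum_mor_comp:
  assumes f: "f \<in> mor V V'" and g: "g \<in> mor W W'" and f': "f' \<in> mor V' V''" and g': "g' \<in> mor W' W''"
  shows "dsum_mor V' W' f' g' \<circ> dsum_mor V W f g = dsum_mor V W (f' \<circ> f) (g' \<circ> g)"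
proof
  fix x
  have 0: "dsum_mor V' W' f' g' 0 = 0"
    by (intro dsum_mor_zero mor_zero[OF f'] mor_zero[OF g'])
  show "(dsum_mor V' W' f' g' \<circ> dsum_mor V W f g) x = dsum_mor V W (f' \<circ> f) (g' \<circ> g) x"
  proof (cases "x \<in> V \<oplus>\<^sub>v W")
    case True
    then obtain v w where "x = join v w" "v \<in> V" "w \<in> W" by (auto simp: dsum_def)
    then show ?thesis by (simp add: mor_in[OF f] mor_in[OF g])
  next
    case False
    then show ?thesis by (simp add: dsum_mor_outside 0)
  qed
qed

lemma dsum_mor_incl: "dsum_mor V U (incl V) (incl U) = incl (V \<oplus>\<^sub>v U)"
proof
  fix x show "dsum_mor V U (incl V) (incl U) x = incl (V \<oplus>\<^sub>v U) x"
    by (cases "x \<in> V \<oplus>\<^sub>v U") (auto simp: dsum_mor_outside incl_def dsum_def)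
qed

lemma incl_comp_mor: "f \<in> mor V W \<Longrightarrow> incl W \<circ> f = f"
  by (rule HOL.ext) (metis comp_apply incl_def mor_in mor_outside)

lemma mor_comp_incl: "f \<in> mor V W \<Longrightarrow> f \<circ> incl V = f"
  by (rule HOL.ext) (simp add: incl_def mor_zero mor_outside)

lemma dsum_in1_in_mor:
  assumes V: "fd_subspace V" and U: "scl.subspace U"
  shows "dsum_in1 V \<in> mor V (V \<oplus>\<^sub>v U)"
proof -
  have s: "scl.subspace V" using V by (rule fd_subspace_imp_subspace)
  have "join (v + v') 0 = join v 0 + join v' (0 :: 'a coords)" for v v'
    using join_add[of v v' 0 0] by simp
  moreover have "join (scl c v) 0 = scl c (join v (0 :: 'a coords))" for c v
    using join_scl[of c v 0] by simp
  moreover have "sq_norm (join v 0) = sq_norm v" if "v \<in> V" for v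
    using sq_norm_join[of v 0] fd_subspace_finite_support[OF V that] by simp
  ultimately show ?thesis
    using s scl.subspace_0[OF U]
    by (auto simp: mor_def dsum_in1_def scl.subspace_add scl.subspace_scale)
qed

lemma incl_comp_in1:
  assumes "scl.subspace V" "scl.subspace U"
  shows "incl (V \<oplus>\<^sub>v U) \<circ> dsum_in1 V = dsum_in1 V"
  using scl.subspace_0[OF assms(2)] by (intro HOL.ext) (simp add: incl_def dsum_in1_def)

lemma mor_diff:
  assumes f: "f \<in> mor V W" and V: "scl.subspace V" and x: "x \<in> V" "y \<in> V"
  shows "f (x - y) = f x - f y"
proof -
  have m: "scl (-1) z = - z" for z :: "'a coords" by (auto simp: scl_def)
  have "f (x + scl (-1) y) = f x + scl (-1) (f y)"
    using mor_add[OF f x(1)] mor_scl[OF f x(2)] scl.subspace_scale[OF V x(2)] by metis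
  then show ?thesis unfolding m by simp
qed

lemma mor_inj_on:
  assumes f: "f \<in> mor V W" and V: "fd_subspace V"
  shows "inj_on f V"
proof (rule inj_onI)
  fix x y assume *: "x \<in> V" "y \<in> V" "f x = f y"
  have s: "scl.subspace V" using V by (rule fd_subspace_imp_subspace)
  have xy: "x - y \<in> V" using scl.subspace_diff[OF s] * by blast
  have "sq_norm (x - y) = sq_norm (f (x - y))" using mor_sq_norm[OF f xy] by simp
  also have "f (x - y) = 0" using mor_diff[OF f s] * by simp
  finally have "sq_norm (x - y) = 0" unfolding sq_norm_zero .
  then have "x - y = 0" by (rule sq_norm_eq_0[OF fd_subspace_finite_support[OF V xy]])
  then show "x = y" by simp
qed

lemma subspace_mor_image:
  assumes f: "f \<in> mor V W" and V: "scl.subspace V"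
  shows "scl.subspace (f ` V)"
proof (rule scl.subspaceI)
  show "0 \<in> f ` V" using mor_zero[OF f] scl.subspace_0[OF V] by force
  show "x + y \<in> f ` V" if "x \<in> f ` V" "y \<in> f ` V" for x y
    using that mor_add[OF f] scl.subspace_add[OF V] by (auto simp: image_iff) metis
  show "scl c x \<in> f ` V" if "x \<in> f ` V" for c x
    using that mor_scl[OF f] scl.subspace_scale[OF V] by (auto simp: image_iff) metis
qed

text \<open>Isometries are injective. The inverse on the image, extended by 0, is again a morphism,
  and the two composites are inclusions of a space into itself, that is, identities of the
  category.\<close>

lemma mor_inverse:
  assumes f: "f \<in> mor V W" and V: "fd_subspace V"
  obtains g where "g \<in> mor (f ` V) V" "g \<circ> f = incl V" "f \<circ> g = incl (f ` V)"
proof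
  define g where "g y = (if y \<in> f ` V then inv_into V f y else 0)" for y
  have s: "scl.subspace V" using V by (rule fd_subspace_imp_subspace)
  have inj: "inj_on f V" by (rule mor_inj_on[OF f V])
  have gf: "g (f x) = x" if "x \<in> V" for x using inj that by (simp add: g_def)
  show "g \<in> mor (f ` V) V"
    unfolding mor_def mem_Collect_eq
  proof (intro conjI)
    show "g ` f ` V \<subseteq> V" using gf by auto
    show "\<forall>x\<in>f ` V. \<forall>y\<in>f ` V. g (x + y) = g x + g y"
      using gf mor_add[OF f] scl.subspace_add[OF s] by (auto simp flip: mor_add[OF f])
    show "\<forall>c. \<forall>x\<in>f ` V. g (scl c x) = scl c (g x)"
      using gf scl.subspace_scale[OF s] by (auto simp flip: mor_scl[OF f])
    show "\<forall>x\<in>f ` V. sq_norm (g x) = sq_norm x"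
      using gf mor_sq_norm[OF f] by auto
  qed (simp add: g_def)
  show "g \<circ> f = incl V"
  proof
    fix x show "(g \<circ> f) x = incl V x"
    proof (cases "x \<in> V")
      case False
      then have "(g \<circ> f) x = g (f 0)" using mor_outside[OF f] mor_zero[OF f] by simp
      then show ?thesis using False gf scl.subspace_0[OF s] by (simp add: incl_def)
    qed (simp add: gf incl_def)
  qed
  show "f \<circ> g = incl (f ` V)"
    using gf mor_zero[OF f] by (auto simp: fun_eq_iff incl_def g_def f_inv_into_f)
qed

section \<open>Frames and complexification\<close>

lemma real_frames_real: "real_frames i m = (mor (std_space i) (std_space m) :: (real coords \<Rightarrow> real coords) set)"
  by (auto simp: real_frames_def Reals_def)

section \<open>Frames of real subspaces\<close>

lemma mor_sum:
  assumes f: "f \<in> mor V W" and V: "scl.subspace V" and x: "\<And>a. a \<in> A \<Longrightarrow> x a \<in> V"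
  shows "f (\<Sum>a\<in>A. scl (c a) (x a)) = (\<Sum>a\<in>A. scl (c a) (f (x a)))"
  using x
proof (induction A rule: infinite_finite_induct)
  case (insert a A)
  have 1: "scl (c a) (x a) \<in> V" using insert.prems scl.subspace_scale[OF V] by blast
  have 2: "(\<Sum>a\<in>A. scl (c a) (x a)) \<in> V"
    using insert.prems by (intro scl.subspace_sum[OF V] scl.subspace_scale[OF V]) blast
  have 3: "f (scl (c a) (x a)) = scl (c a) (f (x a))" by (rule mor_scl[OF f]) (simp add: insert.prems)
  have 4: "f (\<Sum>a\<in>A. scl (c a) (x a)) = (\<Sum>a\<in>A. scl (c a) (f (x a)))"
    by (rule insert.IH) (simp add: insert.prems)
  show ?case unfolding sum.insert[OF insert.hyps] mor_add[OF f 1 2] 3 4 ..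
qed (auto simp: mor_zero[OF f])

lemma finite_support_std_space: "x \<in> std_space i \<Longrightarrow> finite {l. x l \<noteq> 0}"
  using fd_subspace_finite_support[OF fd_subspace_std_space] .

text \<open>The images of the \<open>i\<close> unit vectors are independent and lie in the span of
  \<open>j\<close> vectors.\<close>

lemma mor_std_space_le:
  fixes f :: "'k::real_normed_field coords \<Rightarrow> 'k coords"
  assumes f: "f \<in> mor (std_space i) (std_space j)"
  shows "i \<le> j"
proof -
  define e :: "nat \<Rightarrow> 'k coords" where "e = unit_coords"
  define B where "B = (\<lambda>k. f (e k)) ` {..<i}"
  have ei: "e k \<in> std_space i" if "k < i" for k using that by (simp add: e_def unit_coords_in_std)
  have inj: "inj_on f (std_space i)" by (rule mor_inj_on[OF f fd_subspace_std_space])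
  have e_inj: "inj e" by (rule injI) (metis e_def unit_coords_def zero_neq_one)
  have inj': "inj_on (\<lambda>k. f (e k)) {..<i}"
    using inj e_inj ei by (auto simp: inj_on_def)
  have "scl.independent B"
  proof (rule scl.independent_if_scalars_zero)
    show "finite B" by (simp add: B_def)
    fix u b assume s: "(\<Sum>x\<in>B. scl (u x) x) = 0" and b: "b \<in> B"
    define c where "c k = u (f (e k))" for k
    have "0 = (\<Sum>k<i. scl (c k) (f (e k)))"
      using s unfolding B_def c_def by (subst (asm) sum.reindex[OF inj']) simp
    also have "\<dots> = f (\<Sum>k<i. scl (c k) (e k))"
      by (rule mor_sum[OF f subspace_std_space, symmetric]) (simp add: ei)
    finally have "f (\<Sum>k<i. scl (c k) (e k)) = f 0" by (simp add: mor_zero[OF f])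
    moreover have "(\<Sum>k<i. scl (c k) (e k)) \<in> std_space i"
      using ei by (intro scl.subspace_sum scl.subspace_scale subspace_std_space) blast
    ultimately have z: "(\<Sum>k<i. scl (c k) (e k)) = 0"
      using inj scl.subspace_0[OF subspace_std_space] by (auto dest: inj_onD)
    obtain k where k: "k < i" "b = f (e k)" using b by (auto simp: B_def)
    have "(\<Sum>l<i. scl (c l) (e l)) k = (\<Sum>l<i. if k = l then c l else 0)"
      by (simp add: sum_coords_apply e_def unit_coords_def if_distrib[of "(*) _"] cong: if_cong)
    also have "\<dots> = c k" using k by (simp add: sum.delta)
    finally have "c k = 0" using z by simp
    then show "u b = 0" using k by (simp add: c_def)
  qed
  moreover have "B \<subseteq> scl.span (unit_coords ` {..<j})"
    unfolding std_space_eq_span[symmetric] B_def using mor_in[OF f] ei by auto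
  ultimately have "card B \<le> card (unit_coords ` {..<j} :: 'k coords set)"
    using scl.independent_span_bound[of "unit_coords ` {..<j}" B] by simp
  also have "\<dots> \<le> j" using card_image_le[of "{..<j}" unit_coords] by simp
  finally show ?thesis using card_image[OF inj'] by (simp add: B_def)
qed

text \<open>Follow \<open>f\<close> by the inverse of \<open>g\<close> on the common image. This
  isometry and its counterpart in the other direction compare the dimensions. Hence the fibres of
  the map from frames to subspaces are the orbits of the orthogonal group.\<close>

lemma same_image_frames:
  assumes f: "f \<in> mor (std_space i) (std_space m)" and g: "g \<in> mor (std_space j) (std_space m)"
    and eq: "f ` std_space i = g ` std_space j"
  shows "i = j" and "\<exists>h\<in>mor (std_space i) (std_space i). h ` std_space i = std_space i \<and> f = g \<circ> h"
proof -
  obtain g' where g': "g' \<in> mor (g ` std_space j) (std_space j)" "g' \<circ> g = incl (std_space j)"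
      "g \<circ> g' = incl (g ` std_space j)"
    using mor_inverse[OF g fd_subspace_std_space] by metis
  obtain f' where f': "f' \<in> mor (f ` std_space i) (std_space i)"
    using mor_inverse[OF f fd_subspace_std_space] by metis
  have f1: "f \<in> mor (std_space i) (g ` std_space j)" and g1: "g \<in> mor (std_space j) (f ` std_space i)"
    using f g eq by (auto simp: mor_def)
  have h: "g' \<circ> f \<in> mor (std_space i) (std_space j)" by (rule mor_comp[OF f1 g'(1)])
  have h': "f' \<circ> g \<in> mor (std_space j) (std_space i)" by (rule mor_comp[OF g1 f'])
  show ij: "i = j" using mor_std_space_le[OF h] mor_std_space_le[OF h'] by simp
  have "g \<circ> (g' \<circ> f) = f"
    unfolding comp_assoc[symmetric] g'(3) by (rule incl_comp_mor[OF f1])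
  moreover have "(g' \<circ> f) ` std_space i = std_space i"
  proof -
    have "(g' \<circ> f) ` std_space i = (g' \<circ> g) ` std_space j" by (simp only: image_comp[symmetric] eq)
    then show ?thesis unfolding g'(2) ij by (simp add: incl_def)
  qed
  moreover have "g' \<circ> f \<in> mor (std_space i) (std_space i)" using h ij by simp
  ultimately show "\<exists>h\<in>mor (std_space i) (std_space i). h ` std_space i = std_space i \<and> f = g \<circ> h" by metis
qed

lemma mor_polarization:
  fixes f :: "real coords \<Rightarrow> real coords"
  assumes f: "f \<in> mor V W" and V: "scl.subspace V" "V \<subseteq> std_space N" "W \<subseteq> std_space N"
    and x: "x \<in> V" "y \<in> V"
  shows "(\<Sum>l<N. f x l * f y l) = (\<Sum>l<N. x l * y l)"
proof -
  have sq: "sq_norm z = (\<Sum>l<N. z l * z l)" if "z \<in> std_space N" for z :: "real coords"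
    using that by (subst sq_norm_superset[of "{..<N}"])
      (auto simp: std_space_def power2_eq_square not_le[symmetric])
  have pol: "2 * (\<Sum>l<N. a l * b l)
      = (\<Sum>l<N. (a + b) l * (a + b) l) - (\<Sum>l<N. a l * a l) - (\<Sum>l<N. b l * b l)" for a b :: "real coords"
    by (simp add: algebra_simps sum.distrib sum_distrib_left)
  have xy: "x + y \<in> V" using scl.subspace_add[OF V(1)] x by blast
  have n: "(\<Sum>l<N. f z l * f z l) = (\<Sum>l<N. z l * z l)" if "z \<in> V" for z
    using mor_sq_norm[OF f that] mor_in[OF f that] that V by (simp add: sq subset_iff)
  show ?thesis
    using pol[of "f x" "f y"] pol[of x y] n[OF xy] n[OF x(1)] n[OF x(2)] mor_add[OF f x] by simp
qed

text \<open>One step of the Gram-Schmidt process: subtract from \<open>u\<close> its projection to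
  the image of \<open>f\<close>, normalize, and send the new coordinate to the result.\<close>

lemma frame_extend:
  fixes f :: "real coords \<Rightarrow> real coords"
  assumes f: "f \<in> mor (std_space i) (std_space m)" and U: "scl.subspace U" "U \<subseteq> std_space m"
    and fU: "f ` std_space i \<subseteq> U" and u: "u \<in> U" "u \<notin> f ` std_space i"
  shows "\<exists>g\<in>mor (std_space (Suc i)) (std_space m). g ` std_space (Suc i) \<subseteq> U"
proof -
  \<comment> \<open>One coordinate beyond \<open>m\<close> leaves room for both
    \<open>std_space m\<close> and \<open>std_space (Suc i)\<close>, so that all inner products are
    sums over the same range.\<close>
  define N where "N = Suc m"
  define ip :: "real coords \<Rightarrow> real coords \<Rightarrow> real" where "ip x y = (\<Sum>l<N. x l * y l)" for x y
  have iN: "Suc i \<le> N" using mor_std_space_le[OF f] by (simp add: N_def)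
  have mN: "std_space m \<subseteq> (std_space N :: real coords set)" by (auto simp: std_space_def N_def)
  have stdN: "std_space k \<subseteq> (std_space N :: real coords set)" if "k \<le> N" for k
    using that by (auto simp: std_space_def)
  have sq: "sq_norm z = ip z z" if "z \<in> std_space N" for z :: "real coords"
    using that unfolding ip_def by (subst sq_norm_superset[of "{..<N}"])
      (auto simp: std_space_def power2_eq_square not_le[symmetric])
  have ip_add: "ip (x + y) z = ip x z + ip y z" "ip z (x + y) = ip z x + ip z y" for x y z
    by (auto simp: ip_def algebra_simps sum.distrib)
  have ip_scl: "ip (scl c x) z = c * ip x z" "ip z (scl c x) = c * ip z x" for c x z
    by (auto simp: ip_def algebra_simps sum_distrib_left)
  have ip_comm: "ip x y = ip y x" for x y by (simp add: ip_def mult.commute)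
  have ip_sum: "ip z (\<Sum>k\<in>A. scl (c k) (x k)) = (\<Sum>k\<in>A. c k * ip z (x k))" if "finite A" for z A c and x :: "nat \<Rightarrow> real coords"
    using that
  proof (induction A)
    case (insert a A)
    show ?case unfolding sum.insert[OF insert.hyps] ip_add ip_scl insert.IH ..
  qed (simp add: ip_def)
  have pres: "ip (f x) (f y) = ip x y" if "x \<in> std_space i" "y \<in> std_space i" for x y
    unfolding ip_def using iN by (intro mor_polarization[OF f subspace_std_space _ _ that] mN stdN) simp
  let ?e = "unit_coords :: nat \<Rightarrow> real coords"
  have e: "?e k \<in> std_space i" if "k < i" for k using that by (rule unit_coords_in_std)
  \<comment> \<open>The coefficients are those of the orthogonal projection of \<open>u\<close> in
    the frame \<open>f\<close>; thus \<open>f y\<close> is the projection and \<open>w\<close> is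
    orthogonal to the image.\<close>
  define y where "y = (\<Sum>k<i. scl (ip u (f (?e k))) (?e k))"
  have y: "y \<in> std_space i" unfolding y_def
    using e by (intro scl.subspace_sum scl.subspace_scale subspace_std_space) auto
  define w where "w = u - f y"
  have ip_diff: "ip (a - b) z = ip a z - ip b z" for a b z
    by (auto simp: ip_def algebra_simps sum_subtractf)
  have wU: "w \<in> U" unfolding w_def using scl.subspace_diff[OF U(1)] u(1) fU y by blast
  have "w \<noteq> 0" using u(2) y by (auto simp: w_def)
  moreover have wm: "w \<in> std_space m" using wU U(2) by auto
  ultimately have sqw: "sq_norm w > 0"
    using sq_norm_eq_0[OF finite_support_std_space[OF wm]]
    by (metis less_eq_real_def sq_norm_def sum_nonneg zero_le_power2)
  have wfe: "ip w (f (?e k)) = 0" if "k < i" for k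
  proof -
    have "ip y (?e k) = (\<Sum>l<i. if l = k then ip u (f (?e l)) else 0)"
      unfolding y_def ip_comm[of _ "?e k"] ip_sum[OF finite_lessThan]
    proof (rule sum.cong[OF refl])
      fix l assume "l \<in> {..<i}"
      have "ip (?e k) (?e l) = (\<Sum>q<N. if q = k then (if q = l then 1 else 0) else 0)"
        unfolding ip_def unit_coords_def by (rule sum.cong) auto
      also have "\<dots> = (if l = k then 1 else 0)" using that iN by (simp add: sum.delta)
      finally show "ip u (f (?e l)) * ip (?e k) (?e l) = (if l = k then ip u (f (?e l)) else 0)" by simp
    qed
    also have "\<dots> = ip u (f (?e k))" using that by simp
    finally show ?thesis using pres[OF y e[OF that]] by (simp add: w_def ip_diff)
  qed
  have wf: "ip w (f x) = 0" if x: "x \<in> std_space i" for x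
  proof -
    have "f x = f (\<Sum>k<i. scl (x k) (?e k))" using std_space_expand[OF x] by simp
    also have "\<dots> = (\<Sum>k<i. scl (x k) (f (?e k)))"
      by (rule mor_sum[OF f subspace_std_space]) (simp add: e)
    finally have "f x = (\<Sum>k<i. scl (x k) (f (?e k)))" .
    then have "ip w (f x) = (\<Sum>k<i. x k * ip w (f (?e k)))" by (simp add: ip_sum)
    also have "\<dots> = 0" by (rule sum.neutral) (simp add: wfe)
    finally show ?thesis .
  qed
  define v where "v = scl (1 / sqrt (sq_norm w)) w"
  have vU: "v \<in> U" unfolding v_def by (rule scl.subspace_scale[OF U(1) wU])
  have vv: "ip v v = 1" using sqw wm mN by (auto simp: v_def ip_scl sq[symmetric] subset_iff)
  have vf: "ip v (f x) = 0" if "x \<in> std_space i" for x using wf[OF that] by (simp add: v_def ip_scl)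
  \<comment> \<open>Outside \<open>std_space i\<close> the map \<open>f\<close> takes its default
    value 0, so a vector with one more coordinate is truncated before \<open>f\<close> is
    applied.\<close>
  define tr :: "real coords \<Rightarrow> real coords" where "tr x = (\<lambda>l. if l < i then x l else 0)" for x
  have tri: "tr x \<in> std_space i" for x by (simp add: tr_def std_space_def)
  have tr_add: "tr (x + y) = tr x + tr y" for x y by (auto simp: tr_def)
  have tr_scl: "tr (scl c x) = scl c (tr x)" for c x by (auto simp: tr_def)
  define g where "g x = (if x \<in> std_space (Suc i) then f (tr x) + scl (x i) v else 0)" for x
  have gU: "g x \<in> U" if "x \<in> std_space (Suc i)" for x
    using that fU tri vU by (auto simp: g_def intro!: scl.subspace_add[OF U(1)] scl.subspace_scale[OF U(1)])
  have s: "scl.subspace (std_space (Suc i) :: real coords set)" by (rule subspace_std_space)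
  have "g \<in> mor (std_space (Suc i)) (std_space m)"
    unfolding mor_def mem_Collect_eq
  proof (intro conjI ballI allI impI)
    show "g ` std_space (Suc i) \<subseteq> std_space m" using gU U(2) by auto
    fix x y :: "real coords" and c assume x: "x \<in> std_space (Suc i)"
    { assume y: "y \<in> std_space (Suc i)"
      show "g (x + y) = g x + g y"
        using x y scl.subspace_add[OF s x y] mor_add[OF f tri tri, of x y]
        by (auto simp: g_def tr_add algebra_simps) }
    show "g (scl c x) = scl c (g x)"
      using x scl.subspace_scale[OF s x] mor_scl[OF f tri, of c x]
      by (auto simp: g_def tr_scl algebra_simps)
    have "sq_norm (g x) = ip (g x) (g x)" using gU[OF x] U(2) mN by (intro sq) blast
    also have "\<dots> = ip (f (tr x)) (f (tr x)) + 2 * (x i * ip v (f (tr x))) + x i * x i * ip v v"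
      using x by (simp add: g_def ip_add ip_scl ip_comm[of "f (tr x)" v] algebra_simps)
    also have "\<dots> = ip (tr x) (tr x) + x i * x i" using vf vv pres tri by simp
    also have "\<dots> = ip x x"
    proof -
      have "ip x x = (\<Sum>l<N. tr x l * tr x l + (if l = i then x i * x i else 0))"
        unfolding ip_def using x by (intro sum.cong) (auto simp: tr_def std_space_def)
      then show ?thesis using iN by (simp add: sum.distrib ip_def)
    qed
    also have "\<dots> = sq_norm x" using x stdN[OF iN] by (intro sq[symmetric]) blast
    finally show "sq_norm (g x) = sq_norm x" .
  qed (simp add: g_def)
  then show ?thesis using gU by blast
qed

text \<open>A frame of greatest length inside \<open>U\<close> must exhaust \<open>U\<close>, as a
  missed vector would extend it. The search starts with the empty frame on
  \<open>std_space 0\<close>, and \<open>U \<noteq> {0}\<close> excludes length 0 at the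
  end.\<close>

lemma nonzero_subspace_frame:
  assumes U: "U \<in> nonzero_subspaces m"
  obtains i f where "i \<in> {1..m}" "f \<in> mor (std_space i) (std_space m)" "f ` std_space i = U"
proof -
  have sU: "scl.subspace U" "U \<noteq> {0}" "U \<subseteq> std_space m" using U by (auto simp: nonzero_subspaces_def)
  define P where "P i \<longleftrightarrow> (\<exists>f\<in>mor (std_space i) (std_space m). f ` std_space i \<subseteq> U)" for i
  have std0: "std_space 0 = {0 :: real coords}" by (auto simp: std_space_def)
  have P0: "P 0"
    unfolding P_def std0
    by (rule bexI[of _ "incl {0}"]) (use sU scl.subspace_0 in \<open>auto simp: incl_def intro!: incl_in_mor\<close>)
  have Pm: "\<And>i. P i \<Longrightarrow> i \<le> m" unfolding P_def using mor_std_space_le by blast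
  define i where "i = Greatest P"
  have Pi: "P i" unfolding i_def using GreatestI_nat[of P 0 m] P0 Pm by blast
  have nP: "\<not> P (Suc i)" using Greatest_le_nat[of P "Suc i" m] Pm i_def by fastforce
  obtain f where f: "f \<in> mor (std_space i) (std_space m)" "f ` std_space i \<subseteq> U"
    using Pi by (auto simp: P_def)
  have "f ` std_space i = U"
    using frame_extend[OF f(1) sU(1,3) f(2)] nP f(2) unfolding P_def by blast
  moreover have "i \<noteq> 0"
  proof
    assume "i = 0"
    then have "U = {0}" using calculation std0 mor_zero[OF f(1)] by auto
    then show False using sU(2) by blast
  qed
  ultimately show ?thesis using that[of i f] f(1) Pm[OF Pi] by auto
qed

lemma image_frame_nonzero:
  assumes "1 \<le> i" and f: "f \<in> mor (std_space i) (std_space m)"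
  shows "f ` std_space i \<in> nonzero_subspaces m"
proof -
  have "unit_coords 0 \<in> (std_space i :: real coords set)"
    using assms(1) by (simp add: unit_coords_in_std)
  moreover have "(unit_coords 0 :: real coords) \<noteq> 0"
    by (metis unit_coords_def zero_fun_apply zero_neq_one)
  moreover have "f x = 0 \<Longrightarrow> x = 0" if "x \<in> std_space i" for x
    using mor_inj_on[OF f fd_subspace_std_space] mor_zero[OF f] that
      scl.subspace_0[OF subspace_std_space] by (metis inj_onD)
  ultimately have "f ` std_space i \<noteq> {0}" by (metis image_eqI singletonD)
  then show ?thesis
    using subspace_mor_image[OF f subspace_std_space] mor_in[OF f]
    by (auto simp: nonzero_subspaces_def)
qed

lemma nonzero_subspaces_fd: "U \<in> nonzero_subspaces m \<Longrightarrow> fd_subspace U"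
  using fd_subspace_subset[OF fd_subspace_std_space] by (auto simp: nonzero_subspaces_def)

lemma ext_nonzero_real [simp]: "U \<in> nonzero_subspaces m \<Longrightarrow> ext U = U"
  by (rule ext_real) (simp add: nonzero_subspaces_def)

section \<open>Complexification of subspaces and isometries\<close>

lemma in_ext_iff: 
  assumes "scl.subspace U" shows "z \<in> ext U \<longleftrightarrow> Re \<circ> z \<in> U \<and> Im \<circ> z \<in> U"
proof -
  have "z = (\<lambda>i. Complex ((Re \<circ> z) i) ((Im \<circ> z) i))" by auto
  moreover have "Re \<circ> (\<lambda>i. Complex (x i) (y i)) = x" "Im \<circ> (\<lambda>i. Complex (x i) (y i)) = y" for x y
    by auto
  ultimately show ?thesis unfolding ext_complex[OF assms] mem_Collect_eq by metis
qed

lemma ext_subset_iff: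
  assumes "scl.subspace U" "scl.subspace U'"
  shows "(ext U :: complex coords set) \<subseteq> ext U' \<longleftrightarrow> U \<subseteq> U'"
proof
  assume *: "(ext U :: complex coords set) \<subseteq> ext U'"
  show "U \<subseteq> U'"
  proof
    fix x assume "x \<in> U"
    then have "(\<lambda>i. Complex (x i) 0) \<in> ext U"
      using scl.subspace_0[OF assms(1)] by (auto simp: in_ext_iff[OF assms(1)] comp_def zero_fun_def)
    then have "(\<lambda>i. Complex (x i) 0) \<in> ext U'" using * by blast
    then show "x \<in> U'" by (simp add: in_ext_iff[OF assms(2)] comp_def)
  qed
qed (auto simp: in_ext_iff assms)

lemma ext_dsum:
  assumes "scl.subspace V" "scl.subspace U"
  shows "(ext V \<oplus>\<^sub>v ext U :: complex coords set) = ext (V \<oplus>\<^sub>v U)"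
proof (rule Set.set_eqI)
  fix z :: "complex coords"
  show "z \<in> ext V \<oplus>\<^sub>v ext U \<longleftrightarrow> z \<in> ext (V \<oplus>\<^sub>v U)"
    unfolding in_ext_iff[OF subspace_dsum[OF assms]]
    by (simp add: in_dsum_iff in_ext_iff assms comp_def) blast
qed

lemma ext_std_space: "(ext (std_space i) :: complex coords set) = std_space i"
  by (rule Set.set_eqI, unfold in_ext_iff[OF subspace_std_space])
    (auto simp: std_space_def complex_eq_iff)

lemma cplx_mor_apply:
  "z \<in> ext V \<Longrightarrow> cplx_mor V f z i = Complex (f (Re \<circ> z) i) (f (Im \<circ> z) i)"
  by (simp add: cplx_mor_def)

lemma cplx_mor_outside: "z \<notin> ext V \<Longrightarrow> cplx_mor V f z = 0"
  by (simp add: cplx_mor_def)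

lemma Re_cplx_mor: "z \<in> ext V \<Longrightarrow> Re \<circ> cplx_mor V f z = f (Re \<circ> z)"
  and Im_cplx_mor: "z \<in> ext V \<Longrightarrow> Im \<circ> cplx_mor V f z = f (Im \<circ> z)"
  by (auto simp: cplx_mor_apply)

lemma complex_coords_eq_iff: "z = w \<longleftrightarrow> Re \<circ> z = Re \<circ> w \<and> Im \<circ> z = Im \<circ> w"
  by (auto simp: fun_eq_iff complex_eq_iff)

lemma sq_norm_complex:
  assumes "finite {i. z i \<noteq> 0}"
  shows "sq_norm z = sq_norm (Re \<circ> z) + sq_norm (Im \<circ> z)"
proof -
  let ?S = "{i. z i \<noteq> 0}"
  have "sq_norm (Re \<circ> z) = (\<Sum>i\<in>?S. (norm ((Re \<circ> z) i))\<^sup>2)"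
    "sq_norm (Im \<circ> z) = (\<Sum>i\<in>?S. (norm ((Im \<circ> z) i))\<^sup>2)"
    using assms by (intro sq_norm_superset; auto)+
  then show ?thesis by (simp add: sq_norm_def cmod_power2 sum.distrib)
qed

lemma finite_support_ext:
  assumes V: "fd_subspace V" and z: "z \<in> ext V"
  shows "finite {i. (z i :: complex) \<noteq> 0}"
proof -
  have "Re \<circ> z \<in> V" "Im \<circ> z \<in> V" using z in_ext_iff[OF fd_subspace_imp_subspace[OF V]] by auto
  then have "finite ({i. (Re \<circ> z) i \<noteq> 0} \<union> {i. (Im \<circ> z) i \<noteq> 0})"
    using fd_subspace_finite_support[OF V] by blast
  then show ?thesis by (rule rev_finite_subset) (auto simp: complex_eq_iff)
qed

lemma cplx_mor_in_mor:
  assumes f: "f \<in> mor V W" and V: "fd_subspace V" and W: "fd_subspace W"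
  shows "cplx_mor V f \<in> mor (ext V) (ext W)"
proof -
  have sV: "scl.subspace V" and sW: "scl.subspace W" using V W by (auto intro: fd_subspace_imp_subspace)
  have sE: "scl.subspace (ext V :: complex coords set)" unfolding ext_def by (rule scl.subspace_span)
  have mem: "Re \<circ> z \<in> V" "Im \<circ> z \<in> V" if "z \<in> ext V" for z using that in_ext_iff[OF sV] by auto
  have W': "cplx_mor V f z \<in> ext W" if "z \<in> ext V" for z
    using mem[OF that] mor_in[OF f] that by (auto simp: in_ext_iff[OF sW] Re_cplx_mor Im_cplx_mor)
  have add: "cplx_mor V f (z + w) = cplx_mor V f z + cplx_mor V f w" if "z \<in> ext V" "w \<in> ext V" for z w
  proof -
    have "Re \<circ> (z + w) = (Re \<circ> z) + (Re \<circ> w)" "Im \<circ> (z + w) = (Im \<circ> z) + (Im \<circ> w)" for z w :: "complex coords"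
      by auto
    note r = this
    have zw: "z + w \<in> ext V" by (rule scl.subspace_add[OF sE that])
    show ?thesis
      unfolding complex_coords_eq_iff[of "cplx_mor V f (z + w)"] r
        Re_cplx_mor[OF zw] Im_cplx_mor[OF zw] Re_cplx_mor[OF that(1)] Re_cplx_mor[OF that(2)]
        Im_cplx_mor[OF that(1)] Im_cplx_mor[OF that(2)]
      using mor_add[OF f] mem that by blast
  qed
  have scale: "cplx_mor V f (scl c z) = scl c (cplx_mor V f z)" if "z \<in> ext V" for c z
  proof -
    have r: "Re \<circ> scl c z = scl (Re c) (Re \<circ> z) - scl (Im c) (Im \<circ> z)"
      and i: "Im \<circ> scl c z = scl (Re c) (Im \<circ> z) + scl (Im c) (Re \<circ> z)" for z
      by (auto simp: algebra_simps)
    have sc: "scl a x \<in> V" if "x \<in> V" for a x using that scl.subspace_scale[OF sV] by blast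
    show ?thesis
      using that scl.subspace_scale[OF sE that] mem[OF that]
      by (simp add: complex_coords_eq_iff[of "cplx_mor V f (scl c z)"] Re_cplx_mor Im_cplx_mor r i
          mor_add[OF f] mor_diff[OF f sV] mor_scl[OF f] sc)
        (auto simp: fun_eq_iff)
  qed
  have nrm: "sq_norm (cplx_mor V f z) = sq_norm z" if "z \<in> ext V" for z
    using sq_norm_complex[OF finite_support_ext[OF W W'[OF that]]]
      sq_norm_complex[OF finite_support_ext[OF V that]] mem[OF that] that
    by (simp add: Re_cplx_mor Im_cplx_mor mor_sq_norm[OF f])
  show ?thesis unfolding mor_def using W' add scale nrm by (auto simp: cplx_mor_outside)
qed

lemma cplx_mor_zero:
  assumes "f \<in> mor V W" "fd_subspace V" "fd_subspace W"
  shows "cplx_mor V f 0 = 0"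
  by (rule mor_zero[OF cplx_mor_in_mor[OF assms]])

lemma cplx_mor_comp:
  assumes f: "f \<in> mor V W" and g: "g \<in> mor W X"
    and fd: "fd_subspace V" "fd_subspace W" "fd_subspace X"
  shows "cplx_mor W g \<circ> cplx_mor V f = cplx_mor V (g \<circ> f)"
proof
  fix z show "(cplx_mor W g \<circ> cplx_mor V f) z = cplx_mor V (g \<circ> f) z"
  proof (cases "z \<in> ext V")
    case True
    then have "cplx_mor V f z \<in> ext W" by (rule mor_in[OF cplx_mor_in_mor[OF f fd(1,2)]])
    then show ?thesis using True
      by (simp add: complex_coords_eq_iff[of "cplx_mor W g (cplx_mor V f z)"] Re_cplx_mor Im_cplx_mor)
  qed (simp add: cplx_mor_outside cplx_mor_zero[OF g fd(2,3)])
qed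

lemma cplx_mor_incl:
  assumes "scl.subspace V" shows "cplx_mor V (incl V) = incl (ext V)"
proof
  fix z show "cplx_mor V (incl V) z = incl (ext V) z"
  proof (cases "z \<in> ext V")
    case True
    then have "Re \<circ> z \<in> V" "Im \<circ> z \<in> V" using in_ext_iff[OF assms] by auto
    then show ?thesis using True
      by (simp add: complex_coords_eq_iff[of "cplx_mor V (incl V) z"] Re_cplx_mor Im_cplx_mor)
        (simp add: incl_def comp_def)
  qed (simp add: cplx_mor_outside incl_def)
qed

lemma cplx_mor_dsum:
  assumes "scl.subspace V" "scl.subspace U"
  shows "cplx_mor (V \<oplus>\<^sub>v U) (dsum_mor V U f g) = dsum_mor (ext V) (ext U) (cplx_mor V f) (cplx_mor U g)"
proof
  fix z
  show "cplx_mor (V \<oplus>\<^sub>v U) (dsum_mor V U f g) z = dsum_mor (ext V) (ext U) (cplx_mor V f) (cplx_mor U g) z"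
  proof (cases "z \<in> ext (V \<oplus>\<^sub>v U)")
    case True
    then have *: "z \<in> ext V \<oplus>\<^sub>v ext U" by (simp add: ext_dsum[OF assms])
    then obtain v u where z: "z = join v u" "v \<in> ext V" "u \<in> ext U" by (auto simp: dsum_def)
    have j: "Re \<circ> join a b = join (Re \<circ> a) (Re \<circ> b)" "Im \<circ> join a b = join (Im \<circ> a) (Im \<circ> b)" for a b
      by (auto simp: join_def)
    have m: "Re \<circ> v \<in> V" "Im \<circ> v \<in> V" "Re \<circ> u \<in> U" "Im \<circ> u \<in> U"
      using z in_ext_iff assms by auto
    show ?thesis
      using True z m
      by (simp add: complex_coords_eq_iff[of "cplx_mor (V \<oplus>\<^sub>v U) (dsum_mor V U f g) (join v u)"]
          Re_cplx_mor Im_cplx_mor j)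
  next
    case False
    then show ?thesis by (simp add: cplx_mor_outside dsum_mor_outside ext_dsum[OF assms])
  qed
qed

lemma cplx_mor_in1:
  assumes "scl.subspace V"
  shows "cplx_mor V (dsum_in1 V) = dsum_in1 (ext V)"
proof
  fix z show "cplx_mor V (dsum_in1 V) z = dsum_in1 (ext V) z"
  proof (cases "z \<in> ext V")
    case True
    then have "Re \<circ> z \<in> V" "Im \<circ> z \<in> V" using in_ext_iff[OF assms] by auto
    moreover have "Re \<circ> join z 0 = join (Re \<circ> z) 0" "Im \<circ> join z 0 = join (Im \<circ> z) 0"
      by (auto simp: join_def)
    ultimately show ?thesis using True
      by (simp add: complex_coords_eq_iff[of "cplx_mor V (dsum_in1 V) z"] Re_cplx_mor Im_cplx_mor)
        (simp add: dsum_in1_def)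
  qed (simp add: cplx_mor_outside dsum_in1_def)
qed

text \<open>Real and imaginary parts are treated separately, so a preimage is assembled from a
  preimage of each part.\<close>

lemma cplx_mor_image:
  assumes f: "f \<in> mor V W" and V: "scl.subspace V"
  shows "cplx_mor V f ` ext V = ext (f ` V)"
proof
  have s: "scl.subspace (f ` V)" by (rule subspace_mor_image[OF f V])
  show "cplx_mor V f ` ext V \<subseteq> ext (f ` V)"
    by (auto simp: in_ext_iff[OF s] in_ext_iff[OF V] Re_cplx_mor Im_cplx_mor)
  show "ext (f ` V) \<subseteq> cplx_mor V f ` ext V"
  proof
    fix z :: "complex coords" assume "z \<in> ext (f ` V)"
    then obtain x y where xy: "x \<in> V" "y \<in> V" "Re \<circ> z = f x" "Im \<circ> z = f y"
      by (auto simp: in_ext_iff[OF s])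
    define w where "w = (\<lambda>i. Complex (x i) (y i))"
    have w: "Re \<circ> w = x" "Im \<circ> w = y" by (auto simp: w_def)
    then have we: "w \<in> ext V" using xy by (simp add: in_ext_iff[OF V])
    then have "z = cplx_mor V f w"
      using xy w by (simp add: complex_coords_eq_iff[of z] Re_cplx_mor Im_cplx_mor)
    then show "z \<in> cplx_mor V f ` ext V" using we by blast
  qed
qed

lemma fd_subspace_ext:
  assumes V: "fd_subspace V" shows "fd_subspace (ext V :: complex coords set)"
proof -
  obtain B where B: "finite B" "\<forall>b\<in>B. finite {i. b i \<noteq> 0}" "V = scl.span B"
    using V by (auto simp: fd_subspace_def)
  let ?c = "\<lambda>(u :: real coords) i. complex_of_real (u i)"
  have "scl.subspace {u. ?c u \<in> scl.span (?c ` B)}"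
  proof (rule scl.subspaceI)
    have "?c 0 = 0" by auto
    then show "0 \<in> {u. ?c u \<in> scl.span (?c ` B)}" using scl.span_zero by simp
    fix x y assume *: "x \<in> {u. ?c u \<in> scl.span (?c ` B)}" "y \<in> {u. ?c u \<in> scl.span (?c ` B)}"
    have "?c (x + y) = ?c x + ?c y" by auto
    then show "x + y \<in> {u. ?c u \<in> scl.span (?c ` B)}"
      using * scl.span_add[of "?c x" "?c ` B" "?c y"] by simp
  next
    fix c x assume *: "x \<in> {u. ?c u \<in> scl.span (?c ` B)}"
    have "?c (scl c x) = scl (of_real c) (?c x)" by auto
    then show "scl c x \<in> {u. ?c u \<in> scl.span (?c ` B)}"
      using * scl.span_scale[of "?c x" "?c ` B" "of_real c"] by simp
  qed
  moreover have "B \<subseteq> {u. ?c u \<in> scl.span (?c ` B)}" by (auto intro: scl.span_base)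
  ultimately have "V \<subseteq> {u. ?c u \<in> scl.span (?c ` B)}" unfolding B(3) by (rule scl.span_minimal[rotated])
  then have "?c ` V \<subseteq> scl.span (?c ` B)" by auto
  then have "ext V \<subseteq> scl.span (?c ` B)" unfolding ext_def by (rule scl.span_minimal) (rule scl.subspace_span)
  moreover have "scl.span (?c ` B) \<subseteq> ext V"
    unfolding ext_def using scl.span_superset[of B] B(3) by (intro scl.span_mono image_mono) auto
  ultimately have "ext V = scl.span (?c ` B)" by simp
  moreover have "finite (?c ` B)" using B(1) by simp
  moreover have "\<forall>b\<in>?c ` B. finite {i. b i \<noteq> 0}" using B(2) by simp
  ultimately show ?thesis unfolding fd_subspace_def by blast
qed

lemma conjv_in_ext:
  assumes V: "scl.subspace V" and z: "z \<in> ext V" shows "conjv z \<in> ext V"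
proof -
  have "Re \<circ> conjv z = Re \<circ> z" "Im \<circ> conjv z = scl (-1) (Im \<circ> z)" by (auto simp: conjv_def)
  then show ?thesis using z scl.subspace_scale[OF V, of "Im \<circ> z" "-1"] by (simp add: in_ext_iff[OF V])
qed

lemma conjv_conjv [simp]: "conjv (conjv z) = z"
  by (auto simp: conjv_def)

lemma reality_object_ext:
  assumes V: "fd_subspace V" shows "reality_object (ext V)"
proof -
  have "conjv ` ext V = ext V"
    using conjv_in_ext[OF fd_subspace_imp_subspace[OF V]] by (auto simp: image_iff) (metis conjv_conjv)
  then show ?thesis by (simp add: reality_object_def fd_subspace_ext[OF V])
qed

text \<open>A complexified map acts by the same real map on real and imaginary parts. Equivariance
  of a functor with Reality therefore becomes plain naturality of the involution along complexified
  morphisms.\<close>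

lemma conjv_cplx_mor:
  assumes f: "f \<in> mor V W" and V: "scl.subspace V"
  shows "conjv \<circ> cplx_mor V f \<circ> conjv = cplx_mor V f"
proof
  fix z show "(conjv \<circ> cplx_mor V f \<circ> conjv) z = cplx_mor V f z"
  proof (cases "z \<in> ext V")
    case True
    have c: "Re \<circ> conjv z = Re \<circ> z" "Im \<circ> conjv z = scl (-1) (Im \<circ> z)" for z by (auto simp: conjv_def)
    have "Im \<circ> z \<in> V" using True in_ext_iff[OF V] by auto
    moreover have "scl (-1) (scl (-1) x) = x" for x :: "real coords" by auto
    ultimately show ?thesis
      using True conjv_in_ext[OF V True] mor_scl[OF f, of "Im \<circ> z" "-1"]
      by (simp add: complex_coords_eq_iff[of "conjv _"] c Re_cplx_mor Im_cplx_mor mor_scl[OF f])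
        (auto simp: fun_eq_iff)
  next
    case False
    then have "conjv z \<notin> ext V" using conjv_in_ext[OF V, of "conjv z"] by auto
    moreover have "conjv 0 = 0" by (auto simp: conjv_def)
    ultimately show ?thesis using False by (simp add: cplx_mor_outside)
  qed
qed

section \<open>Homotopy limits\<close>

lemma kify_subtopology_Collect:
  assumes "closedin X {x \<in> topspace X. Q x}"
  shows "kify (subtopology X {x. Q x}) = subtopology (kify X) {x. Q x}"
proof -
  have "subtopology Y {x. Q x} = subtopology Y {x \<in> topspace X. Q x}" if "topspace Y = topspace X" for Y
    by (rule subtopology_cong) (use that in auto)
  then show ?thesis using kify_subtopology[OF assms] by simp
qed

lemma topspace_simplex_space [simp]: "topspace (simplex_space k) = standard_simplex k"
  by (simp add: simplex_space_def)

lemma topspace_chain_space: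
  "topspace (chain_space Q k) = {u \<in> {..k} \<rightarrow>\<^sub>E topspace Q. \<forall>i<k. u i \<le> u (Suc i)}"
  by (auto simp: chain_space_def)

lemma chain_space_in: "u \<in> topspace (chain_space Q k) \<Longrightarrow> i \<le> k \<Longrightarrow> u i \<in> topspace Q"
  by (auto simp: topspace_chain_space)

lemma chain_space_mono:
  assumes u: "u \<in> topspace (chain_space Q k)" and "i \<le> l" "l \<le> k"
  shows "u i \<le> u l"
  using assms(2,3)
proof (induction l rule: dec_induct)
  case (step l)
  have "u l \<le> u (Suc l)" using u step by (auto simp: topspace_chain_space)
  then show ?case using step by force
qed simp

lemma continuous_map_chain_eval:
  "i \<le> k \<Longrightarrow> continuous_map (chain_space Q k) Q (\<lambda>u. u i)"
  unfolding chain_space_def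
  by (intro continuous_map_from_subtopology continuous_map_product_projection) simp

lemma chain_space_map_in:
  assumes "\<rho> \<in> topspace Q' \<rightarrow> topspace Q"
    and "\<And>x y. x \<in> topspace Q' \<Longrightarrow> y \<in> topspace Q' \<Longrightarrow> x \<le> y \<Longrightarrow> \<rho> x \<le> \<rho> y"
    and u: "u \<in> topspace (chain_space Q' k)"
  shows "restrict (\<rho> \<circ> u) {..k} \<in> topspace (chain_space Q k)"
  using assms by (auto simp: topspace_chain_space PiE_iff)

lemma chain_space_reindex:
  assumes u: "u \<in> topspace (chain_space Q k)" and \<theta>: "\<theta> ` {..i} \<subseteq> {..k}" "mono_on {..i} \<theta>"
  shows "restrict (u \<circ> \<theta>) {..i} \<in> topspace (chain_space Q i)"
proof -
  have \<theta>k: "\<theta> l \<le> k" if "l \<le> i" for l using \<theta>(1) that by auto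
  have "u (\<theta> l) \<le> u (\<theta> (Suc l))" if "l < i" for l
    using \<theta>(2) \<theta>k[of "Suc l"] that by (intro chain_space_mono[OF u]) (auto simp: mono_on_def)
  then show ?thesis
    using chain_space_in[OF u] \<theta>k by (auto simp: topspace_chain_space)
qed

lemma continuous_map_chain_space:
  assumes \<rho>: "continuous_map Q' Q \<rho>"
    and mono: "\<And>x y. x \<in> topspace Q' \<Longrightarrow> y \<in> topspace Q' \<Longrightarrow> x \<le> y \<Longrightarrow> \<rho> x \<le> \<rho> y"
  shows "continuous_map (chain_space Q' k) (chain_space Q k) (\<lambda>u. restrict (\<rho> \<circ> u) {..k})"
proof -
  have \<rho>': "\<rho> \<in> topspace Q' \<rightarrow> topspace Q" using \<rho> by (auto simp: continuous_map_def)
  have "continuous_map (chain_space Q' k) (product_topology (\<lambda>_. Q) {..k}) (\<lambda>u. restrict (\<rho> \<circ> u) {..k})"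
    unfolding continuous_map_componentwise
  proof (intro conjI ballI)
    fix i assume i: "i \<in> {..k}"
    have "continuous_map (chain_space Q' k) Q (\<rho> \<circ> (\<lambda>u. u i))"
      using i by (intro continuous_map_compose[OF continuous_map_chain_eval \<rho>]) simp
    then show "continuous_map (chain_space Q' k) Q (\<lambda>u. restrict (\<rho> \<circ> u) {..k} i)"
      by (rule continuous_map_eq) (use i in auto)
  qed auto
  moreover have "restrict (\<rho> \<circ> u) {..k} \<in> topspace (chain_space Q k)"
    if "u \<in> topspace (chain_space Q' k)" for u by (rule chain_space_map_in[OF \<rho>' mono that])
  ultimately show ?thesis
    unfolding chain_space_def[of Q] continuous_map_in_subtopology
    by (auto simp: topspace_chain_space)
qed

lemma simplex_push_in:
  assumes t: "t \<in> standard_simplex j" and \<theta>: "\<theta> ` {..j} \<subseteq> {..k}"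
  shows "simplex_push j \<theta> t \<in> standard_simplex k"
proof -
  have t': "\<And>i. 0 \<le> t i" "(\<Sum>i\<le>j. t i) = 1" using t by (auto simp: standard_simplex_def)
  have nn: "0 \<le> simplex_push j \<theta> t i" for i
    unfolding simplex_push_def by (rule sum_nonneg) (simp add: t')
  have le: "simplex_push j \<theta> t i \<le> 1" for i
    unfolding simplex_push_def t'(2)[symmetric] by (rule sum_mono2) (auto simp: t')
  have z: "simplex_push j \<theta> t i = 0" if "i > k" for i
  proof -
    have "{l. l \<le> j \<and> \<theta> l = i} = {}" using \<theta> that by fastforce
    then show ?thesis unfolding simplex_push_def by (simp only: sum.empty)
  qed
  have "(\<Sum>i\<le>k. simplex_push j \<theta> t i) = (\<Sum>i\<le>k. \<Sum>l | l \<in> {..j} \<and> \<theta> l = i. t l)"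
    by (simp add: simplex_push_def)
  also have "\<dots> = (\<Sum>l\<in>{..j}. t l)"
    by (rule sum.group) (use \<theta> in auto)
  finally have "(\<Sum>i\<le>k. simplex_push j \<theta> t i) = 1" using t' by simp
  then show ?thesis using nn le z by (auto simp: standard_simplex_def)
qed

section \<open>Maps of homotopy limits and their closed subspaces\<close>

text \<open>The defining conditions of \<open>holim\<close>, separated from its topology. A map into
  a homotopy limit is then handled in two steps, continuity into the ambient product and membership
  in this set.\<close>

definition cosimplicial :: "'p::order topology \<Rightarrow> ('p \<Rightarrow> 'p \<Rightarrow> 'u \<Rightarrow> 'u)
    \<Rightarrow> (nat \<Rightarrow> (nat \<Rightarrow> real) \<times> (nat \<Rightarrow> 'p) \<Rightarrow> 'p \<times> 'u) set" where
  "cosimplicial Q tr =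
     {h. (\<forall>k. \<forall>t\<in>topspace (simplex_space k). \<forall>u\<in>topspace (chain_space Q k).
            fst (h k (t, u)) = u k) \<and>
         (\<forall>j k \<theta>. \<theta> ` {..j} \<subseteq> {..k} \<and> mono_on {..j} \<theta> \<longrightarrow>
            (\<forall>t\<in>topspace (simplex_space j). \<forall>u\<in>topspace (chain_space Q k).
               snd (h k (simplex_push j \<theta> t, u)) =
               tr (u (\<theta> j)) (u k) (snd (h j (t, restrict (u \<circ> \<theta>) {..j})))))}"

abbreviation holim_ambient where
  "holim_ambient Q E \<equiv> product_topology
     (\<lambda>k. compact_open_topology (prod_topology (simplex_space k) (chain_space Q k)) E) UNIV"

lemma holim_eq: "holim Q E tr = kify (subtopology (holim_ambient Q E) (cosimplicial Q tr))"
  by (simp add: holim_def cosimplicial_def)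

lemma holim_value:
  assumes "h \<in> topspace (holim Q E tr)" "t \<in> standard_simplex k" "u \<in> topspace (chain_space Q k)"
  shows "h k (t, u) \<in> topspace E" and "fst (h k (t, u)) = u k"
proof -
  have "h \<in> topspace (holim_ambient Q E)" "h \<in> cosimplicial Q tr"
    using assms(1) by (auto simp: holim_eq)
  moreover from this have "continuous_map (prod_topology (simplex_space k) (chain_space Q k)) E (h k)"
    by (auto simp: topspace_compact_open)
  ultimately show "h k (t, u) \<in> topspace E" "fst (h k (t, u)) = u k"
    using assms(2,3) by (auto simp: continuous_map_def cosimplicial_def)
qed

text \<open>Contravariant in the poset along \<rho> and covariant in the values along \<kappa>. The
  \<open>restrict\<close> keeps the result a legal point of the compact-open topology.\<close>

definition holim_map :: "'q::order topology \<Rightarrow> ('q \<Rightarrow> 'p) \<Rightarrow> ('p \<times> 'u \<Rightarrow> 'q \<times> 'v)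
    \<Rightarrow> (nat \<Rightarrow> (nat \<Rightarrow> real) \<times> (nat \<Rightarrow> 'p) \<Rightarrow> 'p \<times> 'u)
    \<Rightarrow> nat \<Rightarrow> (nat \<Rightarrow> real) \<times> (nat \<Rightarrow> 'q) \<Rightarrow> 'q \<times> 'v" where
  "holim_map Q' \<rho> \<kappa> h = (\<lambda>k. restrict (\<lambda>(t, u). \<kappa> (h k (t, restrict (\<rho> \<circ> u) {..k})))
     (standard_simplex k \<times> topspace (chain_space Q' k)))"

lemma holim_map_apply [simp]:
  "t \<in> standard_simplex k \<Longrightarrow> u \<in> topspace (chain_space Q' k) \<Longrightarrow>
   holim_map Q' \<rho> \<kappa> h k (t, u) = \<kappa> (h k (t, restrict (\<rho> \<circ> u) {..k}))"
  by (simp add: holim_map_def)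

text \<open>\<psi> provides the continuous left inverse required for precomposition in the
  compact-open topology, and \<open>j\<close> compares the test spaces of the two k-ifications. The
  lemma serves for identities of one poset and for the passage between real and complex posets,
  where \<rho> and \<psi> are \<open>ext\<close> and \<open>real_points\<close> in either
  order.\<close>

lemma continuous_map_holim:
  fixes Q :: "'p::order topology" and Q' :: "'q::order topology"
    and E :: "('p \<times> 'u) topology" and E' :: "('q \<times> 'v) topology"
    and j :: "(nat \<Rightarrow> (nat \<Rightarrow> real) \<times> (nat \<Rightarrow> 'p) \<Rightarrow> 'p \<times> 'u)
      \<Rightarrow> (nat \<Rightarrow> (nat \<Rightarrow> real) \<times> (nat \<Rightarrow> 'q) \<Rightarrow> 'q \<times> 'v)"
  assumes j: "inj j"
    and \<rho>: "continuous_map Q' Q \<rho>" and \<psi>: "continuous_map Q Q' \<psi>"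
    and \<psi>\<rho>: "\<And>q. q \<in> topspace Q' \<Longrightarrow> \<psi> (\<rho> q) = q"
    and mono: "\<And>x y. x \<in> topspace Q' \<Longrightarrow> y \<in> topspace Q' \<Longrightarrow> x \<le> y \<Longrightarrow> \<rho> x \<le> \<rho> y"
      "\<And>x y. x \<in> topspace Q \<Longrightarrow> y \<in> topspace Q \<Longrightarrow> x \<le> y \<Longrightarrow> \<psi> x \<le> \<psi> y"
    and \<kappa>: "continuous_map E E' \<kappa>"
    and fst_\<kappa>: "\<And>q x. q \<in> topspace Q' \<Longrightarrow> (\<rho> q, x) \<in> topspace E \<Longrightarrow> fst (\<kappa> (\<rho> q, x)) = q"
    and compat: "\<And>q q' x. q \<in> topspace Q' \<Longrightarrow> q' \<in> topspace Q' \<Longrightarrow> q \<le> q' \<Longrightarrow> (\<rho> q, x) \<in> topspace E \<Longrightarrow>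
      snd (\<kappa> (\<rho> q', tr (\<rho> q) (\<rho> q') x)) = tr' q q' (snd (\<kappa> (\<rho> q, x)))"
  shows "continuous_map (holim Q E tr) (holim Q' E' tr') (holim_map Q' \<rho> \<kappa>)"
  unfolding holim_eq
proof (rule continuous_map_kify[OF j])
  let ?I = "\<lambda>k. prod_topology (simplex_space k) (chain_space Q k)"
  let ?I' = "\<lambda>k. prod_topology (simplex_space k) (chain_space Q' k)"
  have \<rho>': "\<rho> \<in> topspace Q' \<rightarrow> topspace Q" using \<rho> by (auto simp: continuous_map_def)
  have ru: "restrict (\<rho> \<circ> u) {..k} \<in> topspace (chain_space Q k)"
    if "u \<in> topspace (chain_space Q' k)" for u k by (rule chain_space_map_in[OF \<rho>' mono(1) that])
  have r: "continuous_map (?I' k) (?I k) (\<lambda>(t, u). (t, restrict (\<rho> \<circ> u) {..k}))" for k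
    unfolding case_prod_beta
    by (intro continuous_map_pairedI continuous_map_fst
        continuous_map_compose[OF continuous_map_snd continuous_map_chain_space[OF \<rho> mono(1)], unfolded comp_def[of _ snd]])
  have s: "continuous_map (?I k) (?I' k) (\<lambda>(t, u). (t, restrict (\<psi> \<circ> u) {..k}))" for k
    unfolding case_prod_beta
    by (intro continuous_map_pairedI continuous_map_fst
        continuous_map_compose[OF continuous_map_snd continuous_map_chain_space[OF \<psi> mono(2)], unfolded comp_def[of _ snd]])
  have sr: "restrict (\<psi> \<circ> restrict (\<rho> \<circ> u) {..k}) {..k} = u" if "u \<in> topspace (chain_space Q' k)" for u k
  proof
    fix i show "restrict (\<psi> \<circ> restrict (\<rho> \<circ> u) {..k}) {..k} i = u i"
      using that \<psi>\<rho> by (cases "i \<le> k") (auto simp: topspace_chain_space PiE_iff extensional_def)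
  qed
  have comp: "continuous_map (compact_open_topology (?I k) E) (compact_open_topology (?I' k) E')
      (\<lambda>f. restrict (\<lambda>a. \<kappa> (f ((\<lambda>(t, u). (t, restrict (\<rho> \<circ> u) {..k})) a))) (topspace (?I' k)))" for k
    by (rule continuous_map_compact_open_compose[OF r s _ \<kappa>]) (auto simp: sr)
  have "continuous_map (holim_ambient Q E) (holim_ambient Q' E') (holim_map Q' \<rho> \<kappa>)"
    unfolding continuous_map_componentwise_UNIV
  proof
    fix k
    have "continuous_map (holim_ambient Q E) (compact_open_topology (?I k) E) (\<lambda>h. h k)"
      by (rule continuous_map_product_projection) simp
    from continuous_map_compose[OF this comp]
    show "continuous_map (holim_ambient Q E) (compact_open_topology (?I' k) E') (\<lambda>h. holim_map Q' \<rho> \<kappa> h k)"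
      by (rule continuous_map_eq) (auto simp: holim_map_def restrict_def fun_eq_iff)
  qed
  moreover have "holim_map Q' \<rho> \<kappa> h \<in> cosimplicial Q' tr'"
    if "h \<in> topspace (subtopology (holim_ambient Q E) (cosimplicial Q tr))" for h
  proof -
    have hh: "h \<in> topspace (holim Q E tr)" using that by (simp add: holim_eq)
    have hc: "h \<in> cosimplicial Q tr" using that by simp
    note val = holim_value[OF hh]
    show ?thesis
      unfolding cosimplicial_def mem_Collect_eq
    proof (intro conjI allI ballI impI)
      fix k t u assume t: "t \<in> topspace (simplex_space k)" and u: "u \<in> topspace (chain_space Q' k)"
      have "h k (t, restrict (\<rho> \<circ> u) {..k}) = (\<rho> (u k), snd (h k (t, restrict (\<rho> \<circ> u) {..k})))"
        using val(2)[OF _ ru[OF u], of t] t by (simp add: prod_eq_iff)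
      then show "fst (holim_map Q' \<rho> \<kappa> h k (t, u)) = u k"
        using fst_\<kappa>[OF chain_space_in[OF u order_refl], of "snd (h k (t, restrict (\<rho> \<circ> u) {..k}))"]
          val(1)[OF _ ru[OF u], of t] t u by simp
    next
      fix i k \<theta> t u
      assume \<theta>: "\<theta> ` {..i} \<subseteq> {..k} \<and> mono_on {..i} \<theta>"
        and t: "t \<in> topspace (simplex_space i)" and u: "u \<in> topspace (chain_space Q' k)"
      have \<theta>k: "\<theta> l \<le> k" if "l \<le> i" for l using \<theta> that by auto
      have u\<theta>: "restrict (u \<circ> \<theta>) {..i} \<in> topspace (chain_space Q' i)"
        using \<theta> by (intro chain_space_reindex[OF u]) auto
      define a where "a = h i (t, restrict (\<rho> \<circ> restrict (u \<circ> \<theta>) {..i}) {..i})"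
      have a: "a \<in> topspace E" "fst a = \<rho> (u (\<theta> i))"
        using val[OF _ ru[OF u\<theta>], of t] t by (auto simp: a_def)
      then have a': "a = (\<rho> (u (\<theta> i)), snd a)" by (simp add: prod_eq_iff)
      have push: "simplex_push i \<theta> t \<in> standard_simplex k" using simplex_push_in t \<theta> by auto
      define b where "b = h k (simplex_push i \<theta> t, restrict (\<rho> \<circ> u) {..k})"
      have fb: "fst b = \<rho> (u k)" using val(2)[OF push ru[OF u]] by (simp add: b_def)
      \<comment> \<open>Reindexing a chain along \<theta> and applying \<rho> to its members
        commute, so the cosimplicial identity of \<open>h\<close> can be read at the image
        chain.\<close>
      have rr: "restrict (restrict (\<rho> \<circ> u) {..k} \<circ> \<theta>) {..i} = restrict (\<rho> \<circ> restrict (u \<circ> \<theta>) {..i}) {..i}"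
        using \<theta>k by (auto simp: restrict_def)
      have "snd b = tr (restrict (\<rho> \<circ> u) {..k} (\<theta> i)) (restrict (\<rho> \<circ> u) {..k} k)
          (snd (h i (t, restrict (restrict (\<rho> \<circ> u) {..k} \<circ> \<theta>) {..i})))"
        using hc ru[OF u] \<theta> t unfolding cosimplicial_def b_def by blast
      then have sb: "snd b = tr (\<rho> (u (\<theta> i))) (\<rho> (u k)) (snd a)"
        unfolding rr a_def[symmetric] using \<theta>k by simp
      have "snd (\<kappa> b) = tr' (u (\<theta> i)) (u k) (snd (\<kappa> a))"
      proof -
        have "b = (\<rho> (u k), tr (\<rho> (u (\<theta> i))) (\<rho> (u k)) (snd a))" using fb sb by (simp add: prod_eq_iff)
        moreover have "snd (\<kappa> (\<rho> (u k), tr (\<rho> (u (\<theta> i))) (\<rho> (u k)) (snd a)))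
            = tr' (u (\<theta> i)) (u k) (snd (\<kappa> (\<rho> (u (\<theta> i)), snd a)))"
          using a(1) a' \<theta>k chain_space_in[OF u] chain_space_mono[OF u] by (intro compat) auto
        ultimately show ?thesis using a' by simp
      qed
      then show "snd (holim_map Q' \<rho> \<kappa> h k (simplex_push i \<theta> t, u)) =
          tr' (u (\<theta> i)) (u k) (snd (holim_map Q' \<rho> \<kappa> h i (t, restrict (u \<circ> \<theta>) {..i})))"
        using push u u\<theta> t by (simp add: a_def b_def)
    qed
  qed
  ultimately show "continuous_map (subtopology (holim_ambient Q E) (cosimplicial Q tr))
      (subtopology (holim_ambient Q' E') (cosimplicial Q' tr')) (holim_map Q' \<rho> \<kappa>)"
    by (auto simp: continuous_map_in_subtopology intro: continuous_map_from_subtopology)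
qed

text \<open>Evaluation at a point of a simplex times a chain is continuous, so the set is an
  intersection of closed preimages, one for each such point.\<close>

lemma closedin_holim_values:
  assumes A: "closedin E A"
  shows "closedin (subtopology (holim_ambient Q E) (cosimplicial Q tr))
    {h \<in> topspace (subtopology (holim_ambient Q E) (cosimplicial Q tr)).
       \<forall>k. h k ` (standard_simplex k \<times> topspace (chain_space Q k)) \<subseteq> A}" (is "closedin ?Y ?C")
proof -
  define B where "B z = (case z of (k, a) \<Rightarrow> {h \<in> topspace ?Y. h k a \<in> A})" for z
  let ?Z = "SIGMA k:UNIV. standard_simplex k \<times> topspace (chain_space Q k)"
  have "closedin ?Y (B z)" if "z \<in> ?Z" for z
  proof -
    obtain k a where z: "z = (k, a)" "a \<in> topspace (prod_topology (simplex_space k) (chain_space Q k))"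
      using \<open>z \<in> ?Z\<close> by auto
    have "continuous_map (holim_ambient Q E)
        (compact_open_topology (prod_topology (simplex_space k) (chain_space Q k)) E) (\<lambda>h. h k)"
      by (rule continuous_map_product_projection) simp
    from continuous_map_compose[OF this continuous_map_compact_open_eval[OF z(2)]]
    have "continuous_map (holim_ambient Q E) E ((\<lambda>f. f a) \<circ> (\<lambda>h. h k))" .
    then have "continuous_map ?Y E (\<lambda>h. h k a)"
      unfolding comp_def by (rule continuous_map_from_subtopology)
    from closedin_continuous_map_preimage[OF this A] show ?thesis unfolding B_def z by simp
  qed
  \<comment> \<open>An intersection over an empty family is \<open>UNIV\<close>, so that case is
    settled by the intersection with the carrier.\<close>
  then have cB: "closedin ?Y (topspace ?Y \<inter> (\<Inter>z\<in>?Z. B z))"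
  proof (cases "?Z = {}")
    case False
    show ?thesis
      by (rule closedin_Int[OF closedin_topspace closedin_INT[OF False]])
        (fact \<open>\<And>z. z \<in> ?Z \<Longrightarrow> closedin ?Y (B z)\<close>)
  next
    case True
    show ?thesis unfolding True image_empty Inter_empty Int_UNIV_right by (rule closedin_topspace)
  qed
  have "?C = topspace ?Y \<inter> (\<Inter>z\<in>?Z. B z)"
    unfolding B_def by (rule Set.set_eqI) (simp add: image_subset_iff split_paired_Ball_Sigma, blast)
  then show ?thesis using cB by (simp only:)
qed

text \<open>Before k-ification this is the behaviour of compact-open topologies and products under
  subspaces; closedness of the condition lets it pass through \<open>kify\<close>.\<close>

lemma holim_subtopology:
  assumes A: "closedin E A"
  shows "holim Q (subtopology E A) tr = subtopology (holim Q E tr)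
    {h. \<forall>k. h k ` (standard_simplex k \<times> topspace (chain_space Q k)) \<subseteq> A}"
proof -
  let ?B = "{h. \<forall>k. h k ` (standard_simplex k \<times> topspace (chain_space Q k)) \<subseteq> A}"
  have "holim_ambient Q (subtopology E A) = subtopology (holim_ambient Q E)
      (\<Pi>\<^sub>E k\<in>UNIV. {f. f ` (standard_simplex k \<times> topspace (chain_space Q k)) \<subseteq> A})"
    unfolding compact_open_subtopology subtopology_product_topology
    by (simp only: topspace_prod_topology topspace_simplex_space)
  moreover have "(\<Pi>\<^sub>E k\<in>UNIV. {f. f ` (standard_simplex k \<times> topspace (chain_space Q k)) \<subseteq> A}) = ?B"
    unfolding PiE_UNIV_domain Pi_def by simp
  ultimately have "subtopology (holim_ambient Q (subtopology E A)) (cosimplicial Q tr)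
      = subtopology (subtopology (holim_ambient Q E) (cosimplicial Q tr)) ?B"
    by (simp only: subtopology_subtopology Int_commute)
  then show ?thesis
    unfolding holim_eq using kify_subtopology_Collect[OF closedin_holim_values[OF A, of Q tr]] by (simp only:)
qed

section \<open>Fixed points of \<open>\<tau>\<^sub>n\<close>\<close>

text \<open>The type on which \<open>holim\<close> over the real poset lives. Its double power set
  carries the test spaces by which compact generation of functor values is measured below.\<close>

type_synonym 'u section_family = "nat \<Rightarrow> (nat \<Rightarrow> real) \<times> (nat \<Rightarrow> real coords set) \<Rightarrow> real coords set \<times> 'u"

section \<open>The poset of subspaces as a quotient of frames\<close>

lemma frame_image_in_poset:
  "\<forall>i\<in>{1..m}. (\<lambda>f. f ` std_space i) \<in> topspace (top_of_set (mor (std_space i) (std_space m)))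
     \<rightarrow> nonzero_subspaces m"
  using image_frame_nonzero by auto

lemma subspace_poset_real:
  "subspace_poset m = final_topology (nonzero_subspaces m) {1..m}
     (\<lambda>i. top_of_set (mor (std_space i) (std_space m))) (\<lambda>i f. f ` std_space i)"
  unfolding subspace_poset_def
  by (rule final_topology_cong) (auto simp: real_frames_real image_iff)

lemma topspace_subspace_poset_real [simp]: "topspace (subspace_poset m) = nonzero_subspaces m"
  unfolding subspace_poset_real by (rule topspace_final_topology[OF frame_image_in_poset])

text \<open>
  The saturation of \<open>B\<close> is the union of its translates under \<open>O(i)\<close>.  Since the quotient maps are
  open, they remain quotient maps after taking products with arbitrary spaces.
\<close>

lemma openin_frame_image:
  fixes B :: "(real coords \<Rightarrow> real coords) set"
  assumes i: "i \<in> {1..m}" and B: "openin (top_of_set (mor (std_space i) (std_space m))) B"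
  shows "openin (subspace_poset m) ((\<lambda>f. f ` std_space i) ` B)"
  unfolding subspace_poset_real openin_final_topology
proof (intro conjI ballI)
  have Bm: "B \<subseteq> mor (std_space i) (std_space m)" using openin_subset[OF B] by simp
  show "(\<lambda>f. f ` std_space i) ` B \<subseteq> nonzero_subspaces m"
    using image_frame_nonzero i Bm by auto
  fix j assume j: "j \<in> {1..m}"
  let ?X = "top_of_set (mor (std_space j) (std_space m) :: (real coords \<Rightarrow> real coords) set)"
  let ?S = "{f \<in> topspace ?X. f ` std_space j \<in> (\<lambda>f. f ` std_space i) ` B}"
  show "openin ?X ?S"
  proof (cases "j = i")
    case False
    have "f \<notin> ?S" for f
    proof
      assume "f \<in> ?S"
      then obtain b where b: "b \<in> B" "f ` std_space j = b ` std_space i" "f \<in> mor (std_space j) (std_space m)" by auto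
      then show False using same_image_frames(1)[OF b(3) _ b(2)] Bm False by blast
    qed
    then have "?S = {}" by blast
    then show ?thesis by (simp only: openin_empty)
  next
    case True
    have cont: "continuous_map ?X ?X (\<lambda>f. f \<circ> h)" if h: "h \<in> mor (std_space j) (std_space j)" for h
    proof -
      have "continuous_on (mor (std_space j) (std_space m)) (\<lambda>f :: real coords \<Rightarrow> real coords. f \<circ> h)"
        by (rule continuous_on_coordinatewise_then_product)
          (auto intro: continuous_on_subset[OF continuous_on_product_coordinates])
      moreover have "(\<lambda>f. f \<circ> h) ` mor (std_space j) (std_space m) \<subseteq> mor (std_space j) (std_space m)"
        using mor_comp[OF h] by blast
      ultimately show ?thesis by (simp add: image_subset_iff_funcset)
    qed
    define H where "H = {h \<in> mor (std_space j) (std_space j). h ` std_space j = (std_space j :: real coords set)}"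
    have "?S = (\<Union>h\<in>H. {f \<in> topspace ?X. f \<circ> h \<in> B})"
    proof (intro equalityI subsetI)
      fix f assume f: "f \<in> ?S"
      then obtain b where b: "b \<in> B" "f ` std_space i = b ` std_space i" using True by auto
      have bm: "b \<in> mor (std_space i) (std_space m)" and fm: "f \<in> mor (std_space i) (std_space m)"
        using b Bm f True by auto
      obtain h where h: "h \<in> mor (std_space i) (std_space i)" "h ` std_space i = std_space i" "b = f \<circ> h"
        using same_image_frames(2)[OF bm fm b(2)[symmetric]] by blast
      then have "f \<in> {f \<in> topspace ?X. f \<circ> h \<in> B}" "h \<in> H" using f b True by (auto simp: H_def)
      then show "f \<in> (\<Union>h\<in>H. {f \<in> topspace ?X. f \<circ> h \<in> B})" by blast
    next
      fix f assume "f \<in> (\<Union>h\<in>H. {f \<in> topspace ?X. f \<circ> h \<in> B})"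
      then obtain h where h: "h \<in> H" "f \<in> topspace ?X" "f \<circ> h \<in> B" by blast
      have "(f \<circ> h) ` std_space j = f ` std_space j" using h(1) by (simp only: image_comp[symmetric] H_def mem_Collect_eq)
      then have "f ` std_space j = (f \<circ> h) ` std_space i" using True by simp
      then show "f \<in> ?S" using h(2,3) by blast
    qed
    moreover have "openin ?X {f \<in> topspace ?X. f \<circ> h \<in> B}" if "h \<in> H" for h
      using B True that by (intro openin_continuous_map_preimage[OF cont]) (auto simp: H_def)
    ultimately show ?thesis by auto
  qed
qed

lemma in_index_iff: "in_index m k t u \<longleftrightarrow> t \<in> standard_simplex k \<and> u \<in> topspace (chain_space (subspace_poset m) k)"
  by (simp add: in_index_def)

lemma in_index_nonzero: "in_index m k t u \<Longrightarrow> i \<le> k \<Longrightarrow> u i \<in> nonzero_subspaces m"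
  using chain_space_in unfolding in_index_iff by fastforce

lemma in_index_fd: "in_index m k t u \<Longrightarrow> fd_subspace (u k)"
  using in_index_nonzero nonzero_subspaces_fd by blast

lemma in_index_extensional: "in_index m k t u \<Longrightarrow> restrict u {..k} = u"
  unfolding in_index_iff topspace_chain_space by (auto intro: extensional_restrict)

lemma in_index_ext_real [simp]: "in_index m k t u \<Longrightarrow> ext (u k) = u k"
  using in_index_nonzero by force

lemma in_index_chain_ext_real: "in_index m k t u \<Longrightarrow> restrict (\<lambda>i. ext (u i)) {..k} = u"
proof -
  assume i: "in_index m k t u"
  have "restrict (\<lambda>i. ext (u i)) {..k} = restrict u {..k}"
    by (rule restrict_ext) (metis atMost_iff ext_nonzero_real in_index_nonzero[OF i])
  then show ?thesis using in_index_extensional[OF i] by simp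
qed

lemma enc_real:
  "enc m h = Fam (\<lambda>k t u. if in_index m k t u then snd (h k (t, u)) else Star)"
  for h :: "'a univ section_family"
  by (simp add: enc_def in_index_chain_ext_real cong: if_cong)

definition frame_proj ::
    "('k::real_normed_field, 'u) fctr \<Rightarrow> 'k coords set \<Rightarrow> nat \<Rightarrow> ('k coords \<Rightarrow> 'k coords) \<times> 'u \<Rightarrow> 'k coords set \<times> 'u" where
  "frame_proj E V i = (\<lambda>(f, x). (f ` std_space i,
     Mp E (V \<oplus>\<^sub>v std_space i) (V \<oplus>\<^sub>v f ` std_space i) (dsum_mor V (std_space i) (incl V) f) x))"

lemma total_space_frame_proj:
  "total_space m E V = final_topology
     (SIGMA U:topspace (subspace_poset m). topspace (Sp E (V \<oplus>\<^sub>v U))) {1..m}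
     (\<lambda>i. prod_topology (top_of_set (real_frames i m)) (Sp E (V \<oplus>\<^sub>v std_space i))) (frame_proj E V)"
  by (simp add: total_space_def frame_proj_def[abs_def])

abbreviation tau_holim where
  "tau_holim n E V \<equiv> holim (subspace_poset (n + 1)) (total_space (n + 1) E V)
     (\<lambda>U U'. Mp E (V \<oplus>\<^sub>v U) (V \<oplus>\<^sub>v U') (incl (V \<oplus>\<^sub>v U)))"

lemma Sp_tau: "Sp (tau n E) V = transport (enc (n + 1)) (tau_holim n E V)"
  by (simp add: tau_def)

lemma Pt_tau: "Pt (tau n E) V = Fam (\<lambda>k t u. if in_index (n + 1) k t u then Pt E (V \<oplus>\<^sub>v ext (u k)) else Star)"
  by (simp add: tau_def)

lemma Mp_tau: "Mp (tau n E) V W f = fam_map (n + 1) (\<lambda>U. Mp E (V \<oplus>\<^sub>v U) (W \<oplus>\<^sub>v U) (dsum_mor V U f (incl U)))"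
  by (simp add: tau_def)

lemma frame_mor:
  assumes V: "fd_subspace V" and f: "f \<in> mor (std_space i) (std_space m)"
  shows "dsum_mor V (std_space i) (incl V) f \<in> mor (V \<oplus>\<^sub>v std_space i) (V \<oplus>\<^sub>v f ` std_space i)"
proof -
  have "f \<in> mor (std_space i) (f ` std_space i)" using f by (auto simp: mor_def)
  moreover have "fd_subspace (f ` std_space i)"
    using subspace_mor_image[OF f subspace_std_space] mor_in[OF f]
    by (intro fd_subspace_subset[OF fd_subspace_std_space]) auto
  ultimately show ?thesis
    using V by (intro dsum_mor_in_mor fd_subspace_std_space incl_in_mor fd_subspace_imp_subspace) auto
qed

section \<open>Functors with the regularity that \<open>tau\<close> preserves\<close>

text \<open>Functor laws on points together with continuity for each fixed morphism, a package that
  reproduces itself under \<open>tau\<close>. \<open>Sp_generated\<close> is the form of compact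
  generation that lets \<open>eta\<close> be continuous into a k-ified homotopy limit.\<close>

locale regular =
  fixes G :: "(real, 'a univ) fctr"
  assumes Pt_in: "fd_subspace V \<Longrightarrow> Pt G V \<in> topspace (Sp G V)"
    and Sp_generated: "fd_subspace V \<Longrightarrow> test_generated TYPE('a univ section_family set set) (Sp G V)"
    and Mp_incl: "fd_subspace V \<Longrightarrow> x \<in> topspace (Sp G V) \<Longrightarrow> Mp G V V (incl V) x = x"
    and Mp_continuous: "fd_subspace V \<Longrightarrow> fd_subspace W \<Longrightarrow> f \<in> mor V W \<Longrightarrow>
      continuous_map (Sp G V) (Sp G W) (Mp G V W f)"
    and Mp_Pt: "fd_subspace V \<Longrightarrow> fd_subspace W \<Longrightarrow> f \<in> mor V W \<Longrightarrow> Mp G V W f (Pt G V) = Pt G W"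
    and Mp_comp: "fd_subspace V \<Longrightarrow> fd_subspace W \<Longrightarrow> fd_subspace X \<Longrightarrow> f \<in> mor V W \<Longrightarrow> g \<in> mor W X \<Longrightarrow>
      x \<in> topspace (Sp G V) \<Longrightarrow> Mp G W X g (Mp G V W f x) = Mp G V X (g \<circ> f) x"
begin

lemma Mp_in:
  "fd_subspace V \<Longrightarrow> fd_subspace W \<Longrightarrow> f \<in> mor V W \<Longrightarrow> x \<in> topspace (Sp G V) \<Longrightarrow> Mp G V W f x \<in> topspace (Sp G W)"
  using continuous_map_image_subset_topspace[OF Mp_continuous] by blast

lemma frame_proj_in:
  assumes V: "fd_subspace V"
  shows "\<forall>i\<in>{1..m}. frame_proj G V i
     \<in> topspace (prod_topology (top_of_set (mor (std_space i) (std_space m))) (Sp G (V \<oplus>\<^sub>v std_space i)))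
       \<rightarrow> (SIGMA U:nonzero_subspaces m. topspace (Sp G (V \<oplus>\<^sub>v U)))"
proof (intro ballI funcsetI)
  fix i and z :: "(real coords \<Rightarrow> real coords) \<times> 'a univ" assume i: "i \<in> {1..m}"
    and z: "z \<in> topspace (prod_topology (top_of_set (mor (std_space i) (std_space m))) (Sp G (V \<oplus>\<^sub>v std_space i)))"
  obtain f x where fx: "z = (f, x)" "f \<in> mor (std_space i) (std_space m)" "x \<in> topspace (Sp G (V \<oplus>\<^sub>v std_space i))"
    using z by auto
  have U: "f ` std_space i \<in> nonzero_subspaces m" using image_frame_nonzero[OF _ fx(2)] i by simp
  show "frame_proj G V i z \<in> (SIGMA U:nonzero_subspaces m. topspace (Sp G (V \<oplus>\<^sub>v U)))"
    using U V fx(3) Mp_in[OF _ _ frame_mor[OF V fx(2)] fx(3)]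
    by (auto simp: fx(1) frame_proj_def fd_subspace_dsum fd_subspace_std_space nonzero_subspaces_fd)
qed

lemma total_space_regular:
  "total_space m G V = final_topology (SIGMA U:nonzero_subspaces m. topspace (Sp G (V \<oplus>\<^sub>v U))) {1..m}
     (\<lambda>i. prod_topology (top_of_set (mor (std_space i) (std_space m))) (Sp G (V \<oplus>\<^sub>v std_space i)))
     (frame_proj G V)"
  by (simp add: total_space_frame_proj real_frames_real)

lemma topspace_total_space:
  "fd_subspace V \<Longrightarrow> topspace (total_space m G V) = (SIGMA U:nonzero_subspaces m. topspace (Sp G (V \<oplus>\<^sub>v U)))"
  unfolding total_space_regular by (rule topspace_final_topology[OF frame_proj_in])

lemma continuous_map_frame_proj:
  assumes "fd_subspace V" "i \<in> {1..m}"
  shows "continuous_map (prod_topology (top_of_set (mor (std_space i) (std_space m))) (Sp G (V \<oplus>\<^sub>v std_space i)))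
    (total_space m G V) (frame_proj G V i)"
  unfolding total_space_regular
  by (rule continuous_map_into_final_topology[OF frame_proj_in[OF assms(1)] assms(2)])

lemma tau_holim_value:
  assumes V: "fd_subspace V" and h: "h \<in> topspace (tau_holim n G V)" and i: "in_index (n + 1) k t u"
  shows "h k (t, u) = (u k, snd (h k (t, u)))" and "snd (h k (t, u)) \<in> topspace (Sp G (V \<oplus>\<^sub>v u k))"
proof -
  have tu: "t \<in> standard_simplex k" "u \<in> topspace (chain_space (subspace_poset (n + 1)) k)"
    using i by (auto simp: in_index_iff)
  show 1: "h k (t, u) = (u k, snd (h k (t, u)))"
    using holim_value(2)[OF h tu] by (simp add: prod_eq_iff)
  have "h k (t, u) \<in> topspace (total_space (n + 1) G V)" by (rule holim_value(1)[OF h tu])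
  then show "snd (h k (t, u)) \<in> topspace (Sp G (V \<oplus>\<^sub>v u k))"
    unfolding topspace_total_space[OF V] by (subst (asm) 1) auto
qed

text \<open>Reduces equations between maps induced on \<open>tau n G\<close> to equations between
  the values of a family, where the properties of \<open>G\<close> apply.\<close>

lemma Sp_tau_cases:
  assumes V: "fd_subspace V" and x: "x \<in> topspace (Sp (tau n G) V)"
  obtains g where "x = Fam (\<lambda>k t u. if in_index (n + 1) k t u then g k t u else Star)"
    "\<And>k t u. in_index (n + 1) k t u \<Longrightarrow> g k t u \<in> topspace (Sp G (V \<oplus>\<^sub>v u k))"
proof -
  obtain h where h: "h \<in> topspace (tau_holim n G V)" "x = enc (n + 1) h"
    using x by (auto simp: Sp_tau)
  show ?thesis
    by (rule that[of "\<lambda>k t u. snd (h k (t, u))"]) (use h tau_holim_value(2)[OF V h(1)] in \<open>auto simp: enc_real\<close>)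
qed

end

lemma fam_map_index:
  "fam_map m \<phi> (Fam (\<lambda>k t u. if in_index m k t u then g k t u else Star))
     = Fam (\<lambda>k t u. if in_index m k t u then \<phi> (u k) (g k t u) else Star)"
  for \<phi> :: "real coords set \<Rightarrow> 'a univ \<Rightarrow> 'a univ"
  by (auto simp: fun_eq_iff)

text \<open>Naturality along isometries of the second summand says that \<phi> commutes with the
  projections from frames; continuity then descends from the products of frames with a single
  value.\<close>

lemma continuous_map_total_space:
  assumes G: "regular G" and G': "regular G'" and V: "fd_subspace V" and W: "fd_subspace W"
    and cont: "\<And>U. fd_subspace U \<Longrightarrow> continuous_map (Sp G (V \<oplus>\<^sub>v U)) (Sp G' (W \<oplus>\<^sub>v U)) (\<phi> U)"
    and nat: "\<And>U U' f x. fd_subspace U \<Longrightarrow> fd_subspace U' \<Longrightarrow> f \<in> mor U U' \<Longrightarrow> x \<in> topspace (Sp G (V \<oplus>\<^sub>v U)) \<Longrightarrow>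
      \<phi> U' (Mp G (V \<oplus>\<^sub>v U) (V \<oplus>\<^sub>v U') (dsum_mor V U (incl V) f) x)
      = Mp G' (W \<oplus>\<^sub>v U) (W \<oplus>\<^sub>v U') (dsum_mor W U (incl W) f) (\<phi> U x)"
  shows "continuous_map (total_space m G V) (total_space m G' W) (\<lambda>(U, x). (U, \<phi> U x))"
proof (subst regular.total_space_regular[OF G], rule continuous_map_from_final_topology[OF regular.frame_proj_in[OF G V]])
  have \<phi>_in: "\<phi> U x \<in> topspace (Sp G' (W \<oplus>\<^sub>v U))" if "fd_subspace U" "x \<in> topspace (Sp G (V \<oplus>\<^sub>v U))" for U x
    using continuous_map_image_subset_topspace[OF cont[OF that(1)]] that(2) by blast
  show "(\<lambda>(U, x). (U, \<phi> U x)) z \<in> topspace (total_space m G' W)"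
    if "z \<in> (SIGMA U:nonzero_subspaces m. topspace (Sp G (V \<oplus>\<^sub>v U)))" for z
    using that \<phi>_in nonzero_subspaces_fd by (auto simp: regular.topspace_total_space[OF G' W])
  fix i assume i: "i \<in> {1..m}"
  let ?F = "top_of_set (mor (std_space i) (std_space m) :: (real coords \<Rightarrow> real coords) set)"
  have "continuous_map (prod_topology ?F (Sp G (V \<oplus>\<^sub>v std_space i))) (prod_topology ?F (Sp G' (W \<oplus>\<^sub>v std_space i)))
      (\<lambda>(f, x). (f, \<phi> (std_space i) x))"
    unfolding case_prod_beta
    by (intro continuous_map_pairedI continuous_map_fst
        continuous_map_compose[OF continuous_map_snd cont[OF fd_subspace_std_space], unfolded comp_def])
  from continuous_map_compose[OF this regular.continuous_map_frame_proj[OF G' W i]]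
  show "continuous_map (prod_topology ?F (Sp G (V \<oplus>\<^sub>v std_space i))) (total_space m G' W)
      (\<lambda>z. (\<lambda>(U, x). (U, \<phi> U x)) (frame_proj G V i z))"
  proof (rule continuous_map_eq)
    fix z assume "z \<in> topspace (prod_topology ?F (Sp G (V \<oplus>\<^sub>v std_space i)))"
    then obtain f x where fx: "z = (f, x)" "f \<in> mor (std_space i) (std_space m)" "x \<in> topspace (Sp G (V \<oplus>\<^sub>v std_space i))"
      by auto
    have U: "fd_subspace (f ` std_space i)"
      using image_frame_nonzero[OF _ fx(2)] i nonzero_subspaces_fd by simp
    have fm: "f \<in> mor (std_space i) (f ` std_space i)" using fx(2) by (auto simp: mor_def)
    show "(frame_proj G' W i \<circ> (\<lambda>(f, x). (f, \<phi> (std_space i) x))) z = (\<lambda>(U, x). (U, \<phi> U x)) (frame_proj G V i z)"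
      using nat[OF fd_subspace_std_space U fm fx(3)] by (simp add: fx(1) frame_proj_def)
  qed
qed

lemma enc_holim_map_id:
  fixes h :: "'a univ section_family"
  assumes "\<And>k t u. in_index m k t u \<Longrightarrow> snd (\<kappa> (h k (t, u))) = \<phi> (u k) (snd (h k (t, u)))"
  shows "enc m (holim_map (subspace_poset m) (\<lambda>x. x) \<kappa> h) = fam_map m \<phi> (enc m h)"
proof -
  have "snd (holim_map (subspace_poset m) (\<lambda>x. x) \<kappa> h k (t, u)) = \<phi> (u k) (snd (h k (t, u)))"
    if i: "in_index m k t u" for k t u
  proof -
    have "restrict ((\<lambda>x. x) \<circ> u) {..k} = u" using in_index_extensional[OF i] by (simp add: comp_def)
    then show ?thesis using i assms[OF i] by (simp add: in_index_iff)
  qed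
  then show ?thesis by (simp add: enc_real fam_map_index cong: if_cong)
qed

text \<open>Stated for two base spaces and an arbitrary natural family, so that it covers the
  morphism maps of \<open>tau n G\<close>, where \<open>V\<close> changes, as well as an action on
  the values, where it does not.\<close>

lemma continuous_map_tau:
  assumes G: "regular G" and G': "regular G'" and V: "fd_subspace V" and W: "fd_subspace W"
    and cont: "\<And>U. fd_subspace U \<Longrightarrow> continuous_map (Sp G (V \<oplus>\<^sub>v U)) (Sp G' (W \<oplus>\<^sub>v U)) (\<phi> U)"
    and nat: "\<And>U U' f x. fd_subspace U \<Longrightarrow> fd_subspace U' \<Longrightarrow> f \<in> mor U U' \<Longrightarrow> x \<in> topspace (Sp G (V \<oplus>\<^sub>v U)) \<Longrightarrow>
      \<phi> U' (Mp G (V \<oplus>\<^sub>v U) (V \<oplus>\<^sub>v U') (dsum_mor V U (incl V) f) x)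
      = Mp G' (W \<oplus>\<^sub>v U) (W \<oplus>\<^sub>v U') (dsum_mor W U (incl W) f) (\<phi> U x)"
  shows "continuous_map (Sp (tau n G) V) (Sp (tau n G') W) (fam_map (n + 1) \<phi>)"
  unfolding Sp_tau
proof (rule continuous_map_from_transport)
  let ?\<kappa> = "\<lambda>(U, x). (U, \<phi> U x)"
  let ?Q = "subspace_poset (n + 1) :: real coords set topology"
  have "continuous_map (tau_holim n G V) (tau_holim n G' W) (holim_map ?Q (\<lambda>x. x) ?\<kappa>)"
  proof (rule continuous_map_holim[where j = "\<lambda>x. x" and \<psi> = "\<lambda>x. x"])
    show "continuous_map (total_space (n + 1) G V) (total_space (n + 1) G' W) ?\<kappa>"
      by (rule continuous_map_total_space[OF G G' V W cont nat])
    fix U U' x assume U: "U \<in> topspace ?Q" "U' \<in> topspace ?Q" "U \<le> U'"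
      and x: "(U, x) \<in> topspace (total_space (n + 1) G V)"
    have fd: "fd_subspace U" "fd_subspace U'" using U nonzero_subspaces_fd by auto
    \<comment> \<open>The transition maps of the diagram are the instances of naturality in which
      the isometry of the second summand is an inclusion.\<close>
    have i: "incl U \<in> mor U U'" using U(3) by (intro incl_in_mor fd_subspace_imp_subspace[OF fd(1)]) auto
    have "dsum_mor Y U (incl Y) (incl U) = incl (Y \<oplus>\<^sub>v U)" for Y by (rule dsum_mor_incl)
    then show "snd (?\<kappa> (U', Mp G (V \<oplus>\<^sub>v U) (V \<oplus>\<^sub>v U') (incl (V \<oplus>\<^sub>v U)) x))
        = Mp G' (W \<oplus>\<^sub>v U) (W \<oplus>\<^sub>v U') (incl (W \<oplus>\<^sub>v U)) (snd (?\<kappa> (U, x)))"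
      using nat[OF fd i, of x] x by (simp add: regular.topspace_total_space[OF G V])
  qed auto
  from continuous_map_compose[OF this continuous_map_transport]
  show "continuous_map (tau_holim n G V) (transport (enc (n + 1)) (tau_holim n G' W))
      (\<lambda>x. fam_map (n + 1) \<phi> (enc (n + 1) x))"
  proof (rule continuous_map_eq)
    fix h assume h: "h \<in> topspace (tau_holim n G V)"
    show "(enc (n + 1) \<circ> holim_map ?Q (\<lambda>x. x) ?\<kappa>) h = fam_map (n + 1) \<phi> (enc (n + 1) h)"
      unfolding comp_def
    proof (rule enc_holim_map_id)
      fix k t u assume "in_index (n + 1) k t u"
      from regular.tau_holim_value(1)[OF G V h this]
      show "snd (?\<kappa> (h k (t, u))) = \<phi> (u k) (snd (h k (t, u)))"
        by (metis (no_types, lifting) case_prod_conv snd_conv)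
    qed
  qed
qed

section \<open>Continuity and naturality of the unit\<close>

context regular begin

text \<open>A frame moves only the second summand, so the image of a point of \<open>V\<close> under
  the first inclusion depends on the subspace and not on the frame.\<close>

lemma frame_proj_in1:
  assumes V: "fd_subspace V" and i: "i \<in> {1..m}" and f: "f \<in> mor (std_space i) (std_space m)"
    and x: "x \<in> topspace (Sp G V)"
  shows "frame_proj G V i (f, Mp G V (V \<oplus>\<^sub>v std_space i) (dsum_in1 V) x)
    = (f ` std_space i, Mp G V (V \<oplus>\<^sub>v f ` std_space i) (dsum_in1 V) x)"
proof -
  have U: "fd_subspace (f ` std_space i)"
    using image_frame_nonzero[OF _ f] i nonzero_subspaces_fd by simp
  have sV: "scl.subspace V" using V by (rule fd_subspace_imp_subspace)
  have 1: "dsum_mor V (std_space i) (incl V) f \<circ> dsum_in1 V = dsum_in1 V"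
  proof
    fix y show "(dsum_mor V (std_space i) (incl V) f \<circ> dsum_in1 V) y = dsum_in1 V y"
      using scl.subspace_0[OF subspace_std_space[of i, where 'a = real]] scl.subspace_0[OF sV] mor_zero[OF f]
      by (cases "y \<in> V") (auto simp: dsum_in1_def incl_def intro!: dsum_mor_zero)
  qed
  show ?thesis
    using Mp_comp[OF V fd_subspace_dsum[OF V fd_subspace_std_space] fd_subspace_dsum[OF V U]
        dsum_in1_in_mor[OF V subspace_std_space] frame_mor[OF V f] x]
    by (simp add: frame_proj_def 1)
qed

text \<open>Continuity is clear after pulling back to frames. A product neighbourhood
  \<open>A \<times> B\<close> of a frame and a point is pushed down to subspaces, where it stays a
  neighbourhood by \<open>openin_frame_image\<close>.\<close>

lemma continuous_map_in1_total:
  assumes V: "fd_subspace V"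
  shows "continuous_map (prod_topology (Sp G V) (subspace_poset m)) (total_space m G V)
    (\<lambda>(x, U). (U, Mp G V (V \<oplus>\<^sub>v U) (dsum_in1 V) x))" (is "continuous_map ?X ?Y ?\<gamma>")
  unfolding continuous_map_def
proof (intro conjI allI impI)
  show "?\<gamma> \<in> topspace ?X \<rightarrow> topspace ?Y"
  proof (rule funcsetI)
    fix z assume "z \<in> topspace ?X"
    then obtain x U where z: "z = (x, U)" "x \<in> topspace (Sp G V)" "U \<in> nonzero_subspaces m" by auto
    have U: "fd_subspace U" by (rule nonzero_subspaces_fd[OF z(3)])
    show "?\<gamma> z \<in> topspace ?Y"
      using Mp_in[OF V fd_subspace_dsum[OF V U] dsum_in1_in_mor[OF V fd_subspace_imp_subspace[OF U]] z(2)] z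
      by (simp add: topspace_total_space[OF V])
  qed
  fix W assume W: "openin ?Y W"
  show "openin ?X {z \<in> topspace ?X. ?\<gamma> z \<in> W}"
  proof (subst openin_subopen, intro ballI)
    fix z assume z: "z \<in> {z \<in> topspace ?X. ?\<gamma> z \<in> W}"
    then obtain x U where xU: "z = (x, U)" "x \<in> topspace (Sp G V)" "U \<in> nonzero_subspaces m" "?\<gamma> (x, U) \<in> W"
      by auto
    obtain i f where f: "i \<in> {1..m}" "f \<in> mor (std_space i) (std_space m)" "f ` std_space i = U"
      using nonzero_subspace_frame[OF xU(3)] .
    let ?F = "top_of_set (mor (std_space i) (std_space m) :: (real coords \<Rightarrow> real coords) set)"
    let ?g = "\<lambda>(f, x). frame_proj G V i (f, Mp G V (V \<oplus>\<^sub>v std_space i) (dsum_in1 V) x)"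
    have "continuous_map (prod_topology ?F (Sp G V)) (prod_topology ?F (Sp G (V \<oplus>\<^sub>v std_space i)))
        (\<lambda>(f, x). (f, Mp G V (V \<oplus>\<^sub>v std_space i) (dsum_in1 V) x))"
      unfolding case_prod_beta
      by (intro continuous_map_pairedI continuous_map_fst
          continuous_map_compose[OF continuous_map_snd Mp_continuous, unfolded comp_def]
          V fd_subspace_dsum fd_subspace_std_space dsum_in1_in_mor subspace_std_space)
    from continuous_map_compose[OF this continuous_map_frame_proj[OF V f(1)]]
    have "continuous_map (prod_topology ?F (Sp G V)) ?Y ?g" by (rule continuous_map_eq) auto
    from openin_continuous_map_preimage[OF this W]
    have op: "openin (prod_topology ?F (Sp G V)) {z \<in> topspace (prod_topology ?F (Sp G V)). ?g z \<in> W}" .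
    have "(f, x) \<in> {z \<in> topspace (prod_topology ?F (Sp G V)). ?g z \<in> W}"
      using f xU frame_proj_in1[OF V f(1,2) xU(2)] by simp
    with op obtain A B where AB: "openin ?F A" "openin (Sp G V) B" "f \<in> A" "x \<in> B"
      "A \<times> B \<subseteq> {z \<in> topspace (prod_topology ?F (Sp G V)). ?g z \<in> W}"
      unfolding openin_prod_topology_alt by meson
    let ?O = "B \<times> (\<lambda>f. f ` std_space i) ` A"
    have "openin ?X ?O"
      using AB(1,2) openin_frame_image[OF f(1)] by (simp add: openin_prod_Times_iff)
    moreover have "z \<in> ?O" using AB(3,4) f(3) xU(1) by blast
    moreover have "?O \<subseteq> {z \<in> topspace ?X. ?\<gamma> z \<in> W}"
    proof
      fix y assume "y \<in> ?O"
      then obtain a b where y: "y = (b, a ` std_space i)" "a \<in> A" "b \<in> B" by blast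
      then have ab: "a \<in> mor (std_space i) (std_space m)" "b \<in> topspace (Sp G V)" "?g (a, b) \<in> W"
        using AB(5) by auto
      then have "?\<gamma> y \<in> W" using frame_proj_in1[OF V f(1) ab(1,2)] y(1) by simp
      then show "y \<in> {z \<in> topspace ?X. ?\<gamma> z \<in> W}"
        using y ab image_frame_nonzero[OF _ ab(1)] f(1) by simp
    qed
    ultimately show "\<exists>T. openin ?X T \<and> z \<in> T \<and> T \<subseteq> {z \<in> topspace ?X. ?\<gamma> z \<in> W}" by blast
  qed
qed

text \<open>Curry the preceding map along the last vertex of a chain. The resulting section is
  constant on simplices, and compact generation of the source permits the k-ified target.\<close>

lemma continuous_map_eta:
  assumes V: "fd_subspace V"
  shows "continuous_map (Sp G V) (Sp (tau n G) V) (eta n G V)"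
proof -
  let ?m = "n + 1"
  let ?Q = "subspace_poset ?m :: real coords set topology"
  let ?I = "\<lambda>k. prod_topology (simplex_space k) (chain_space ?Q k)"
  let ?tr = "\<lambda>U U'. Mp G (V \<oplus>\<^sub>v U) (V \<oplus>\<^sub>v U') (incl (V \<oplus>\<^sub>v U))"
  define \<Theta> where "\<Theta> x = (\<lambda>k. restrict (\<lambda>(t, u). (u k, Mp G V (V \<oplus>\<^sub>v u k) (dsum_in1 V) x)) (topspace (?I k)))" for x
  have sV: "scl.subspace V" using V by (rule fd_subspace_imp_subspace)
  have "continuous_map (Sp G V) (holim_ambient ?Q (total_space ?m G V)) \<Theta>"
    unfolding continuous_map_componentwise_UNIV
  proof
    fix k
    have 1: "continuous_map (?I k) ?Q ((\<lambda>u. u k) \<circ> snd)"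
      by (rule continuous_map_compose[OF continuous_map_snd continuous_map_chain_eval]) simp
    have "continuous_map (prod_topology (Sp G V) (?I k)) ?Q (((\<lambda>u. u k) \<circ> snd) \<circ> snd)"
      by (rule continuous_map_compose[OF continuous_map_snd 1])
    then have "continuous_map (prod_topology (Sp G V) (?I k)) (prod_topology (Sp G V) ?Q)
        (\<lambda>z. (fst z, snd (snd z) k))"
      by (intro continuous_map_pairedI continuous_map_fst) (simp add: comp_def)
    from continuous_map_curry[OF continuous_map_compose[OF this continuous_map_in1_total[OF V]]]
    show "continuous_map (Sp G V) (compact_open_topology (?I k) (total_space ?m G V)) (\<lambda>x. \<Theta> x k)"
      by (rule continuous_map_eq) (auto simp: \<Theta>_def restrict_def fun_eq_iff)
  qed
  moreover have "\<Theta> x \<in> cosimplicial ?Q ?tr" if x: "x \<in> topspace (Sp G V)" for x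
    unfolding cosimplicial_def mem_Collect_eq
  proof (intro conjI allI ballI impI)
    show "fst (\<Theta> x k (t, u)) = u k" if "t \<in> topspace (simplex_space k)" "u \<in> topspace (chain_space ?Q k)" for k t u
      using that by (simp add: \<Theta>_def)
  next
    fix i k \<theta> t u
    assume \<theta>: "\<theta> ` {..i} \<subseteq> {..k} \<and> mono_on {..i} \<theta>"
      and t: "t \<in> topspace (simplex_space i)" and u: "u \<in> topspace (chain_space ?Q k)"
    have \<theta>k: "\<theta> l \<le> k" if "l \<le> i" for l using \<theta> that by auto
    have u\<theta>: "restrict (u \<circ> \<theta>) {..i} \<in> topspace (chain_space ?Q i)"
      using \<theta> by (intro chain_space_reindex[OF u]) auto
    have push: "simplex_push i \<theta> t \<in> standard_simplex k" using simplex_push_in t \<theta> by auto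
    have fd: "fd_subspace (u (\<theta> i))" "fd_subspace (u k)"
      using chain_space_in[OF u] \<theta>k nonzero_subspaces_fd by auto
    have i: "incl (V \<oplus>\<^sub>v u (\<theta> i)) \<in> mor (V \<oplus>\<^sub>v u (\<theta> i)) (V \<oplus>\<^sub>v u k)"
      using chain_space_mono[OF u, of "\<theta> i" k] \<theta>k fd V
      by (intro incl_in_mor fd_subspace_imp_subspace fd_subspace_dsum) (auto simp: dsum_def)
    \<comment> \<open>Enlarging the second summand does not affect a point that comes from the
      first, which is all that the cosimplicial identities ask for.\<close>
    have "?tr (u (\<theta> i)) (u k) (Mp G V (V \<oplus>\<^sub>v u (\<theta> i)) (dsum_in1 V) x) = Mp G V (V \<oplus>\<^sub>v u k) (dsum_in1 V) x"
      using Mp_comp[OF V fd_subspace_dsum[OF V fd(1)] fd_subspace_dsum[OF V fd(2)]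
          dsum_in1_in_mor[OF V fd_subspace_imp_subspace[OF fd(1)]] i x]
        incl_comp_in1[OF sV fd_subspace_imp_subspace[OF fd(1)]] by simp
    then show "snd (\<Theta> x k (simplex_push i \<theta> t, u))
        = ?tr (u (\<theta> i)) (u k) (snd (\<Theta> x i (t, restrict (u \<circ> \<theta>) {..i})))"
      using push u u\<theta> t by (simp add: \<Theta>_def)
  qed
  ultimately have "continuous_map (Sp G V) (subtopology (holim_ambient ?Q (total_space ?m G V)) (cosimplicial ?Q ?tr)) \<Theta>"
    by (auto simp: continuous_map_in_subtopology)
  from continuous_map_into_kify[OF this Sp_generated[OF V]]
  have "continuous_map (Sp G V) (tau_holim n G V) \<Theta>" by (simp add: holim_eq)
  from continuous_map_compose[OF this continuous_map_transport[of _ "enc ?m"]]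
  show ?thesis
    unfolding Sp_tau
  proof (rule continuous_map_eq)
    fix x
    have "snd (\<Theta> x k (t, u)) = Mp G V (V \<oplus>\<^sub>v u k) (dsum_in1 V) x" if "in_index ?m k t u" for k t u
      using that by (simp add: \<Theta>_def in_index_iff)
    then show "(enc ?m \<circ> \<Theta>) x = eta n G V x"
      by (simp add: enc_real eta_def cong: if_cong)
  qed
qed

lemma eta_Pt:
  assumes V: "fd_subspace V" shows "eta n G V (Pt G V) = Pt (tau n G) V"
proof -
  have "Mp G V (V \<oplus>\<^sub>v u k) (dsum_in1 V) (Pt G V) = Pt G (V \<oplus>\<^sub>v u k)" if "in_index (n + 1) k t u" for k t u
    using in_index_fd[OF that] V
    by (intro Mp_Pt fd_subspace_dsum dsum_in1_in_mor fd_subspace_imp_subspace)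
  then show ?thesis by (simp add: eta_def Pt_tau cong: if_cong)
qed

text \<open>Both composites are the sum of \<open>f\<close> and \<open>g\<close>.\<close>

lemma Mp_dsum_nat:
  assumes V: "fd_subspace V" and W: "fd_subspace W" and f: "f \<in> mor V W"
    and U: "fd_subspace U" "fd_subspace U'" and g: "g \<in> mor U U'" and x: "x \<in> topspace (Sp G (V \<oplus>\<^sub>v U))"
  shows "Mp G (V \<oplus>\<^sub>v U') (W \<oplus>\<^sub>v U') (dsum_mor V U' f (incl U')) (Mp G (V \<oplus>\<^sub>v U) (V \<oplus>\<^sub>v U') (dsum_mor V U (incl V) g) x)
    = Mp G (W \<oplus>\<^sub>v U) (W \<oplus>\<^sub>v U') (dsum_mor W U (incl W) g) (Mp G (V \<oplus>\<^sub>v U) (W \<oplus>\<^sub>v U) (dsum_mor V U f (incl U)) x)"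
proof -
  note s = fd_subspace_imp_subspace
  have i: "incl V \<in> mor V V" "incl W \<in> mor W W" "incl U \<in> mor U U" "incl U' \<in> mor U' U'"
    using V W U by (auto intro!: incl_in_mor s)
  note d = fd_subspace_dsum[OF V U(1)] fd_subspace_dsum[OF V U(2)] fd_subspace_dsum[OF W U(1)] fd_subspace_dsum[OF W U(2)]
  note m = dsum_mor_in_mor[OF i(1) g V V U] dsum_mor_in_mor[OF f i(4) V W U(2,2)]
    dsum_mor_in_mor[OF f i(3) V W U(1,1)] dsum_mor_in_mor[OF i(2) g W W U]
  have "dsum_mor V U' f (incl U') \<circ> dsum_mor V U (incl V) g = dsum_mor V U f g"
    using dsum_mor_comp[OF i(1) g f i(4)] mor_comp_incl[OF f] incl_comp_mor[OF g] by simp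
  moreover have "dsum_mor W U (incl W) g \<circ> dsum_mor V U f (incl U) = dsum_mor V U f g"
    using dsum_mor_comp[OF f i(3) i(2) g] mor_comp_incl[OF g] incl_comp_mor[OF f] by simp
  ultimately show ?thesis
    using Mp_comp[OF d(1,2,4) m(1,2) x] Mp_comp[OF d(1,3,4) m(3,4) x] by simp
qed

lemma regular_tau: "regular (tau n G)"
proof
  fix V :: "real coords set" assume V: "fd_subspace V"
  \<comment> \<open>The family of base points is the image of the base point under
    \<open>eta\<close>, hence a genuine point of the homotopy limit.\<close>
  show "Pt (tau n G) V \<in> topspace (Sp (tau n G) V)"
    using continuous_map_image_subset_topspace[OF continuous_map_eta[OF V, of n]] Pt_in[OF V]
    unfolding eta_Pt[OF V, symmetric] by blast
  show "test_generated TYPE('a univ section_family set set) (Sp (tau n G) V)"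
    unfolding Sp_tau holim_eq by (rule test_generated_transport[OF test_generated_kify])
  show "Mp (tau n G) V V (incl V) x = x" if "x \<in> topspace (Sp (tau n G) V)" for x
    using that
  proof (rule Sp_tau_cases[OF V])
    fix g assume x: "x = Fam (\<lambda>k t u. if in_index (n + 1) k t u then g k t u else Star)"
      and g: "\<And>k t u. in_index (n + 1) k t u \<Longrightarrow> g k t u \<in> topspace (Sp G (V \<oplus>\<^sub>v u k))"
    have "Mp G (V \<oplus>\<^sub>v u k) (V \<oplus>\<^sub>v u k) (dsum_mor V (u k) (incl V) (incl (u k))) (g k t u) = g k t u"
      if "in_index (n + 1) k t u" for k t u
      unfolding dsum_mor_incl by (rule Mp_incl[OF fd_subspace_dsum[OF V in_index_fd[OF that]] g[OF that]])
    then show ?thesis unfolding x Mp_tau fam_map_index by (simp cong: if_cong)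
  qed
next
  fix V W :: "real coords set" and f assume V: "fd_subspace V" and W: "fd_subspace W" and f: "f \<in> mor V W"
  have i: "incl U \<in> mor U U" if "fd_subspace U" for U using that by (intro incl_in_mor fd_subspace_imp_subspace) auto
  show "continuous_map (Sp (tau n G) V) (Sp (tau n G) W) (Mp (tau n G) V W f)"
    unfolding Mp_tau
  proof (rule continuous_map_tau[OF regular_axioms regular_axioms V W])
    show "continuous_map (Sp G (V \<oplus>\<^sub>v U)) (Sp G (W \<oplus>\<^sub>v U)) (Mp G (V \<oplus>\<^sub>v U) (W \<oplus>\<^sub>v U) (dsum_mor V U f (incl U)))"
      if "fd_subspace U" for U
      using that V W f i by (intro Mp_continuous fd_subspace_dsum dsum_mor_in_mor)
  qed (rule Mp_dsum_nat[OF V W f])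
  have "Mp G (V \<oplus>\<^sub>v u k) (W \<oplus>\<^sub>v u k) (dsum_mor V (u k) f (incl (u k))) (Pt G (V \<oplus>\<^sub>v u k)) = Pt G (W \<oplus>\<^sub>v u k)"
    if "in_index (n + 1) k t u" for k t u
    using in_index_fd[OF that] V W f i by (intro Mp_Pt fd_subspace_dsum dsum_mor_in_mor)
  then show "Mp (tau n G) V W f (Pt (tau n G) V) = Pt (tau n G) W"
    unfolding Mp_tau Pt_tau fam_map_index by (simp cong: if_cong)
next
  fix V W X :: "real coords set" and f g x
  assume fd: "fd_subspace V" "fd_subspace W" "fd_subspace X" and f: "f \<in> mor V W" and g: "g \<in> mor W X"
    and x: "x \<in> topspace (Sp (tau n G) V)"
  have i: "incl U \<in> mor U U" if "fd_subspace U" for U using that by (intro incl_in_mor fd_subspace_imp_subspace) auto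
  show "Mp (tau n G) W X g (Mp (tau n G) V W f x) = Mp (tau n G) V X (g \<circ> f) x"
    using x
  proof (rule Sp_tau_cases[OF fd(1)])
    fix v assume xv: "x = Fam (\<lambda>k t u. if in_index (n + 1) k t u then v k t u else Star)"
      and v: "\<And>k t u. in_index (n + 1) k t u \<Longrightarrow> v k t u \<in> topspace (Sp G (V \<oplus>\<^sub>v u k))"
    have "Mp G (W \<oplus>\<^sub>v u k) (X \<oplus>\<^sub>v u k) (dsum_mor W (u k) g (incl (u k)))
          (Mp G (V \<oplus>\<^sub>v u k) (W \<oplus>\<^sub>v u k) (dsum_mor V (u k) f (incl (u k))) (v k t u))
        = Mp G (V \<oplus>\<^sub>v u k) (X \<oplus>\<^sub>v u k) (dsum_mor V (u k) (g \<circ> f) (incl (u k))) (v k t u)"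
      if ix: "in_index (n + 1) k t u" for k t u
    proof -
      note U = in_index_fd[OF ix]
      have "incl (u k) \<circ> incl (u k) = incl (u k)" using incl_comp_mor[OF i[OF U]] .
      then show ?thesis
        using Mp_comp[OF fd_subspace_dsum[OF fd(1) U] fd_subspace_dsum[OF fd(2) U] fd_subspace_dsum[OF fd(3) U]
            dsum_mor_in_mor[OF f i[OF U] fd(1,2) U U] dsum_mor_in_mor[OF g i[OF U] fd(2,3) U U] v[OF ix]]
          dsum_mor_comp[OF f i[OF U] g i[OF U]] by simp
    qed
    then show ?thesis unfolding xv Mp_tau fam_map_index by (simp cong: if_cong)
  qed
qed

end

section \<open>Actions on functors and their fixed points under \<open>tau\<close>\<close>

text \<open>Naturality is plain rather than twisted, because conjugation fixes complexified
  isometries. Closedness of the fixed sets is part of the data so that it can be handed from stage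
  to stage.\<close>

locale regular_action = regular G for G :: "(real, 'a univ) fctr" +
  fixes \<sigma> :: "real coords set \<Rightarrow> 'a univ \<Rightarrow> 'a univ"
  assumes \<sigma>_continuous: "fd_subspace V \<Longrightarrow> continuous_map (Sp G V) (Sp G V) (\<sigma> V)"
    and \<sigma>_Pt: "fd_subspace V \<Longrightarrow> \<sigma> V (Pt G V) = Pt G V"
    and \<sigma>_closed: "fd_subspace V \<Longrightarrow> closedin (Sp G V) {x \<in> topspace (Sp G V). \<sigma> V x = x}"
    and \<sigma>_nat: "fd_subspace V \<Longrightarrow> fd_subspace W \<Longrightarrow> f \<in> mor V W \<Longrightarrow> x \<in> topspace (Sp G V) \<Longrightarrow>
      \<sigma> W (Mp G V W f x) = Mp G V W f (\<sigma> V x)"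
begin

lemma \<sigma>_in: "fd_subspace V \<Longrightarrow> x \<in> topspace (Sp G V) \<Longrightarrow> \<sigma> V x \<in> topspace (Sp G V)"
  using continuous_map_image_subset_topspace[OF \<sigma>_continuous] by blast

text \<open>A frame is invertible onto its image, so the map it induces on values is injective;
  since it also commutes with \<sigma>, a point is fixed before applying the frame exactly when it
  is fixed afterwards.\<close>

lemma fixed_frame_proj_iff:
  assumes V: "fd_subspace V" and i: "i \<in> {1..m}" and f: "f \<in> mor (std_space i) (std_space m)"
    and x: "x \<in> topspace (Sp G (V \<oplus>\<^sub>v std_space i))"
  shows "(case frame_proj G V i (f, x) of (U, y) \<Rightarrow> \<sigma> (V \<oplus>\<^sub>v U) y = y) \<longleftrightarrow> \<sigma> (V \<oplus>\<^sub>v std_space i) x = x"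
proof -
  have U: "fd_subspace (f ` std_space i)"
    using image_frame_nonzero[OF _ f] i nonzero_subspaces_fd by simp
  note d = fd_subspace_dsum[OF V fd_subspace_std_space[of i]] fd_subspace_dsum[OF V U]
  define F where "F = dsum_mor V (std_space i) (incl V) f"
  have F: "F \<in> mor (V \<oplus>\<^sub>v std_space i) (V \<oplus>\<^sub>v f ` std_space i)" unfolding F_def by (rule frame_mor[OF V f])
  obtain f' where f': "f' \<in> mor (f ` std_space i) (std_space i)" "f' \<circ> f = incl (std_space i)"
    using mor_inverse[OF f fd_subspace_std_space] by metis
  have fm: "f \<in> mor (std_space i) (f ` std_space i)" using f by (auto simp: mor_def)
  have iV: "incl V \<in> mor V V" using V by (intro incl_in_mor fd_subspace_imp_subspace) auto
  define F' where "F' = dsum_mor V (f ` std_space i) (incl V) f'"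
  have F': "F' \<in> mor (V \<oplus>\<^sub>v f ` std_space i) (V \<oplus>\<^sub>v std_space i)"
    unfolding F'_def by (rule dsum_mor_in_mor[OF iV f'(1) V V U fd_subspace_std_space])
  have "F' \<circ> F = incl (V \<oplus>\<^sub>v std_space i)"
    unfolding F_def F'_def using dsum_mor_comp[OF iV fm iV f'(1)] incl_comp_mor[OF iV] f'(2)
    by (simp add: dsum_mor_incl)
  then have inv: "Mp G (V \<oplus>\<^sub>v f ` std_space i) (V \<oplus>\<^sub>v std_space i) F' (Mp G (V \<oplus>\<^sub>v std_space i) (V \<oplus>\<^sub>v f ` std_space i) F y) = y"
    if "y \<in> topspace (Sp G (V \<oplus>\<^sub>v std_space i))" for y
    using Mp_comp[OF d(1,2,1) F F' that] Mp_incl[OF d(1) that] by simp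
  show ?thesis
    using inv[OF x] inv[OF \<sigma>_in[OF d(1) x]] \<sigma>_nat[OF d F x] by (auto simp: frame_proj_def F_def)
qed

text \<open>Pulled back to frames, the set is all frames times the fixed points of a single value,
  which is closed.\<close>

lemma closedin_total_fixed:
  assumes V: "fd_subspace V"
  shows "closedin (total_space m G V) {z \<in> topspace (total_space m G V). case z of (U, y) \<Rightarrow> \<sigma> (V \<oplus>\<^sub>v U) y = y}"
  unfolding topspace_total_space[OF V]
  unfolding total_space_regular closedin_final_topology[OF frame_proj_in[OF V]]
proof (intro conjI ballI)
  fix i assume i: "i \<in> {1..m}"
  let ?F = "top_of_set (mor (std_space i) (std_space m) :: (real coords \<Rightarrow> real coords) set)"
  let ?S = "SIGMA U:nonzero_subspaces m. topspace (Sp G (V \<oplus>\<^sub>v U))"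
  let ?X = "prod_topology ?F (Sp G (V \<oplus>\<^sub>v std_space i))"
  let ?A = "{x \<in> topspace (Sp G (V \<oplus>\<^sub>v std_space i)). \<sigma> (V \<oplus>\<^sub>v std_space i) x = x}"
  have "{z \<in> topspace ?X. frame_proj G V i z \<in> {z \<in> ?S. case z of (U, y) \<Rightarrow> \<sigma> (V \<oplus>\<^sub>v U) y = y}}
      = topspace ?F \<times> ?A" (is "?L = ?R")
  proof (rule Set.set_eqI)
    fix z
    show "z \<in> ?L \<longleftrightarrow> z \<in> ?R"
    proof (cases "z \<in> topspace ?X")
      case True
      then have "frame_proj G V i z \<in> ?S" using frame_proj_in[OF V, of m] i by blast
      moreover obtain f x where "z = (f, x)" "f \<in> mor (std_space i) (std_space m)"
          "x \<in> topspace (Sp G (V \<oplus>\<^sub>v std_space i))" using True by auto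
      ultimately show ?thesis using fixed_frame_proj_iff[OF V i] True by simp
    qed auto
  qed
  moreover have "closedin ?X (topspace ?F \<times> ?A)"
    unfolding closedin_prod_Times_iff using \<sigma>_closed[OF fd_subspace_dsum[OF V fd_subspace_std_space]] by simp
  ultimately show "closedin ?X {z \<in> topspace ?X. frame_proj G V i z \<in> {z \<in> ?S. case z of (U, y) \<Rightarrow> \<sigma> (V \<oplus>\<^sub>v U) y = y}}"
    by (simp only:)
qed auto

text \<open>A family is fixed when all its values are, since both sides are \<open>Star\<close> off
  the index set. The second form is the shape in which closed subsets of the total space enter
  \<open>closedin_holim_values\<close> and \<open>holim_subtopology\<close>.\<close>

lemma tau_fixed_iff:
  assumes V: "fd_subspace V" and h: "h \<in> topspace (tau_holim n G V)"
  shows "tau_map n \<sigma> V (enc (n + 1) h) = enc (n + 1) h \<longleftrightarrow>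
    (\<forall>k. h k ` (standard_simplex k \<times> topspace (chain_space (subspace_poset (n + 1)) k))
      \<subseteq> {z \<in> topspace (total_space (n + 1) G V). case z of (U, y) \<Rightarrow> \<sigma> (V \<oplus>\<^sub>v U) y = y})"
proof -
  have *: "(\<forall>k t u. t \<in> S k \<and> u \<in> C k \<longrightarrow> h k (t, u) \<in> A) \<longleftrightarrow> (\<forall>k. h k ` (S k \<times> C k) \<subseteq> A)"
    for S :: "nat \<Rightarrow> (nat \<Rightarrow> real) set" and C :: "nat \<Rightarrow> (nat \<Rightarrow> real coords set) set" and A
    by auto
  have "tau_map n \<sigma> V (enc (n + 1) h) = enc (n + 1) h \<longleftrightarrow>
      (\<forall>k t u. in_index (n + 1) k t u \<longrightarrow> \<sigma> (V \<oplus>\<^sub>v u k) (snd (h k (t, u))) = snd (h k (t, u)))"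
    unfolding tau_map_def enc_real fam_map_index univ.inject fun_eq_iff by auto
  also have "\<dots> \<longleftrightarrow> (\<forall>k t u. in_index (n + 1) k t u \<longrightarrow>
      h k (t, u) \<in> {z \<in> topspace (total_space (n + 1) G V). case z of (U, y) \<Rightarrow> \<sigma> (V \<oplus>\<^sub>v U) y = y})"
  proof (intro all_cong1 imp_cong refl)
    fix k t u assume i: "in_index (n + 1) k t u"
    then have "h k (t, u) \<in> topspace (total_space (n + 1) G V)"
      using holim_value(1)[OF h] by (simp add: in_index_iff)
    then show "\<sigma> (V \<oplus>\<^sub>v u k) (snd (h k (t, u))) = snd (h k (t, u)) \<longleftrightarrow>
        h k (t, u) \<in> {z \<in> topspace (total_space (n + 1) G V). case z of (U, y) \<Rightarrow> \<sigma> (V \<oplus>\<^sub>v U) y = y}"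
      using tau_holim_value(1)[OF V h i] by (metis (mono_tags, lifting) case_prod_conv mem_Collect_eq)
  qed
  also have "\<dots> \<longleftrightarrow> (\<forall>k. h k ` (standard_simplex k \<times> topspace (chain_space (subspace_poset (n + 1)) k))
      \<subseteq> {z \<in> topspace (total_space (n + 1) G V). case z of (U, y) \<Rightarrow> \<sigma> (V \<oplus>\<^sub>v U) y = y})"
    unfolding in_index_iff by (rule *)
  finally show ?thesis .
qed

lemma closedin_tau_fixed:
  assumes V: "fd_subspace V"
  shows "closedin (Sp (tau n G) V) {x \<in> topspace (Sp (tau n G) V). tau_map n \<sigma> V x = x}"
proof -
  let ?A = "{z \<in> topspace (total_space (n + 1) G V). case z of (U, y) \<Rightarrow> \<sigma> (V \<oplus>\<^sub>v U) y = y}"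
  let ?tr = "\<lambda>U U'. Mp G (V \<oplus>\<^sub>v U) (V \<oplus>\<^sub>v U') (incl (V \<oplus>\<^sub>v U))"
  have "{h \<in> topspace (tau_holim n G V). enc (n + 1) h \<in> {x \<in> topspace (Sp (tau n G) V). tau_map n \<sigma> V x = x}}
    = {h \<in> topspace (tau_holim n G V).
        \<forall>k. h k ` (standard_simplex k \<times> topspace (chain_space (subspace_poset (n + 1)) k)) \<subseteq> ?A}"
  proof (intro Collect_cong conj_cong refl)
    fix h assume h: "h \<in> topspace (tau_holim n G V)"
    show "enc (n + 1) h \<in> {x \<in> topspace (Sp (tau n G) V). tau_map n \<sigma> V x = x} \<longleftrightarrow>
        (\<forall>k. h k ` (standard_simplex k \<times> topspace (chain_space (subspace_poset (n + 1)) k)) \<subseteq> ?A)"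
      unfolding mem_Collect_eq Sp_tau topspace_transport tau_fixed_iff[OF V h, symmetric] using h by blast
  qed
  moreover have "closedin (tau_holim n G V) {h \<in> topspace (tau_holim n G V).
        \<forall>k. h k ` (standard_simplex k \<times> topspace (chain_space (subspace_poset (n + 1)) k)) \<subseteq> ?A}"
    using closedin_kifyI[OF closedin_holim_values[OF closedin_total_fixed[OF V], where tr = ?tr]]
    unfolding holim_eq topspace_kify .
  ultimately show ?thesis by (auto simp: Sp_tau closedin_transport)
qed

text \<open>Naturality of \<sigma> makes it act on sections, and the fixed families form a closed
  set again; thus the assumptions reproduce themselves and \<open>tau\<close> can be
  iterated.\<close>

lemma regular_action_tau: "regular_action (tau n G) (tau_map n \<sigma>)"
proof -
  interpret t: regular "tau n G" by (rule regular_tau)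
  show ?thesis
  proof
    fix V :: "real coords set" assume V: "fd_subspace V"
    show "continuous_map (Sp (tau n G) V) (Sp (tau n G) V) (tau_map n \<sigma> V)"
      unfolding tau_map_def
    proof (rule continuous_map_tau[OF regular_axioms regular_axioms V V])
      show "continuous_map (Sp G (V \<oplus>\<^sub>v U)) (Sp G (V \<oplus>\<^sub>v U)) (\<sigma> (V \<oplus>\<^sub>v U))" if "fd_subspace U" for U
        by (rule \<sigma>_continuous[OF fd_subspace_dsum[OF V that]])
      show "\<sigma> (V \<oplus>\<^sub>v U') (Mp G (V \<oplus>\<^sub>v U) (V \<oplus>\<^sub>v U') (dsum_mor V U (incl V) f) x)
          = Mp G (V \<oplus>\<^sub>v U) (V \<oplus>\<^sub>v U') (dsum_mor V U (incl V) f) (\<sigma> (V \<oplus>\<^sub>v U) x)"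
        if "fd_subspace U" "fd_subspace U'" "f \<in> mor U U'" "x \<in> topspace (Sp G (V \<oplus>\<^sub>v U))" for U U' f x
        using that V by (intro \<sigma>_nat fd_subspace_dsum dsum_mor_in_mor incl_in_mor fd_subspace_imp_subspace) auto
    qed
    have "\<sigma> (V \<oplus>\<^sub>v u k) (Pt G (V \<oplus>\<^sub>v u k)) = Pt G (V \<oplus>\<^sub>v u k)" if "in_index (n + 1) k t u" for k t u
      by (rule \<sigma>_Pt[OF fd_subspace_dsum[OF V in_index_fd[OF that]]])
    then show "tau_map n \<sigma> V (Pt (tau n G) V) = Pt (tau n G) V"
      unfolding tau_map_def Pt_tau fam_map_index by (simp cong: if_cong)
    show "closedin (Sp (tau n G) V) {x \<in> topspace (Sp (tau n G) V). tau_map n \<sigma> V x = x}"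
      by (rule closedin_tau_fixed[OF V])
  next
    fix V W :: "real coords set" and f x
    assume V: "fd_subspace V" and W: "fd_subspace W" and f: "f \<in> mor V W" and x: "x \<in> topspace (Sp (tau n G) V)"
    show "tau_map n \<sigma> W (Mp (tau n G) V W f x) = Mp (tau n G) V W f (tau_map n \<sigma> V x)"
      using x
    proof (rule Sp_tau_cases[OF V])
      fix v assume xv: "x = Fam (\<lambda>k t u. if in_index (n + 1) k t u then v k t u else Star)"
        and v: "\<And>k t u. in_index (n + 1) k t u \<Longrightarrow> v k t u \<in> topspace (Sp G (V \<oplus>\<^sub>v u k))"
      have "\<sigma> (W \<oplus>\<^sub>v u k) (Mp G (V \<oplus>\<^sub>v u k) (W \<oplus>\<^sub>v u k) (dsum_mor V (u k) f (incl (u k))) (v k t u))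
          = Mp G (V \<oplus>\<^sub>v u k) (W \<oplus>\<^sub>v u k) (dsum_mor V (u k) f (incl (u k))) (\<sigma> (V \<oplus>\<^sub>v u k) (v k t u))"
        if "in_index (n + 1) k t u" for k t u
        using in_index_fd[OF that] v[OF that] V W f
        by (intro \<sigma>_nat fd_subspace_dsum dsum_mor_in_mor incl_in_mor fd_subspace_imp_subspace) auto
      then show ?thesis unfolding xv Mp_tau tau_map_def fam_map_index by (simp cong: if_cong)
    qed
  qed
qed

lemma eta_equivariant:
  assumes V: "fd_subspace V" and x: "x \<in> topspace (Sp G V)"
  shows "eta n G V (\<sigma> V x) = tau_map n \<sigma> V (eta n G V x)"
proof -
  have "Mp G V (V \<oplus>\<^sub>v u k) (dsum_in1 V) (\<sigma> V x) = \<sigma> (V \<oplus>\<^sub>v u k) (Mp G V (V \<oplus>\<^sub>v u k) (dsum_in1 V) x)"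
    if "in_index (n + 1) k t u" for k t u
    using in_index_fd[OF that] V x
    by (intro \<sigma>_nat[symmetric] fd_subspace_dsum dsum_in1_in_mor fd_subspace_imp_subspace)
  then show ?thesis unfolding eta_def tau_map_def fam_map_index by (simp cong: if_cong)
qed

end

text \<open>A relation rather than an operation, since both functors are given in the applications:
  one is built from fixed points, and the other has its fixed points taken at the end. The spaces
  are compared only at finite-dimensional subspaces, while the maps are equal as functions.\<close>

definition fixed_functor :: "(real, 'a univ) fctr \<Rightarrow> (real coords set \<Rightarrow> 'a univ \<Rightarrow> 'a univ) \<Rightarrow> (real, 'a univ) fctr \<Rightarrow> bool" where
  "fixed_functor G \<sigma> G' \<longleftrightarrow> Pt G' = Pt G \<and> Mp G' = Mp G \<and>
     (\<forall>V. fd_subspace V \<longrightarrow> Sp G' V = fixed_space (Sp G V) (\<sigma> V))"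

lemma topspace_fixed_space [simp]: "topspace (fixed_space X s) = {x \<in> topspace X. s x = x}"
  by (auto simp: fixed_space_def)

context regular_action begin

text \<open>The total space is a final topology and the fixed part is closed. Above it, the
  restriction is the product of the frames with the fixed points of one value, which is the
  corresponding stage for \<open>G'\<close>.\<close>

lemma total_space_fixed:
  assumes G': "fixed_functor G \<sigma> G'" and V: "fd_subspace V"
  shows "total_space m G' V = subtopology (total_space m G V) {(U, y). \<sigma> (V \<oplus>\<^sub>v U) y = y}"
proof -
  let ?F = "\<lambda>i. top_of_set (mor (std_space i) (std_space m) :: (real coords \<Rightarrow> real coords) set)"
  let ?Q = "\<lambda>z. case z of (U, y) \<Rightarrow> \<sigma> (V \<oplus>\<^sub>v U) y = y"
  let ?S = "SIGMA U:nonzero_subspaces m. topspace (Sp G (V \<oplus>\<^sub>v U))"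
  have Sp': "Sp G' (V \<oplus>\<^sub>v U) = fixed_space (Sp G (V \<oplus>\<^sub>v U)) (\<sigma> (V \<oplus>\<^sub>v U))" if "fd_subspace U" for U
    using G' fd_subspace_dsum[OF V that] by (simp add: fixed_functor_def)
  have fp: "frame_proj G' V = frame_proj G V"
    using G' by (intro HOL.ext) (simp add: fixed_functor_def frame_proj_def)
  have "subtopology (total_space m G V) {z. ?Q z}
      = final_topology {z \<in> ?S. ?Q z} {1..m}
          (\<lambda>i. subtopology (prod_topology (?F i) (Sp G (V \<oplus>\<^sub>v std_space i))) {z. ?Q (frame_proj G V i z)}) (frame_proj G V)"
    unfolding total_space_regular
    by (rule subtopology_final_topology[OF frame_proj_in[OF V]])
      (use closedin_total_fixed[OF V, of m] in \<open>unfold topspace_total_space[OF V], unfold total_space_regular\<close>)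
  also have "\<dots> = total_space m G' V"
    unfolding total_space_frame_proj fp
  proof (rule final_topology_cong)
    show "{z \<in> ?S. ?Q z} = (SIGMA U:topspace (subspace_poset m). topspace (Sp G' (V \<oplus>\<^sub>v U)))"
      using Sp' nonzero_subspaces_fd by auto
    fix i assume i: "i \<in> {1..m}"
    let ?X = "prod_topology (?F i) (Sp G (V \<oplus>\<^sub>v std_space i))"
    let ?B = "topspace (?F i) \<times> {x. \<sigma> (V \<oplus>\<^sub>v std_space i) x = x}"
    have "topspace ?X \<inter> {z. ?Q (frame_proj G V i z)} = topspace ?X \<inter> ?B"
    proof (rule Set.set_eqI)
      fix z show "z \<in> topspace ?X \<inter> {z. ?Q (frame_proj G V i z)} \<longleftrightarrow> z \<in> topspace ?X \<inter> ?B"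
      proof (cases "z \<in> topspace ?X")
        case True
        then obtain f x where "z = (f, x)" "f \<in> mor (std_space i) (std_space m)"
          "x \<in> topspace (Sp G (V \<oplus>\<^sub>v std_space i))" by auto
        then show ?thesis using fixed_frame_proj_iff[OF V i] by simp
      qed simp
    qed
    then have "subtopology ?X {z. ?Q (frame_proj G V i z)} = subtopology ?X ?B"
      by (rule subtopology_cong)
    also have "\<dots> = prod_topology (?F i) (Sp G' (V \<oplus>\<^sub>v std_space i))"
      unfolding Sp'[OF fd_subspace_std_space] fixed_space_def prod_topology_subtopology(2) ..
    finally show "subtopology ?X {z. ?Q (frame_proj G V i z)}
        = prod_topology (top_of_set (real_frames i m)) (Sp G' (V \<oplus>\<^sub>v std_space i))"
      by (simp add: real_frames_real)
  qed simp
  finally show ?thesis by simp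
qed

text \<open>The restriction passes in turn through the total space, the homotopy limit and the
  encoding, each time over a closed set.\<close>

lemma fixed_functor_tau:
  assumes G': "fixed_functor G \<sigma> G'"
  shows "fixed_functor (tau n G) (tau_map n \<sigma>) (tau n G')"
  unfolding fixed_functor_def
proof (intro conjI allI impI)
  have PM: "Pt G' = Pt G" "Mp G' = Mp G" using G' by (auto simp: fixed_functor_def)
  show "Pt (tau n G') = Pt (tau n G)" "Mp (tau n G') = Mp (tau n G)" unfolding tau_def PM by simp_all
  fix V :: "real coords set" assume V: "fd_subspace V"
  let ?A = "{z \<in> topspace (total_space (n + 1) G V). case z of (U, y) \<Rightarrow> \<sigma> (V \<oplus>\<^sub>v U) y = y}"
  let ?C = "{h. \<forall>k. h k ` (standard_simplex k \<times> topspace (chain_space (subspace_poset (n + 1)) k)) \<subseteq> ?A}"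
  have "total_space (n + 1) G' V = subtopology (total_space (n + 1) G V) ?A"
  proof -
    have "?A = topspace (total_space (n + 1) G V) \<inter> {(U, y). \<sigma> (V \<oplus>\<^sub>v U) y = y}" by auto
    then show ?thesis unfolding total_space_fixed[OF G' V] by (intro subtopology_cong) blast
  qed
  then have "tau_holim n G' V = subtopology (tau_holim n G V) ?C"
    unfolding PM using holim_subtopology[OF closedin_total_fixed[OF V]] by simp
  also have "\<dots> = subtopology (tau_holim n G V) {h. tau_map n \<sigma> V (enc (n + 1) h) = enc (n + 1) h}"
  proof -
    have "topspace (tau_holim n G V) \<inter> ?C
        = topspace (tau_holim n G V) \<inter> {h. tau_map n \<sigma> V (enc (n + 1) h) = enc (n + 1) h}"
    proof (rule Set.set_eqI)
      fix h show "h \<in> topspace (tau_holim n G V) \<inter> ?C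
        \<longleftrightarrow> h \<in> topspace (tau_holim n G V) \<inter> {h. tau_map n \<sigma> V (enc (n + 1) h) = enc (n + 1) h}"
        unfolding Int_iff mem_Collect_eq using tau_fixed_iff[OF V, of h n] by argo
    qed
    then show ?thesis by (rule subtopology_cong)
  qed
  finally have "Sp (tau n G') V = transport (enc (n + 1))
      (subtopology (tau_holim n G V) {h. tau_map n \<sigma> V (enc (n + 1) h) = enc (n + 1) h})"
    by (simp only: Sp_tau)
  also have "\<dots> = subtopology (Sp (tau n G) V) {x. tau_map n \<sigma> V x = x}"
    unfolding Sp_tau
    by (rule subtopology_transport[symmetric]) (use closedin_tau_fixed[OF V, of n] in \<open>simp only: Sp_tau\<close>)
  finally show "Sp (tau n G') V = fixed_space (Sp (tau n G) V) (tau_map n \<sigma> V)"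
    by (simp only: fixed_space_def)
qed

end

section \<open>Comparison of real and complex scalars\<close>

text \<open>Literal equality, for the maps even as functions on the whole type, so that
  constructions applied to both sides can be compared by rewriting.\<close>

definition agree :: "(real, 'a univ) fctr \<Rightarrow> (complex, 'a univ) fctr \<Rightarrow> bool" where
  "agree G E \<longleftrightarrow>
     (\<forall>V. fd_subspace V \<longrightarrow> Sp G V = Sp E (ext V) \<and> Pt G V = Pt E (ext V)) \<and>
     (\<forall>V W f. fd_subspace V \<and> fd_subspace W \<and> f \<in> mor V W \<longrightarrow>
        Mp G V W f = Mp E (ext V) (ext W) (cplx_mor V f))"

lemma agreeD:
  assumes "agree G E" "fd_subspace V"
  shows "Sp G V = Sp E (ext V)" "Pt G V = Pt E (ext V)"
    "fd_subspace W \<Longrightarrow> f \<in> mor V W \<Longrightarrow> Mp G V W f = Mp E (ext V) (ext W) (cplx_mor V f)"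
  using assms by (auto simp: agree_def)

section \<open>Real and complex posets of subspaces\<close>

text \<open>The inverse of complexification on the posets.\<close>

definition real_points :: "complex coords set \<Rightarrow> real coords set" where
  "real_points Z = {x. (\<lambda>i. complex_of_real (x i)) \<in> Z}"

lemma real_points_ext [simp]: "scl.subspace U \<Longrightarrow> real_points (ext U) = U"
  using scl.subspace_0 by (auto simp: real_points_def in_ext_iff comp_def zero_fun_def)

lemma nonzero_subspaces_subspace: "U \<in> nonzero_subspaces m \<Longrightarrow> scl.subspace U"
  by (simp add: nonzero_subspaces_def)

lemma sq_norm_of_real: "sq_norm (\<lambda>i. complex_of_real (x i)) = sq_norm x"
  by (simp add: sq_norm_def)

definition real_restriction ::
    "nat \<Rightarrow> (complex coords \<Rightarrow> complex coords) \<Rightarrow> real coords \<Rightarrow> real coords" where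
  "real_restriction i g x = (if x \<in> std_space i then Re \<circ> g (\<lambda>l. complex_of_real (x l)) else 0)"

text \<open>An isometry with real matrix preserves real vectors and is determined by its effect on
  them, by complex linearity.\<close>

lemma real_restriction_frame:
  assumes g: "g \<in> real_frames i m"
  shows "real_restriction i g \<in> mor (std_space i) (std_space m)"
    and "cplx_mor (std_space i) (real_restriction i g) = g"
proof -
  define c where "c x = (\<lambda>l. complex_of_real (x l))" for x :: "real coords"
  define f where "f = real_restriction i g"
  have gm: "g \<in> mor (std_space i) (std_space m)" using g by (simp add: real_frames_def)
  have cs: "c x \<in> std_space i" if "x \<in> std_space i" for x using that by (simp add: c_def std_space_def)
  have gc: "g (c x) = c (f x)" if x: "x \<in> std_space i" for x
  proof
    fix l
    have "g (c x) l \<in> \<real>" using g cs[OF x] by (auto simp: real_frames_def c_def)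
    then show "g (c x) l = c (f x) l"
      using x by (auto simp: f_def real_restriction_def c_def elim: Reals_cases)
  qed
  have c_inj: "c x = c y \<Longrightarrow> x = y" for x y by (auto simp: c_def fun_eq_iff)
  have c_add: "c (x + y) = c x + c y" for x y by (auto simp: c_def)
  have c_scl: "c (scl a x) = scl (complex_of_real a) (c x)" for a x by (auto simp: c_def)
  have s: "scl.subspace (std_space i :: real coords set)" by (rule subspace_std_space)
  have "f \<in> mor (std_space i) (std_space m)"
    unfolding mor_def mem_Collect_eq
  proof (intro conjI ballI allI impI)
    show "f ` std_space i \<subseteq> std_space m"
    proof
      fix y assume "y \<in> f ` std_space i"
      then obtain x where x: "x \<in> std_space i" "y = f x" by blast
      have "c y \<in> std_space m" using mor_in[OF gm cs[OF x(1)]] gc[OF x(1)] x(2) by simp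
      then show "y \<in> std_space m" by (simp add: c_def std_space_def)
    qed
    fix x :: "real coords" assume x: "x \<in> std_space i"
    { fix y :: "real coords" assume y: "y \<in> std_space i"
      have "c (f (x + y)) = c (f x + f y)"
        using mor_add[OF gm cs[OF x] cs[OF y]] gc[OF x] gc[OF y] gc[OF scl.subspace_add[OF s x y]]
        unfolding c_add by metis
      then show "f (x + y) = f x + f y" by (rule c_inj) }
    { fix a
      have "c (f (scl a x)) = c (scl a (f x))"
        using mor_scl[OF gm cs[OF x]] gc[OF x] gc[OF scl.subspace_scale[OF s x]]
        unfolding c_scl by metis
      then show "f (scl a x) = scl a (f x)" by (rule c_inj) }
    show "sq_norm (f x) = sq_norm x"
      using mor_sq_norm[OF gm cs[OF x]] gc[OF x] sq_norm_of_real unfolding c_def by metis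
  qed (simp add: f_def real_restriction_def)
  moreover have "cplx_mor (std_space i) f = g"
  proof
    fix z
    show "cplx_mor (std_space i) f z = g z"
    proof (cases "z \<in> std_space i")
      case True
      have ze: "z \<in> ext (std_space i)" using True by (simp add: ext_std_space)
      have ri: "Re \<circ> z \<in> std_space i" "Im \<circ> z \<in> std_space i" using True by (auto simp: std_space_def)
      have z: "z = c (Re \<circ> z) + scl \<i> (c (Im \<circ> z))" by (auto simp: c_def complex_eq_iff fun_eq_iff)
      have "scl \<i> (c (Im \<circ> z)) \<in> std_space i"
        by (rule scl.subspace_scale[OF subspace_std_space cs[OF ri(2)]])
      then have "g (c (Re \<circ> z) + scl \<i> (c (Im \<circ> z))) = c (f (Re \<circ> z)) + scl \<i> (c (f (Im \<circ> z)))"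
        using mor_add[OF gm cs[OF ri(1)]] mor_scl[OF gm cs[OF ri(2)]] gc[OF ri(1)] gc[OF ri(2)] by metis
      then have "g z = c (f (Re \<circ> z)) + scl \<i> (c (f (Im \<circ> z)))" using z by metis
      then show ?thesis
        by (auto simp: fun_eq_iff cplx_mor_apply[OF ze] c_def complex_eq_iff)
    next
      case False
      then show ?thesis using mor_outside[OF gm] by (simp add: cplx_mor_outside ext_std_space)
    qed
  qed
  ultimately show "real_restriction i g \<in> mor (std_space i) (std_space m)"
    "cplx_mor (std_space i) (real_restriction i g) = g" by (auto simp: f_def)
qed

lemma cplx_mor_frame:
  assumes f: "f \<in> mor (std_space i) (std_space m)"
  shows "cplx_mor (std_space i) f \<in> real_frames i m"
proof -
  have "cplx_mor (std_space i) f \<in> mor (std_space i) (std_space m)"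
    using cplx_mor_in_mor[OF f fd_subspace_std_space fd_subspace_std_space] by (simp add: ext_std_space)
  moreover have "cplx_mor (std_space i) f z l \<in> \<real>" if z: "z \<in> std_space i" "\<forall>l. z l \<in> \<real>" for z l
  proof -
    have "Im \<circ> z = 0" using z(2) by (auto simp: fun_eq_iff complex_is_Real_iff)
    then show ?thesis
      using z(1) cplx_mor_apply[of z "std_space i" f l] mor_zero[OF f] by (simp add: ext_std_space complex_is_Real_iff)
  qed
  ultimately show ?thesis by (simp add: real_frames_def)
qed

lemma continuous_on_eval2: "continuous_on A (\<lambda>f. f a l :: 'c::topological_space)"
  by (rule continuous_on_product_then_coordinatewise
      [OF continuous_on_subset[OF continuous_on_product_coordinates subset_UNIV]])

lemma continuous_map_cplx_mor:
  "continuous_map (top_of_set (mor (std_space i) (std_space m))) (top_of_set (real_frames i m))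
     (cplx_mor (std_space i))"
proof -
  have "continuous_on A (\<lambda>f. cplx_mor (std_space i) f z l)" for A z l
    unfolding cplx_mor_def Complex_eq
    by (cases "z \<in> ext (std_space i)") (auto intro!: continuous_intros continuous_on_eval2)
  then have "continuous_on A (cplx_mor (std_space i))" for A
    by (intro continuous_on_coordinatewise_then_product)
  then show ?thesis using cplx_mor_frame by auto
qed

lemma continuous_map_real_restriction:
  "continuous_map (top_of_set (real_frames i m)) (top_of_set (mor (std_space i) (std_space m)))
     (real_restriction i)"
proof -
  have "continuous_on A (\<lambda>g. real_restriction i g x l)" for A x l
    unfolding real_restriction_def comp_def
    by (cases "x \<in> std_space i") (auto intro!: continuous_intros continuous_on_eval2)
  then have "continuous_on A (real_restriction i)" for A
    by (intro continuous_on_coordinatewise_then_product)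
  then show ?thesis using real_restriction_frame(1) by auto
qed

lemma cplx_frame_image:
  "f \<in> mor (std_space i) (std_space m) \<Longrightarrow> cplx_mor (std_space i) f ` std_space i = ext (f ` std_space i)"
  using cplx_mor_image[OF _ subspace_std_space] by (simp add: ext_std_space)

lemma complex_frame_image:
  "g \<in> real_frames i m \<Longrightarrow> g ` std_space i = ext (real_restriction i g ` std_space i)"
  using cplx_frame_image[OF real_restriction_frame(1)] real_restriction_frame(2) by metis

lemma complex_frame_image_in_poset:
  "\<forall>i\<in>{1..m}. (\<lambda>g. g ` std_space i) \<in> topspace (top_of_set (real_frames i m :: (complex coords \<Rightarrow> complex coords) set))
     \<rightarrow> ext ` nonzero_subspaces m"
  using complex_frame_image image_frame_nonzero real_restriction_frame(1) by fastforce

lemma topspace_subspace_poset_complex: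
  "topspace (subspace_poset m :: complex coords set topology) = ext ` nonzero_subspaces m"
  unfolding subspace_poset_def by (rule topspace_final_topology[OF complex_frame_image_in_poset])

text \<open>Complexifying a frame complexifies the subspace it spans, so continuity descends from
  frames.\<close>

lemma continuous_map_poset_ext: "continuous_map (subspace_poset m) (subspace_poset m :: complex coords set topology) ext"
proof (subst subspace_poset_real, rule continuous_map_from_final_topology[OF frame_image_in_poset])
  show "ext U \<in> topspace (subspace_poset m :: complex coords set topology)" if "U \<in> nonzero_subspaces m" for U
    using that by (simp add: topspace_subspace_poset_complex)
  fix i assume i: "i \<in> {1..m}"
  have "continuous_map (top_of_set (real_frames i m)) (subspace_poset m :: complex coords set topology) (\<lambda>g. g ` std_space i)"
    unfolding subspace_poset_def by (rule continuous_map_into_final_topology[OF complex_frame_image_in_poset i])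
  from continuous_map_compose[OF continuous_map_cplx_mor this]
  show "continuous_map (top_of_set (mor (std_space i) (std_space m))) (subspace_poset m :: complex coords set topology)
      (\<lambda>f. ext (f ` std_space i))"
    by (rule continuous_map_eq) (simp add: cplx_frame_image)
qed

lemma continuous_map_poset_real_points:
  "continuous_map (subspace_poset m) (subspace_poset m) real_points"
proof (subst subspace_poset_def, rule continuous_map_from_final_topology[OF complex_frame_image_in_poset])
  show "real_points Z \<in> topspace (subspace_poset m)" if "Z \<in> ext ` nonzero_subspaces m" for Z
    using that nonzero_subspaces_subspace by auto
  fix i assume i: "i \<in> {1..m}"
  have "continuous_map (top_of_set (mor (std_space i) (std_space m))) (subspace_poset m) (\<lambda>f :: real coords \<Rightarrow> real coords. f ` std_space i)"
    unfolding subspace_poset_real by (rule continuous_map_into_final_topology[OF frame_image_in_poset i])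
  from continuous_map_compose[OF continuous_map_real_restriction this]
  show "continuous_map (top_of_set (real_frames i m)) (subspace_poset m) (\<lambda>g. real_points (g ` std_space i))"
  proof (rule continuous_map_eq)
    fix g :: "complex coords \<Rightarrow> complex coords" assume "g \<in> topspace (top_of_set (real_frames i m))"
    then have g: "g \<in> real_frames i m" by simp
    have "scl.subspace (real_restriction i g ` std_space i)"
      by (rule subspace_mor_image[OF real_restriction_frame(1)[OF g] subspace_std_space])
    then show "((\<lambda>f. f ` std_space i) \<circ> real_restriction i) g = real_points (g ` std_space i)"
      by (simp add: complex_frame_image[OF g])
  qed
qed

text \<open>Supplies the comparison of test types for homotopy limits over different posets. Chains
  are pulled back along a left inverse of \<open>a\<close>, which makes \<open>h\<close> recoverable
  from its values on chains of the form \<open>a \<circ> u\<close>.\<close>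

lemma inj_section_family:
  fixes a :: "'p \<Rightarrow> 'q"
  assumes a: "inj a"
  shows "inj (\<lambda>(h :: nat \<Rightarrow> (nat \<Rightarrow> real) \<times> (nat \<Rightarrow> 'p) \<Rightarrow> 'p \<times> 'u) k (t, u). map_prod a id (h k (t, inv_into UNIV a \<circ> u)))"
proof (rule injI)
  fix h h' :: "nat \<Rightarrow> (nat \<Rightarrow> real) \<times> (nat \<Rightarrow> 'p) \<Rightarrow> 'p \<times> 'u"
  assume eq: "(\<lambda>k (t, u). map_prod a id (h k (t, inv_into UNIV a \<circ> u))) = (\<lambda>k (t, u). map_prod a id (h' k (t, inv_into UNIV a \<circ> u)))"
  have "h k (t, u) = h' k (t, u)" for k t u
  proof -
    have "inv_into UNIV a \<circ> (a \<circ> u) = u" using a by (auto simp: fun_eq_iff)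
    then have "map_prod a id (h k (t, u)) = map_prod a id (h' k (t, u))"
      using fun_cong[OF fun_cong[OF eq, of k], of "(t, a \<circ> u)"] by simp
    moreover have "inj (map_prod a (id :: 'u \<Rightarrow> 'u))" using a by (simp add: prod.inj_map)
    ultimately show ?thesis by (simp add: inj_eq)
  qed
  then show "h = h'" by (auto simp: fun_eq_iff)
qed

lemma inj_of_real_coords: "inj (\<lambda>(x :: real coords) i. complex_of_real (x i))"
  by (auto simp: inj_def fun_eq_iff)

text \<open>Interleaving real and imaginary parts embeds complex sequences in real ones. With the
  obvious embedding in the other direction, both k-ifications can be tested against each
  other.\<close>

lemma inj_join_Re_Im: "inj (\<lambda>z :: complex coords. join (Re \<circ> z) (Im \<circ> z))"
  by (auto simp: inj_def complex_coords_eq_iff)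

section \<open>\<open>tau\<close> over real and complex scalars\<close>

locale realification = regular G for G :: "(real, 'a univ) fctr" +
  fixes E :: "(complex, 'a univ) fctr"
  assumes agree: "agree G E"
begin

lemma Mp_agree:
  assumes "fd_subspace V" "fd_subspace U" "fd_subspace W" "fd_subspace U'"
    and f: "f \<in> mor V W" and g: "g \<in> mor U U'"
  shows "Mp E (ext V \<oplus>\<^sub>v ext U) (ext W \<oplus>\<^sub>v ext U') (dsum_mor (ext V) (ext U) (cplx_mor V f) (cplx_mor U g))
    = Mp G (V \<oplus>\<^sub>v U) (W \<oplus>\<^sub>v U') (dsum_mor V U f g)"
proof -
  note s = assms(1-4)[THEN fd_subspace_imp_subspace]
  show ?thesis
    using agreeD(3)[OF agree fd_subspace_dsum[OF assms(1,2)] fd_subspace_dsum[OF assms(3,4)]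
        dsum_mor_in_mor[OF f g assms(1,3,2,4)]] s
    by (simp add: ext_dsum cplx_mor_dsum)
qed

lemma Sp_agree:
  assumes "fd_subspace V" "fd_subspace U"
  shows "Sp E (ext V \<oplus>\<^sub>v ext U) = Sp G (V \<oplus>\<^sub>v U)"
  using agreeD(1)[OF agree fd_subspace_dsum[OF assms]] assms[THEN fd_subspace_imp_subspace]
  by (simp add: ext_dsum)

lemma Sp_agree_std:
  assumes "fd_subspace V"
  shows "Sp E (ext V \<oplus>\<^sub>v std_space i) = Sp G (V \<oplus>\<^sub>v std_space i)"
  using Sp_agree[OF assms fd_subspace_std_space[of i]] by (simp add: ext_std_space)

lemma frame_proj_cplx:
  assumes V: "fd_subspace V" and i: "i \<in> {1..m}" and f: "f \<in> mor (std_space i) (std_space m)"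
  shows "frame_proj E (ext V) i (cplx_mor (std_space i) f, x) = map_prod ext id (frame_proj G V i (f, x))"
proof -
  have U: "fd_subspace (f ` std_space i)"
    using image_frame_nonzero[OF _ f] i nonzero_subspaces_fd by simp
  have fm: "f \<in> mor (std_space i) (f ` std_space i)" using f by (auto simp: mor_def)
  have iV: "incl V \<in> mor V V" using V by (intro incl_in_mor fd_subspace_imp_subspace) auto
  show ?thesis
    using Mp_agree[OF V fd_subspace_std_space V U iV fm] V
    by (simp add: frame_proj_def cplx_frame_image[OF f] ext_std_space cplx_mor_incl fd_subspace_imp_subspace)
qed

lemma frame_proj_complex:
  assumes V: "fd_subspace V" and i: "i \<in> {1..m}" and g: "g \<in> real_frames i m"
  shows "frame_proj E (ext V) i (g, x) = map_prod ext id (frame_proj G V i (real_restriction i g, x))"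
  using frame_proj_cplx[OF V i real_restriction_frame(1)[OF g], of x] real_restriction_frame(2)[OF g] by simp

lemma frame_proj_complex_in:
  assumes V: "fd_subspace V"
  shows "\<forall>i\<in>{1..m}. frame_proj E (ext V) i
     \<in> topspace (prod_topology (top_of_set (real_frames i m)) (Sp E (ext V \<oplus>\<^sub>v std_space i)))
       \<rightarrow> (SIGMA U:topspace (subspace_poset m). topspace (Sp E (ext V \<oplus>\<^sub>v U)))"
proof (intro ballI funcsetI)
  fix i and z :: "(complex coords \<Rightarrow> complex coords) \<times> 'a univ" assume i: "i \<in> {1..m}"
    and z: "z \<in> topspace (prod_topology (top_of_set (real_frames i m)) (Sp E (ext V \<oplus>\<^sub>v std_space i)))"
  obtain g x where gx: "z = (g, x)" "g \<in> real_frames i m" "x \<in> topspace (Sp G (V \<oplus>\<^sub>v std_space i))"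
    using z by (auto simp: Sp_agree_std[OF V])
  have "frame_proj G V i \<in> topspace (prod_topology (top_of_set (mor (std_space i) (std_space m)))
      (Sp G (V \<oplus>\<^sub>v std_space i))) \<rightarrow> (SIGMA U:nonzero_subspaces m. topspace (Sp G (V \<oplus>\<^sub>v U)))"
    using frame_proj_in[OF V, of m] i by blast
  then have "frame_proj G V i (real_restriction i g, x) \<in> (SIGMA U:nonzero_subspaces m. topspace (Sp G (V \<oplus>\<^sub>v U)))"
    by (rule funcset_mem) (use gx(3) real_restriction_frame(1)[OF gx(2)] in simp)
  then show "frame_proj E (ext V) i z \<in> (SIGMA U:topspace (subspace_poset m). topspace (Sp E (ext V \<oplus>\<^sub>v U)))"
    unfolding gx(1) frame_proj_complex[OF V i gx(2)]
    using Sp_agree[OF V nonzero_subspaces_fd] by (auto simp: topspace_subspace_poset_complex)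
qed

lemma topspace_total_space_complex:
  assumes V: "fd_subspace V"
  shows "topspace (total_space m E (ext V)) = (SIGMA Z:ext ` nonzero_subspaces m. topspace (Sp E (ext V \<oplus>\<^sub>v Z)))"
  using topspace_final_topology[OF frame_proj_complex_in[OF V], of m]
  unfolding topspace_subspace_poset_complex total_space_frame_proj .

lemma continuous_map_total_ext:
  assumes V: "fd_subspace V"
  shows "continuous_map (total_space m G V) (total_space m E (ext V)) (\<lambda>(U, x). (ext U, x))"
proof (subst total_space_regular, rule continuous_map_from_final_topology[OF frame_proj_in[OF V]])
  show "(\<lambda>(U, x). (ext U, x)) z \<in> topspace (total_space m E (ext V))"
    if "z \<in> (SIGMA U:nonzero_subspaces m. topspace (Sp G (V \<oplus>\<^sub>v U)))" for z
    using that Sp_agree[OF V nonzero_subspaces_fd] by (auto simp: topspace_total_space_complex[OF V])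
  fix i assume i: "i \<in> {1..m}"
  let ?F = "top_of_set (mor (std_space i) (std_space m) :: (real coords \<Rightarrow> real coords) set)"
  have "continuous_map (prod_topology ?F (Sp G (V \<oplus>\<^sub>v std_space i)))
      (prod_topology (top_of_set (real_frames i m)) (Sp E (ext V \<oplus>\<^sub>v std_space i))) (\<lambda>z. (cplx_mor (std_space i) (fst z), snd z))"
    unfolding Sp_agree_std[OF V]
    by (intro continuous_map_pairedI continuous_map_snd
        continuous_map_compose[OF continuous_map_fst continuous_map_cplx_mor, unfolded comp_def])
  from continuous_map_compose[OF this continuous_map_into_final_topology[OF frame_proj_complex_in[OF V] i]]
  show "continuous_map (prod_topology ?F (Sp G (V \<oplus>\<^sub>v std_space i))) (total_space m E (ext V))
      (\<lambda>z. (\<lambda>(U, x). (ext U, x)) (frame_proj G V i z))"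
    unfolding total_space_frame_proj[symmetric]
    by (rule continuous_map_eq) (auto simp: frame_proj_cplx[OF V i] map_prod_def)
qed

lemma continuous_map_total_real_points:
  assumes V: "fd_subspace V"
  shows "continuous_map (total_space m E (ext V)) (total_space m G V) (\<lambda>(Z, x). (real_points Z, x))"
proof (subst total_space_frame_proj, rule continuous_map_from_final_topology[OF frame_proj_complex_in[OF V]])
  show "(\<lambda>(Z, x). (real_points Z, x)) z \<in> topspace (total_space m G V)"
    if "z \<in> (SIGMA Z:topspace (subspace_poset m). topspace (Sp E (ext V \<oplus>\<^sub>v Z)))" for z
    using that Sp_agree[OF V nonzero_subspaces_fd] nonzero_subspaces_subspace
    by (auto simp: topspace_total_space[OF V] topspace_subspace_poset_complex)
  fix i assume i: "i \<in> {1..m}"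
  let ?X = "prod_topology (top_of_set (real_frames i m :: (complex coords \<Rightarrow> complex coords) set)) (Sp E (ext V \<oplus>\<^sub>v std_space i))"
  have "continuous_map ?X (prod_topology (top_of_set (mor (std_space i) (std_space m))) (Sp G (V \<oplus>\<^sub>v std_space i)))
      (\<lambda>z. (real_restriction i (fst z), snd z))"
    unfolding Sp_agree_std[OF V]
    by (intro continuous_map_pairedI continuous_map_snd
        continuous_map_compose[OF continuous_map_fst continuous_map_real_restriction, unfolded comp_def])
  from continuous_map_compose[OF this continuous_map_frame_proj[OF V i]]
  show "continuous_map ?X (total_space m G V) (\<lambda>z. (\<lambda>(Z, x). (real_points Z, x)) (frame_proj E (ext V) i z))"
  proof (rule continuous_map_eq)
    fix z assume "z \<in> topspace ?X"
    then obtain g x where z: "z = (g, x)" "g \<in> real_frames i m" by auto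
    have "scl.subspace (real_restriction i g ` std_space i)"
      by (rule subspace_mor_image[OF real_restriction_frame(1)[OF z(2)] subspace_std_space])
    then show "(frame_proj G V i \<circ> (\<lambda>z. (real_restriction i (fst z), snd z))) z
        = (\<lambda>(Z, x). (real_points Z, x)) (frame_proj E (ext V) i z)"
      unfolding z(1) by (simp add: frame_proj_complex[OF V i z(2)]) (simp add: frame_proj_def)
  qed
qed

lemma transition_agree:
  assumes V: "fd_subspace V" and U: "fd_subspace U" and U': "fd_subspace U'" and le: "U \<subseteq> U'"
  shows "Mp E (ext V \<oplus>\<^sub>v ext U) (ext V \<oplus>\<^sub>v ext U') (incl (ext V \<oplus>\<^sub>v ext U)) = Mp G (V \<oplus>\<^sub>v U) (V \<oplus>\<^sub>v U') (incl (V \<oplus>\<^sub>v U))"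
proof -
  have "incl V \<in> mor V V" "incl U \<in> mor U U'"
    using V U le by (auto intro!: incl_in_mor fd_subspace_imp_subspace)
  from Mp_agree[OF V U V U' this] show ?thesis
    using V U by (simp add: cplx_mor_incl fd_subspace_imp_subspace dsum_mor_incl)
qed

text \<open>The two homotopy limits live on different types but are mapped to each other along
  \<open>ext\<close> and \<open>real_points\<close>. Because \<open>enc\<close> names complex chains
  by real ones, these maps do not change the encoded family.\<close>

lemma Sp_tau_agree:
  assumes V: "fd_subspace V"
  shows "Sp (tau n G) V = Sp (tau n E) (ext V)"
  unfolding Sp_tau
proof (rule transport_eqI)
  let ?QR = "subspace_poset (n + 1) :: real coords set topology"
  let ?QC = "subspace_poset (n + 1) :: complex coords set topology"
  let ?\<kappa> = "\<lambda>(U, x :: 'a univ). (ext U :: complex coords set, x)"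
  let ?\<kappa>' = "\<lambda>(Z, x :: 'a univ). (real_points Z, x)"
  have mono1: "real_points Z \<le> real_points Z'" if "Z \<le> Z'" for Z Z'
    using that by (auto simp: real_points_def)
  have mono2: "(ext U :: complex coords set) \<le> ext U'"
    if "U \<in> topspace ?QR" "U' \<in> topspace ?QR" "U \<le> U'" for U U'
    using that ext_subset_iff nonzero_subspaces_subspace by simp
  have re: "real_points (ext U) = U" if "U \<in> topspace ?QR" for U
    using that nonzero_subspaces_subspace by simp
  have er: "ext (real_points Z) = Z" if "Z \<in> topspace ?QC" for Z
    using that nonzero_subspaces_subspace by (auto simp: topspace_subspace_poset_complex)
  \<comment> \<open>Homotopy limits are contravariant in the poset, so the map towards complex
    scalars reads its chains through \<open>real_points\<close>.\<close>
  show "continuous_map (tau_holim n G V) (tau_holim n E (ext V)) (holim_map ?QC real_points ?\<kappa>)"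
  proof (rule continuous_map_holim[OF inj_section_family[OF inj_image[OF inj_of_real_coords]]
        continuous_map_poset_real_points continuous_map_poset_ext er mono1 mono2 continuous_map_total_ext[OF V]])
    fix Z Z' x assume Z: "Z \<in> topspace ?QC" "Z' \<in> topspace ?QC" "Z \<le> Z'"
    obtain U U' where U: "Z = ext U" "Z' = ext U'" "U \<in> nonzero_subspaces (n + 1)" "U' \<in> nonzero_subspaces (n + 1)"
      using Z(1,2) unfolding topspace_subspace_poset_complex by blast
    note fd = nonzero_subspaces_fd[OF U(3)] nonzero_subspaces_fd[OF U(4)]
    note s = fd[THEN fd_subspace_imp_subspace]
    have "U \<subseteq> U'" using Z(3) ext_subset_iff[OF s] U by simp
    then show "snd (?\<kappa> (real_points Z', Mp G (V \<oplus>\<^sub>v real_points Z) (V \<oplus>\<^sub>v real_points Z') (incl (V \<oplus>\<^sub>v real_points Z)) x))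
        = Mp E (ext V \<oplus>\<^sub>v Z) (ext V \<oplus>\<^sub>v Z') (incl (ext V \<oplus>\<^sub>v Z)) (snd (?\<kappa> (real_points Z, x)))"
      using transition_agree[OF V fd] s by (simp add: U)
  qed (use er in auto)
  show "continuous_map (tau_holim n E (ext V)) (tau_holim n G V) (holim_map ?QR ext ?\<kappa>')"
  proof (rule continuous_map_holim[OF inj_section_family[OF inj_image[OF inj_join_Re_Im]]
        continuous_map_poset_ext continuous_map_poset_real_points re mono2 mono1 continuous_map_total_real_points[OF V]])
    fix U U' x assume "U \<in> topspace ?QR" "U' \<in> topspace ?QR" "U \<le> U'"
    then show "snd (?\<kappa>' (ext U', Mp E (ext V \<oplus>\<^sub>v ext U) (ext V \<oplus>\<^sub>v ext U') (incl (ext V \<oplus>\<^sub>v ext U)) x))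
        = Mp G (V \<oplus>\<^sub>v U) (V \<oplus>\<^sub>v U') (incl (V \<oplus>\<^sub>v U)) (snd (?\<kappa>' (ext U, x)))"
      using transition_agree[OF V nonzero_subspaces_fd nonzero_subspaces_fd] by simp
  qed (use re in auto)
  \<comment> \<open>The complex chain that \<open>enc\<close> substitutes for a real one is legal,
    and taking real points gives the original back.\<close>
  have chain: "restrict (\<lambda>i. ext (u i)) {..k} \<in> topspace (chain_space ?QC k)"
    and recover: "restrict (real_points \<circ> restrict (\<lambda>i. ext (u i) :: complex coords set) {..k}) {..k} = u"
    if i: "in_index (n + 1) k t u" for k t and u :: "nat \<Rightarrow> real coords set"
  proof -
    have u: "u \<in> topspace (chain_space ?QR k)" using i by (simp add: in_index_iff)
    have "ext \<in> topspace ?QR \<rightarrow> topspace ?QC" by (simp add: topspace_subspace_poset_complex)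
    from chain_space_map_in[OF this mono2 u]
    show "restrict (\<lambda>i. ext (u i)) {..k} \<in> topspace (chain_space ?QC k)" by (simp add: comp_def)
    show "restrict (real_points \<circ> restrict (\<lambda>i. ext (u i) :: complex coords set) {..k}) {..k} = u"
    proof
      fix l show "restrict (real_points \<circ> restrict (\<lambda>i. ext (u i) :: complex coords set) {..k}) {..k} l = u l"
        using in_index_nonzero[OF i, of l] nonzero_subspaces_subspace fun_cong[OF in_index_extensional[OF i], of l]
        by (cases "l \<le> k") auto
    qed
  qed
  have snd_k: "snd (?\<kappa> z) = snd z" "snd (?\<kappa>' z') = snd z'" for z z' by (auto simp: case_prod_beta)
  show "enc (n + 1) (holim_map ?QC real_points ?\<kappa> h) = enc (n + 1) h" for h
  proof -
    have "snd (holim_map ?QC real_points ?\<kappa> h k (t, restrict (\<lambda>i. ext (u i)) {..k})) = snd (h k (t, u))"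
      if i: "in_index (n + 1) k t u" for k t u
    proof -
      have t: "t \<in> standard_simplex k" using i by (simp add: in_index_iff)
      show ?thesis unfolding holim_map_apply[OF t chain[OF i]] recover[OF i] snd_k ..
    qed
    then show ?thesis unfolding enc_real by (simp add: enc_def cong: if_cong)
  qed
  show "enc (n + 1) (holim_map ?QR ext ?\<kappa>' h) = enc (n + 1) h" for h
  proof -
    have "snd (holim_map ?QR ext ?\<kappa>' h k (t, u)) = snd (h k (t, restrict (\<lambda>i. ext (u i)) {..k}))"
      if i: "in_index (n + 1) k t u" for k t u
    proof -
      have t: "t \<in> standard_simplex k" "u \<in> topspace (chain_space ?QR k)" using i by (auto simp: in_index_iff)
      show ?thesis unfolding holim_map_apply[OF t] snd_k by (simp add: comp_def)
    qed
    then show ?thesis unfolding enc_real by (simp add: enc_def cong: if_cong)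
  qed
qed

end

text \<open>Over both scalars families are indexed by real chains and are \<open>Star\<close>
  elsewhere, so the maps are equal on the whole type.\<close>

lemma fam_map_agree:
  assumes "\<And>U. U \<in> nonzero_subspaces m \<Longrightarrow> \<phi> U = \<psi> (ext U :: complex coords set)"
  shows "fam_map m \<phi> = fam_map m \<psi>"
proof
  fix x :: "'a univ"
  have "\<phi> (ext (u k)) y = \<psi> (ext (u k)) y" if "in_index m k t u" for k t u y
    using assms in_index_nonzero[OF that, of k] that by simp
  then show "fam_map m \<phi> x = fam_map m \<psi> x"
    by (cases x) (simp_all cong: if_cong)
qed

lemma tau_map_agree:
  assumes \<phi>: "\<And>V. fd_subspace V \<Longrightarrow> \<phi> V = \<psi> (ext V :: complex coords set)" and V: "fd_subspace V"
  shows "tau_map n \<phi> V = tau_map n \<psi> (ext V)"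
  unfolding tau_map_def
proof (rule fam_map_agree)
  fix U assume "U \<in> nonzero_subspaces (n + 1)"
  then have U: "fd_subspace U" by (rule nonzero_subspaces_fd)
  show "\<phi> (V \<oplus>\<^sub>v U) = \<psi> (ext V \<oplus>\<^sub>v ext U)"
    using \<phi>[OF fd_subspace_dsum[OF V U]] V U by (simp add: ext_dsum fd_subspace_imp_subspace)
qed

context realification begin

lemma agree_tau: "agree (tau n G) (tau n E)"
  unfolding agree_def
proof (intro conjI allI impI)
  fix V :: "real coords set" assume V: "fd_subspace V"
  show "Sp (tau n G) V = Sp (tau n E) (ext V)" by (rule Sp_tau_agree[OF V])
  have "Pt G (V \<oplus>\<^sub>v u k) = Pt E (ext V \<oplus>\<^sub>v ext (u k))" if "in_index (n + 1) k t u" for k t u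
    using agreeD(2)[OF agree fd_subspace_dsum[OF V in_index_fd[OF that]]] V in_index_fd[OF that]
    by (simp add: ext_dsum fd_subspace_imp_subspace)
  then show "Pt (tau n G) V = Pt (tau n E) (ext V)"
    unfolding Pt_tau by (simp cong: if_cong)
next
  fix V W :: "real coords set" and f
  assume "fd_subspace V \<and> fd_subspace W \<and> f \<in> mor V W"
  then have fd: "fd_subspace V" "fd_subspace W" and f: "f \<in> mor V W" by auto
  show "Mp (tau n G) V W f = Mp (tau n E) (ext V) (ext W) (cplx_mor V f)"
    unfolding Mp_tau
  proof (rule fam_map_agree)
    fix U assume "U \<in> nonzero_subspaces (n + 1)"
    then have U: "fd_subspace U" by (rule nonzero_subspaces_fd)
    then have "incl U \<in> mor U U" by (intro incl_in_mor fd_subspace_imp_subspace) auto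
    from Mp_agree[OF fd(1) U fd(2) U f this]
    show "Mp G (V \<oplus>\<^sub>v U) (W \<oplus>\<^sub>v U) (dsum_mor V U f (incl U))
        = Mp E (ext V \<oplus>\<^sub>v ext U) (ext W \<oplus>\<^sub>v ext U) (dsum_mor (ext V) (ext U) (cplx_mor V f) (incl (ext U)))"
      using U by (simp add: cplx_mor_incl fd_subspace_imp_subspace)
  qed
qed

lemma realification_tau: "realification (tau n G) (tau n E)"
  by (intro realification.intro regular_tau realification_axioms.intro agree_tau)

lemma eta_agree:
  assumes V: "fd_subspace V"
  shows "eta n G V = eta n E (ext V)"
proof
  fix x
  have "Mp G V (V \<oplus>\<^sub>v u k) (dsum_in1 V) x = Mp E (ext V) (ext V \<oplus>\<^sub>v ext (u k)) (dsum_in1 (ext V)) x"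
    if "in_index (n + 1) k t u" for k t u
  proof -
    note U = in_index_fd[OF that]
    note s = fd_subspace_imp_subspace[OF V] fd_subspace_imp_subspace[OF U]
    show ?thesis
      using agreeD(3)[OF agree V fd_subspace_dsum[OF V U] dsum_in1_in_mor[OF V s(2)]]
      by (simp add: ext_dsum[OF s] cplx_mor_in1[OF s(1)])
  qed
  then show "eta n G V x = eta n E (ext V) x"
    unfolding eta_def by (simp cong: if_cong)
qed

end

section \<open>Telescopes, homotopy fibres and the main theorem\<close>

lemma realification_iter:
  assumes "realification G E"
  shows "realification (tau_iter n G k) (tau_iter n E k)"
  using assms by (induction k) (auto simp: tau_iter_def intro: realification.realification_tau)

lemma tau_map_iter_agree:
  assumes "\<forall>V. fd_subspace V \<longrightarrow> \<phi> V = \<psi> (ext V :: complex coords set)" "fd_subspace V"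
  shows "(tau_map n ^^ k) \<phi> V = (tau_map n ^^ k) \<psi> (ext V)"
  using assms(2)
proof (induction k arbitrary: V)
  case (Suc k)
  then show ?case using tau_map_agree[of "(tau_map n ^^ k) \<phi>" "(tau_map n ^^ k) \<psi>" V n] by simp
qed (use assms(1) in simp)

text \<open>No functor enters: the maps cut down families whose indices are real chains in both
  cases.\<close>

lemma iter_restrict_agree:
  assumes V: "fd_subspace V"
  shows "iter_restrict n k V = (iter_restrict n k (ext V :: complex coords set) :: 'a univ \<Rightarrow> _)"
  using V
proof (induction k arbitrary: V)
  case (Suc k)
  have "tau_map n (iter_restrict n k) V = (tau_map n (iter_restrict n k) (ext V :: complex coords set) :: 'a univ \<Rightarrow> _)"
    by (rule tau_map_agree) (use Suc in auto)
  then show ?case by (auto simp: fun_eq_iff)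
qed (auto simp: fun_eq_iff)

context realification begin

lemma tau_points_agree: "fd_subspace V \<Longrightarrow> tau_points n G V = tau_points n E (ext V)"
  using agreeD(2)[OF realification.agree[OF realification_iter[OF realification_axioms]]] by blast

lemma tau_steps_agree: "fd_subspace V \<Longrightarrow> tau_steps n G V = tau_steps n E (ext V)"
  using realification.eta_agree[OF realification_iter[OF realification_axioms]] by blast

lemma agree_T: "agree (T n G) (T n E)"
proof -
  note iter = realification.agree[OF realification_iter[OF realification_axioms, of n]]
  show ?thesis
    unfolding agree_def
  proof (intro conjI allI impI)
    fix V :: "real coords set" assume V: "fd_subspace V"
    have "(\<lambda>k. Sp (tau_iter n G k) V) = (\<lambda>k. Sp (tau_iter n E k) (ext V))"
      using agreeD(1)[OF iter V] by blast
    then show "Sp (T n G) V = Sp (T n E) (ext V)"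
      by (simp add: T_def tau_points_agree[OF V] tau_steps_agree[OF V])
    show "Pt (T n G) V = Pt (T n E) (ext V)" by (simp add: T_def)
  next
    fix V W :: "real coords set" and f
    assume "fd_subspace V \<and> fd_subspace W \<and> f \<in> mor V W"
    then have fd: "fd_subspace V" "fd_subspace W" and f: "f \<in> mor V W" by auto
    have "(\<lambda>k. Mp (tau_iter n G k) V W f) = (\<lambda>k. Mp (tau_iter n E k) (ext V) (ext W) (cplx_mor V f))"
      using agreeD(3)[OF iter fd f] by blast
    then show "Mp (T n G) V W f = Mp (T n E) (ext V) (ext W) (cplx_mor V f)"
      by (simp add: T_def tau_points_agree[OF fd(2)] tau_steps_agree[OF fd(2)])
  qed
qed

lemma T_map_agree:
  assumes "\<forall>V. fd_subspace V \<longrightarrow> \<phi> V = \<psi> (ext V)" "fd_subspace V"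
  shows "T_map n G \<phi> V = T_map n E \<psi> (ext V)"
proof -
  have "(\<lambda>k. (tau_map n ^^ k) \<phi> V) = (\<lambda>k. (tau_map n ^^ k) \<psi> (ext V))"
    using tau_map_iter_agree[OF assms] by blast
  then show ?thesis
    by (simp add: T_map_def tau_points_agree[OF assms(2)] tau_steps_agree[OF assms(2)])
qed

lemma agree_T_pred: "agree (T_pred n G) (T_pred n E)"
  by (cases n) (auto simp: agree_T, auto simp: agree_def terminal_def)

lemma T_pred_map_agree:
  assumes "\<forall>V. fd_subspace V \<longrightarrow> \<phi> V = \<psi> (ext V)" "fd_subspace V"
  shows "T_pred_map n G \<phi> V = T_pred_map n E \<psi> (ext V)"
  by (cases n) (simp_all add: T_map_agree[OF assms])

lemma T_down_agree:
  assumes V: "fd_subspace V"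
  shows "T_down n G V = T_down n E (ext V)"
proof (cases n)
  case (Suc m)
  have "(\<lambda>k. iter_restrict m k V) = (\<lambda>k. iter_restrict m k (ext V :: complex coords set) :: 'a univ \<Rightarrow> _)"
    using iter_restrict_agree[OF V] by blast
  then show ?thesis by (simp add: Suc tau_points_agree[OF V] tau_steps_agree[OF V])
qed simp

lemma agree_D: "agree (D n G) (D n E)"
  unfolding agree_def
proof (intro conjI allI impI)
  fix V :: "real coords set" assume V: "fd_subspace V"
  show "Sp (D n G) V = Sp (D n E) (ext V)" "Pt (D n G) V = Pt (D n E) (ext V)"
    using agreeD(1,2)[OF agree_T V] agreeD(1,2)[OF agree_T_pred V] T_down_agree[OF V]
    by (simp_all add: D_def)
next
  fix V W :: "real coords set" and f
  assume "fd_subspace V \<and> fd_subspace W \<and> f \<in> mor V W"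
  then show "Mp (D n G) V W f = Mp (D n E) (ext V) (ext W) (cplx_mor V f)"
    using agreeD(3)[OF agree_T] agreeD(3)[OF agree_T_pred] by (simp add: D_def)
qed

lemma D_map_agree:
  assumes "\<forall>V. fd_subspace V \<longrightarrow> \<phi> V = \<psi> (ext V)" "fd_subspace V"
  shows "D_map n G \<phi> V = D_map n E \<psi> (ext V)"
  by (simp add: D_map_def T_map_agree[OF assms] T_pred_map_agree[OF assms])

end

section \<open>Fixed points of telescopes\<close>

text \<open>The data of the telescope at one fixed \<open>V\<close>, detached from functors.\<close>

locale equivariant_sequence =
  fixes X :: "nat \<Rightarrow> 'a univ topology" and p :: "nat \<Rightarrow> 'a univ"
    and e s :: "nat \<Rightarrow> 'a univ \<Rightarrow> 'a univ"
  assumes e_continuous: "continuous_map (X k) (X (Suc k)) (e k)"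
    and s_p: "s k (p k) = p k"
    and e_p: "e k (p k) = p (Suc k)"
    and e_s: "x \<in> topspace (X k) \<Longrightarrow> e k (s k x) = s (Suc k) (e k x)"
    and closed: "closedin (X k) {x \<in> topspace (X k). s k x = x}"
begin

abbreviation "fixed_pts k \<equiv> {x \<in> topspace (X k). s k x = x}"

lemma e_in: "x \<in> topspace (X k) \<Longrightarrow> e k x \<in> topspace (X (Suc k))"
  using continuous_map_image_subset_topspace[OF e_continuous] by blast

lemma e_fixed: "x \<in> fixed_pts k \<Longrightarrow> e k x \<in> fixed_pts (Suc k)"
  using e_s[of x k] e_in by simp

text \<open>The normal form moves a point with \<open>t = 1\<close> to the start of the next stage;
  preservation of base points makes this consistent with the collapse to
  \<open>Star\<close>.\<close>

lemma tel_point_end: "\<not> t < 1 \<Longrightarrow> tel_point p e k t x = tel_point p e (Suc k) 0 (e k x)"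
  using e_p by (simp add: tel_point_def)

lemma tel_map_tel_point_less: "t < 1 \<Longrightarrow> tel_map p e s (tel_point p e k t x) = tel_point p e k t x \<longleftrightarrow> s k x = x"
  using s_p by (auto simp: tel_point_def)

text \<open>At the end of the interval the normal form lies in the next stage, so there fixedness
  concerns \<open>e k x\<close> and not \<open>x\<close>.\<close>

lemma tel_map_tel_point:
  "tel_map p e s (tel_point p e k t x) = tel_point p e k t x
    \<longleftrightarrow> (if t < 1 then s k x = x else s (Suc k) (e k x) = e k x)"
  using tel_map_tel_point_less[of t k x] tel_map_tel_point_less[of 0 "Suc k" "e k x"] tel_point_end[of t k x]
  by simp

abbreviation "tel_dom k \<equiv> prod_topology (top_of_set {0..1::real}) (X k)"

lemma telescope_maps:
  "\<forall>k\<in>UNIV. (\<lambda>(t, x). tel_point p e k t x) \<in> topspace (prod_topology (top_of_set {0..1}) (Y k))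
     \<rightarrow> (\<Union>k. (\<lambda>(t, x). tel_point p e k t x) ` ({0..1} \<times> topspace (Y k)))"
  by auto

lemma topspace_telescope:
  "topspace (telescope Y p e) = (\<Union>k. (\<lambda>(t, x). tel_point p e k t x) ` ({0..1} \<times> topspace (Y k)))"
  unfolding telescope_def by (rule topspace_final_topology[OF telescope_maps])

lemma tel_point_in:
  "t \<in> {0..1} \<Longrightarrow> x \<in> topspace (Y k) \<Longrightarrow> tel_point p e k t x \<in> topspace (telescope Y p e)"
  unfolding topspace_telescope by force

lemma closedin_telescope:
  "closedin (telescope Y p e) B \<longleftrightarrow> B \<subseteq> topspace (telescope Y p e) \<and>
     (\<forall>k. closedin (prod_topology (top_of_set {0..1}) (Y k)) {z \<in> {0..1} \<times> topspace (Y k). (\<lambda>(t, x). tel_point p e k t x) z \<in> B})"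
  using closedin_final_topology[OF telescope_maps[of Y], of B]
  unfolding topspace_telescope unfolding telescope_def by (simp add: Bex_def)

text \<open>The place where continuity of the structure maps enters.\<close>

lemma closedin_end:
  assumes "closedin (X (Suc k)) B"
  shows "closedin (tel_dom k) ({1} \<times> {x \<in> topspace (X k). e k x \<in> B})"
  unfolding closedin_prod_Times_iff
  using closedin_continuous_map_preimage[OF e_continuous assms] by auto

lemma topspace_telescope_fixed:
  "topspace (telescope (\<lambda>k. fixed_space (X k) (s k)) p e)
     = {y \<in> topspace (telescope X p e). tel_map p e s y = y}" (is "?L = ?R")
proof (intro equalityI subsetI)
  fix y assume "y \<in> ?L"
  then obtain k t x where y: "y = tel_point p e k t x" "t \<in> {0..1}" "x \<in> fixed_pts k"
    unfolding topspace_telescope by auto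
  moreover have "s (Suc k) (e k x) = e k x" using e_fixed[OF y(3)] by simp
  ultimately show "y \<in> ?R"
    using tel_point_in[of t x X k] tel_map_tel_point[of k t x] by simp
next
  fix y assume "y \<in> ?R"
  then obtain k t x where y: "y = tel_point p e k t x" "t \<in> {0..1}" "x \<in> topspace (X k)" "tel_map p e s y = y"
    unfolding topspace_telescope by auto
  show "y \<in> ?L"
  proof (cases "t < 1")
    case True
    then have "x \<in> fixed_pts k" using y tel_map_tel_point by auto
    then show ?thesis
      using tel_point_in[of t x "\<lambda>k. fixed_space (X k) (s k)" k] y(1,2) by simp
  next
    \<comment> \<open>At time 1 the given representative may be moved by \<open>s k\<close>, but the
      one at time 0 of the next stage is fixed.\<close>
    case False
    then have "e k x \<in> fixed_pts (Suc k)" using y tel_map_tel_point[of k t x] e_in by auto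
    moreover have "y = tel_point p e (Suc k) 0 (e k x)" unfolding y(1) by (rule tel_point_end[OF False])
    ultimately show ?thesis
      using tel_point_in[of 0 "e k x" "\<lambda>k. fixed_space (X k) (s k)" "Suc k"] by simp
  qed
qed

lemma closedin_telescope_fixed:
  "closedin (telescope X p e) {y \<in> topspace (telescope X p e). tel_map p e s y = y}"
  unfolding closedin_telescope
proof (intro conjI allI)
  fix k
  let ?P = "{z \<in> {0..1} \<times> topspace (X k). (\<lambda>(t, x). tel_point p e k t x) z
      \<in> {y \<in> topspace (telescope X p e). tel_map p e s y = y}}"
  \<comment> \<open>Besides the points that are fixed from the start there are those that become
    fixed under \<open>e k\<close>, and the latter appear only at time 1.\<close>
  have "?P = ({0..1} \<times> fixed_pts k) \<union> ({1} \<times> {x \<in> topspace (X k). e k x \<in> fixed_pts (Suc k)})"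
  proof (rule Set.set_eqI)
    fix z :: "real \<times> 'a univ"
    obtain t x where z: "z = (t, x)" by force
    have "tel_point p e k t x \<in> topspace (telescope X p e)" if "t \<in> {0..1}" "x \<in> topspace (X k)"
      using that by (rule tel_point_in)
    then show "z \<in> ?P \<longleftrightarrow> z \<in> ({0..1} \<times> fixed_pts k) \<union> ({1} \<times> {x \<in> topspace (X k). e k x \<in> fixed_pts (Suc k)})"
      using tel_map_tel_point[of k t x] e_fixed[of x k] e_in[of x k] unfolding z by (auto split: if_splits)
  qed
  moreover have "closedin (tel_dom k) ({0..1} \<times> fixed_pts k)"
    unfolding closedin_prod_Times_iff using closed by auto
  ultimately show "closedin (tel_dom k) ?P"
    using closedin_end[OF closed, of k] by (simp only: closedin_Un)
qed auto

text \<open>Both topologies are tested stage by stage. The preimage \<open>P k\<close> of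
  \<open>B\<close> in \<open>X k\<close> exceeds the preimage \<open>P' k\<close> in the fixed
  points only at time 1, where points have moved to the next stage; the excess is therefore
  controlled by \<open>P' (Suc k)\<close> at time 0.\<close>

lemma telescope_fixed:
  "telescope (\<lambda>k. fixed_space (X k) (s k)) p e = fixed_space (telescope X p e) (tel_map p e s)"
proof (rule topology_eq_closedin)
  let ?Y = "\<lambda>k. fixed_space (X k) (s k)"
  let ?A = "{y \<in> topspace (telescope X p e). tel_map p e s y = y}"
  show "topspace (telescope ?Y p e) = topspace (fixed_space (telescope X p e) (tel_map p e s))"
    by (simp add: topspace_telescope_fixed)
  fix B assume "B \<subseteq> topspace (telescope ?Y p e)"
  then have BA: "B \<subseteq> ?A" unfolding topspace_telescope_fixed .
  have sub: "fixed_space (telescope X p e) (tel_map p e s) = subtopology (telescope X p e) ?A"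
    unfolding fixed_space_def by (rule subtopology_cong) auto
  have cl1: "closedin (fixed_space (telescope X p e) (tel_map p e s)) B \<longleftrightarrow> closedin (telescope X p e) B"
    unfolding sub closedin_closed_subtopology[OF closedin_telescope_fixed] using BA by blast
  have Yk: "prod_topology (top_of_set {0..1::real}) (?Y k) = subtopology (tel_dom k) ({0..1} \<times> fixed_pts k)" for k
  proof -
    have "?Y k = subtopology (X k) (fixed_pts k)" unfolding fixed_space_def by (rule subtopology_cong) auto
    then show ?thesis by (simp add: prod_topology_subtopology(2))
  qed
  have cF: "closedin (tel_dom k) ({0..1} \<times> fixed_pts k)" for k
    unfolding closedin_prod_Times_iff using closed by auto
  define P where "P k = {z \<in> {0..1} \<times> topspace (X k). (\<lambda>(t, x). tel_point p e k t x) z \<in> B}" for k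
  define P' where "P' k = {z \<in> {0..1} \<times> fixed_pts k. (\<lambda>(t, x). tel_point p e k t x) z \<in> B}" for k
  have cP': "closedin (prod_topology (top_of_set {0..1}) (?Y k)) (P' k) \<longleftrightarrow> closedin (tel_dom k) (P' k)" for k
    unfolding Yk closedin_closed_subtopology[OF cF] by (auto simp: P'_def)
  have PP': "P' k = P k \<inter> ({0..1} \<times> fixed_pts k)" for k by (auto simp: P_def P'_def)
  have "(\<forall>k. closedin (tel_dom k) (P k)) \<longleftrightarrow> (\<forall>k. closedin (tel_dom k) (P' k))"
  proof
    assume "\<forall>k. closedin (tel_dom k) (P k)"
    then show "\<forall>k. closedin (tel_dom k) (P' k)" unfolding PP' using cF closedin_Int by blast
  next
    assume *: "\<forall>k. closedin (tel_dom k) (P' k)"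
    \<comment> \<open>A point that is not fixed may become fixed after one step, at time 1.\<close>
    show "\<forall>k. closedin (tel_dom k) (P k)"
    proof
      fix k
      \<comment> \<open>The slice of \<open>P' (Suc k)\<close> at time 0. Its preimage under
        \<open>e k\<close>, placed at time 1, is the excess of \<open>P k\<close>.\<close>
      define B' where "B' = {y \<in> topspace (X (Suc k)). (0, y) \<in> P' (Suc k)}"
      have "continuous_map (X (Suc k)) (tel_dom (Suc k)) (\<lambda>y. (0, y))"
        by (intro continuous_map_pairedI) auto
      then have "closedin (X (Suc k)) B'"
        unfolding B'_def using * by (intro closedin_continuous_map_preimage) auto
      then have cE: "closedin (tel_dom k) ({1} \<times> {x \<in> topspace (X k). e k x \<in> B'})" by (rule closedin_end)
      have "P k = P' k \<union> ({1} \<times> {x \<in> topspace (X k). e k x \<in> B'})"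
      proof (rule Set.set_eqI)
        fix z :: "real \<times> 'a univ"
        obtain t x where z: "z = (t, x)" by force
        have fx: "tel_map p e s (tel_point p e k t x) = tel_point p e k t x" if "tel_point p e k t x \<in> B"
          using that BA by blast
        show "z \<in> P k \<longleftrightarrow> z \<in> P' k \<union> ({1} \<times> {x \<in> topspace (X k). e k x \<in> B'})"
        proof (cases "t < 1")
          case True
          then show ?thesis using fx tel_map_tel_point[of k t x] unfolding z by (auto simp: P_def P'_def)
        next
          case False
          then show ?thesis
            using fx tel_map_tel_point[of k t x] tel_point_end[OF False, of k x] e_in[of x k]
            unfolding z by (auto simp: P_def P'_def B'_def)
        qed
      qed
      then show "closedin (tel_dom k) (P k)" using * cE by (simp only: closedin_Un)
    qed
  qed
  moreover have "B \<subseteq> topspace (telescope X p e)" using BA by blast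
  ultimately show "closedin (telescope ?Y p e) B \<longleftrightarrow> closedin (fixed_space (telescope X p e) (tel_map p e s)) B"
    unfolding cl1 closedin_telescope topspace_fixed_space P_def[symmetric] P'_def[symmetric] cP'
    using BA unfolding topspace_telescope_fixed by blast
qed

end

section \<open>Fixed points of \<open>T\<close>\<close>

context regular_action begin

lemma regular_action_iter: "regular_action (tau_iter n G k) ((tau_map n ^^ k) \<sigma>)"
proof (induction k)
  case 0
  show ?case using regular_action_axioms by (simp add: tau_iter_def)
next
  case (Suc k)
  then show ?case using regular_action.regular_action_tau[OF Suc] by (simp add: tau_iter_def)
qed

lemma fixed_functor_iter:
  assumes "fixed_functor G \<sigma> G'"
  shows "fixed_functor (tau_iter n G k) ((tau_map n ^^ k) \<sigma>) (tau_iter n G' k)"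
proof (induction k)
  case 0
  show ?case using assms by (simp add: tau_iter_def)
next
  case (Suc k)
  then show ?case
    using regular_action.fixed_functor_tau[OF regular_action_iter Suc] by (simp add: tau_iter_def)
qed

lemma equivariant_sequence_tau:
  assumes V: "fd_subspace V"
  shows "equivariant_sequence (\<lambda>k. Sp (tau_iter n G k) V) (tau_points n G V) (tau_steps n G V)
    (\<lambda>k. (tau_map n ^^ k) \<sigma> V)"
proof
  fix k
  interpret k: regular_action "tau_iter n G k" "(tau_map n ^^ k) \<sigma>" by (rule regular_action_iter)
  have Suc: "tau_iter n G (Suc k) = tau n (tau_iter n G k)" by (simp add: tau_iter_def)
  show "continuous_map (Sp (tau_iter n G k) V) (Sp (tau_iter n G (Suc k)) V) (eta n (tau_iter n G k) V)"
    unfolding Suc by (rule k.continuous_map_eta[OF V])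
  show "(tau_map n ^^ k) \<sigma> V (Pt (tau_iter n G k) V) = Pt (tau_iter n G k) V" by (rule k.\<sigma>_Pt[OF V])
  show "eta n (tau_iter n G k) V (Pt (tau_iter n G k) V) = Pt (tau_iter n G (Suc k)) V"
    unfolding Suc by (rule k.eta_Pt[OF V])
  show "eta n (tau_iter n G k) V ((tau_map n ^^ k) \<sigma> V x) = (tau_map n ^^ Suc k) \<sigma> V (eta n (tau_iter n G k) V x)"
    if "x \<in> topspace (Sp (tau_iter n G k) V)" for x
    using k.eta_equivariant[OF V that, of n] by simp
  show "closedin (Sp (tau_iter n G k) V) {x \<in> topspace (Sp (tau_iter n G k) V). (tau_map n ^^ k) \<sigma> V x = x}"
    by (rule k.\<sigma>_closed[OF V])
qed

lemma fixed_functor_stages: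
  assumes "fixed_functor G \<sigma> G'"
  shows "tau_points n G' V = tau_points n G V" "tau_steps n G' V = tau_steps n G V"
    "Mp (tau_iter n G' k) = Mp (tau_iter n G k)"
proof -
  have *: "Pt (tau_iter n G' k) = Pt (tau_iter n G k)" "Mp (tau_iter n G' k) = Mp (tau_iter n G k)" for k
    using fixed_functor_iter[OF assms] by (auto simp: fixed_functor_def)
  have "eta n (tau_iter n G' k) V x = eta n (tau_iter n G k) V x" for k x
    unfolding eta_def *(2) ..
  then show "tau_points n G' V = tau_points n G V" "tau_steps n G' V = tau_steps n G V"
    "Mp (tau_iter n G' k) = Mp (tau_iter n G k)" by (auto simp: *)
qed

lemma fixed_functor_T:
  assumes G': "fixed_functor G \<sigma> G'"
  shows "fixed_functor (T n G) (T_map n G \<sigma>) (T n G')"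
  unfolding fixed_functor_def
proof (intro conjI allI impI)
  show "Pt (T n G') = Pt (T n G)" "Mp (T n G') = Mp (T n G)"
    by (simp_all add: T_def fixed_functor_stages[OF G'])
  fix V :: "real coords set" assume V: "fd_subspace V"
  have "(\<lambda>k. Sp (tau_iter n G' k) V) = (\<lambda>k. fixed_space (Sp (tau_iter n G k) V) ((tau_map n ^^ k) \<sigma> V))"
    using fixed_functor_iter[OF G'] V by (simp add: fixed_functor_def)
  then show "Sp (T n G') V = fixed_space (Sp (T n G) V) (T_map n G \<sigma> V)"
    using equivariant_sequence.telescope_fixed[OF equivariant_sequence_tau[OF V, of n]]
    by (simp add: T_def T_map_def fixed_functor_stages[OF G'])
qed

lemma closedin_T_fixed:
  assumes V: "fd_subspace V"
  shows "closedin (Sp (T n G) V) {x \<in> topspace (Sp (T n G) V). T_map n G \<sigma> V x = x}"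
  using equivariant_sequence.closedin_telescope_fixed[OF equivariant_sequence_tau[OF V, of n]]
  by (simp add: T_def T_map_def)

lemma fixed_functor_T_pred:
  assumes G': "fixed_functor G \<sigma> G'"
  shows "fixed_functor (T_pred n G) (T_pred_map n G \<sigma>) (T_pred n G')"
  using fixed_functor_T[OF G']
  by (cases n) (simp_all add: fixed_functor_def terminal_def fixed_space_def subtopology_discrete_topology)

lemma closedin_T_pred_fixed:
  assumes V: "fd_subspace V"
  shows "closedin (Sp (T_pred n G) V) {x \<in> topspace (Sp (T_pred n G) V). T_pred_map n G \<sigma> V x = x}"
  using closedin_T_fixed[OF V] by (cases n) (auto simp: terminal_def)

lemma T_down_fixed: "fixed_functor G \<sigma> G' \<Longrightarrow> T_down n G' V = T_down n G V"
  by (cases n) (simp_all add: fixed_functor_stages)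

end

section \<open>Fixed points of homotopy fibres\<close>

abbreviation hofib_points where
  "hofib_points X Y y0 f \<equiv> subtopology (prod_topology X (compact_open_topology (top_of_set {0..1::real}) Y))
     {(x, \<gamma>). \<gamma> 0 = f x \<and> \<gamma> 1 = y0}"

lemma hofib_eq: "hofib X Y y0 f = transport (\<lambda>(x, \<gamma>). HFib x \<gamma>) (kify (hofib_points X Y y0 f))"
  by (simp add: hofib_def)

text \<open>\<open>hofib_map\<close> restricts the new path to the unit interval, which changes
  nothing outside as the given path is extensional.\<close>

lemma hofib_map_fixed_iff:
  assumes "\<gamma> \<in> extensional {0..1}"
  shows "hofib_map s s' (HFib x \<gamma>) = HFib x \<gamma> \<longleftrightarrow> s x = x \<and> (\<forall>t\<in>{0..1}. s' (\<gamma> t) = \<gamma> t)"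
proof -
  have "restrict (s' \<circ> \<gamma>) {0..1} = \<gamma> \<longleftrightarrow> (\<forall>t\<in>{0..1}. s' (\<gamma> t) = \<gamma> t)"
  proof
    assume *: "restrict (s' \<circ> \<gamma>) {0..1} = \<gamma>"
    show "\<forall>t\<in>{0..1}. s' (\<gamma> t) = \<gamma> t"
    proof
      fix t :: real assume "t \<in> {0..1}"
      then show "s' (\<gamma> t) = \<gamma> t" using fun_cong[OF *, of t] by simp
    qed
  next
    assume "\<forall>t\<in>{0..1}. s' (\<gamma> t) = \<gamma> t"
    then show "restrict (s' \<circ> \<gamma>) {0..1} = \<gamma>"
      using assms by (auto simp: restrict_def extensional_def fun_eq_iff)
  qed
  then show ?thesis by simp
qed

lemma closedin_hofib_points_fixed:
  assumes X: "closedin X {x \<in> topspace X. s x = x}" and Y: "closedin Y {y \<in> topspace Y. s' y = y}"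
  shows "closedin (hofib_points X Y y0 f)
    {z \<in> topspace (hofib_points X Y y0 f). case z of (x, \<gamma>) \<Rightarrow> s x = x \<and> (\<forall>t\<in>{0..1}. s' (\<gamma> t) = \<gamma> t)}"
proof -
  let ?Z = "hofib_points X Y y0 f"
  let ?I = "top_of_set {0..1::real}"
  have c1: "continuous_map ?Z X fst"
    by (intro continuous_map_from_subtopology continuous_map_fst)
  have c2: "continuous_map ?Z Y (\<lambda>z. snd z t)" if t: "t \<in> {0..1}" for t :: real
  proof (rule continuous_map_from_subtopology)
    have "continuous_map (compact_open_topology ?I Y) Y (\<lambda>g. g t)"
      by (rule continuous_map_compact_open_eval) (use t in simp)
    from continuous_map_compose[OF continuous_map_snd this]
    show "continuous_map (prod_topology X (compact_open_topology ?I Y)) Y (\<lambda>z. snd z t)"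
      by (simp add: comp_def)
  qed
  have m1: "fst z \<in> topspace X" if "z \<in> topspace ?Z" for z
    by (rule subsetD[OF continuous_map_image_subset_topspace[OF c1] imageI[OF that]])
  have m2: "snd z t \<in> topspace Y" if "z \<in> topspace ?Z" "t \<in> {0..1}" for z and t :: real
    by (rule subsetD[OF continuous_map_image_subset_topspace[OF c2[OF that(2)]] imageI[OF that(1)]])
  have "closedin ?Z ({z \<in> topspace ?Z. fst z \<in> {x \<in> topspace X. s x = x}} \<inter>
      (\<Inter>t\<in>{0..1}. {z \<in> topspace ?Z. snd z t \<in> {y \<in> topspace Y. s' y = y}}))"
    by (intro closedin_Int closedin_INT closedin_continuous_map_preimage[OF c1 X]
        closedin_continuous_map_preimage[OF c2 Y]) auto
  moreover have "{z \<in> topspace ?Z. fst z \<in> {x \<in> topspace X. s x = x}} \<inter>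
      (\<Inter>t\<in>{0..1}. {z \<in> topspace ?Z. snd z t \<in> {y \<in> topspace Y. s' y = y}})
    = {z \<in> topspace ?Z. case z of (x, \<gamma>) \<Rightarrow> s x = x \<and> (\<forall>t\<in>{0..1}. s' (\<gamma> t) = \<gamma> t)}" (is "?L = ?R")
  proof (rule Set.set_eqI)
    fix z show "z \<in> ?L \<longleftrightarrow> z \<in> ?R"
    proof (cases "z \<in> topspace ?Z")
      case True
      show ?thesis
        unfolding Int_iff INT_iff mem_Collect_eq case_prod_beta
        using m1[OF True] m2[OF True] True by blast
    qed blast
  qed
  ultimately show ?thesis by (simp only:)
qed

text \<open>Paths in a fixed subspace are the paths with fixed values, with the subspace topology.
  Evaluation at all times shows that the condition is closed, so it passes through k-ification and
  the encoding.\<close>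

lemma hofib_fixed:
  assumes X: "closedin X {x \<in> topspace X. s x = x}" and Y: "closedin Y {y \<in> topspace Y. s' y = y}"
  shows "hofib (fixed_space X s) (fixed_space Y s') y0 f = fixed_space (hofib X Y y0 f) (hofib_map s s')"
proof -
  let ?Z = "hofib_points X Y y0 f"
  let ?I = "top_of_set {0..1::real}"
  let ?R = "{(x, \<gamma>). \<gamma> 0 = f x \<and> \<gamma> 1 = y0}"
  let ?Q = "\<lambda>z. case z of (x, \<gamma>) \<Rightarrow> s x = x \<and> (\<forall>t\<in>{0..1}. s' (\<gamma> t) = \<gamma> t)"
  let ?H = "\<lambda>z. case z of (x, \<gamma>) \<Rightarrow> HFib x \<gamma>"
  note cl = closedin_hofib_points_fixed[OF X Y, where ?y0.0 = y0 and f = f]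
  have QH: "hofib_map s s' (?H z) = ?H z \<longleftrightarrow> ?Q z" if "z \<in> topspace ?Z" for z
    using that hofib_map_fixed_iff[of "snd z" s s' "fst z"] by (auto simp: topspace_compact_open case_prod_beta)
  have "hofib_points (fixed_space X s) (fixed_space Y s') y0 f = subtopology ?Z {z. ?Q z}"
  proof -
    have "prod_topology (fixed_space X s) (compact_open_topology ?I (fixed_space Y s'))
        = subtopology (prod_topology X (compact_open_topology ?I Y)) {z. ?Q z}"
      unfolding fixed_space_def compact_open_subtopology subtopology_Times[symmetric]
      by (rule subtopology_cong) auto
    then show ?thesis by (simp only: subtopology_subtopology Int_commute)
  qed
  then have "hofib (fixed_space X s) (fixed_space Y s') y0 f = transport ?H (subtopology (kify ?Z) {z. ?Q z})"
    unfolding hofib_eq using kify_subtopology_Collect[OF cl] by simp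
  also have "subtopology (kify ?Z) {z. ?Q z} = subtopology (kify ?Z) {z. hofib_map s s' (?H z) = ?H z}"
    by (rule subtopology_cong) (use QH in auto)
  also have "transport ?H \<dots> = subtopology (transport ?H (kify ?Z)) {y. hofib_map s s' y = y}"
  proof (rule subtopology_transport[symmetric])
    have "{z \<in> topspace (kify ?Z). ?H z \<in> {y \<in> topspace (transport ?H (kify ?Z)). hofib_map s s' y = y}}
        = {z \<in> topspace ?Z. ?Q z}"
      unfolding topspace_transport topspace_kify
      by (intro Collect_cong conj_cong refl) (use QH in auto)
    then show "closedin (transport ?H (kify ?Z)) {y \<in> topspace (transport ?H (kify ?Z)). hofib_map s s' y = y}"
      unfolding closedin_transport using closedin_kifyI[OF cl] by auto
  qed
  finally show ?thesis by (simp only: hofib_eq fixed_space_def)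
qed

context regular_action begin

lemma fixed_functor_D:
  assumes G': "fixed_functor G \<sigma> G'"
  shows "fixed_functor (D n G) (D_map n G \<sigma>) (D n G')"
proof -
  note T = fixed_functor_T[OF G', of n, unfolded fixed_functor_def]
  note TP = fixed_functor_T_pred[OF G', of n, unfolded fixed_functor_def]
  show ?thesis
    unfolding fixed_functor_def
  proof (intro conjI allI impI)
    show "Pt (D n G') = Pt (D n G)" "Mp (D n G') = Mp (D n G)" using T TP by (simp_all add: D_def)
    fix V :: "real coords set" assume V: "fd_subspace V"
    show "Sp (D n G') V = fixed_space (Sp (D n G) V) (D_map n G \<sigma> V)"
      using T TP V T_down_fixed[OF G', of n V] hofib_fixed[OF closedin_T_fixed[OF V, of n] closedin_T_pred_fixed[OF V, of n]]
      by (simp add: D_def D_map_def)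
  qed
qed

end

section \<open>The identity as a weak equivalence\<close>

lemma equiv_spheroid_homotopy: "equiv (spheroids n X x) (spheroid_homotopy n X x)"
proof (rule equivI)
  show "spheroid_homotopy n X x \<subseteq> spheroids n X x \<times> spheroids n X x"
    by (auto simp: spheroid_homotopy_def)
  show "refl_on (spheroids n X x) (spheroid_homotopy n X x)"
    by (auto simp: refl_on_def spheroid_homotopy_def spheroids_def)
  show "sym (spheroid_homotopy n X x)"
    by (auto simp: sym_def spheroid_homotopy_def intro: homotopic_with_symD)
  show "trans (spheroid_homotopy n X x)"
    by (auto simp: trans_def spheroid_homotopy_def intro: homotopic_with_trans)
qed

text \<open>The induced map replaces a class by the union of the classes of its members, which is
  the class itself.\<close>

lemma weak_equivalence_id: "weak_equivalence X X (\<lambda>x. x)"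
proof -
  have "htpy_group_map n X (\<lambda>x. x) x c = c" if "c \<in> htpy_group n X x" for n x c
  proof -
    obtain a where a: "a \<in> spheroids n X x" "c = spheroid_homotopy n X x `` {a}"
      using \<open>c \<in> htpy_group n X x\<close> unfolding htpy_group_def by (rule quotientE)
    have "spheroid_homotopy n X x `` {b} = c" if "b \<in> c" for b
      using equiv_class_eq[OF equiv_spheroid_homotopy, of a b n X x] that a by blast
    moreover have "a \<in> c" unfolding a(2) by (rule equiv_class_self[OF equiv_spheroid_homotopy a(1)])
    ultimately show ?thesis by (auto simp: htpy_group_map_def comp_def)
  qed
  then have "bij_betw (htpy_group_map n X (\<lambda>x. x) x) (htpy_group n X x) (htpy_group n X x)" for n x
    using bij_betw_cong[of "htpy_group n X x" "htpy_group_map n X (\<lambda>x. x) x" id] bij_betw_id by auto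
  then show ?thesis by (simp add: weak_equivalence_def)
qed

section \<open>Fixed points in weak Hausdorff spaces\<close>

text \<open>A closed subset of a test space is itself a test space; test maps into weak Hausdorff
  spaces are therefore closed maps.\<close>

lemma test_map_closed_image:
  assumes X: "weak_Hausdorff X" and u: "test_map C X u" and K: "closedin C K"
  shows "closedin X (u ` K)"
proof -
  have "test_map (subtopology C K) X u"
    using u K by (auto simp: test_map_def Hausdorff_space_subtopology closedin_compact_space
        compact_space_subtopology intro: continuous_map_from_subtopology)
  then have "closedin X (u ` topspace (subtopology C K))" using X unfolding weak_Hausdorff_def by blast
  then show ?thesis using closedin_subset[OF K] by (simp add: Int_absorb1)
qed

text \<open>If \<open>u c\<close> and \<open>v c\<close> differ, their fibres under \<open>u\<close>
  are disjoint closed sets in the normal space \<open>C\<close> and have disjoint neighbourhoods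
  \<open>A\<close> and \<open>B\<close>. A point \<open>d\<close> near \<open>c\<close> with
  \<open>u d = v d\<close> would give a value whose fibre under \<open>u\<close> lies in both, yet
  \<open>d\<close> belongs to that fibre.\<close>

lemma test_map_equalizer_closed:
  assumes X: "weak_Hausdorff X" and u: "test_map C X u" and v: "test_map C X v"
  shows "closedin C {c \<in> topspace C. u c = v c}"
proof -
  have C: "compact_space C" "Hausdorff_space C" and cu: "continuous_map C X u" and cv: "continuous_map C X v"
    using u v by (auto simp: test_map_def)
  have uX: "u c \<in> topspace X" "v c \<in> topspace X" if "c \<in> topspace C" for c
    using that continuous_map_image_subset_topspace[OF cu] continuous_map_image_subset_topspace[OF cv] by blast+
  have pt: "closedin X {u c}" "closedin X {v c}" if "c \<in> topspace C" for c
    using test_map_closed_image[OF X u, of "{c}"] test_map_closed_image[OF X v, of "{c}"]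
      closedin_Hausdorff_sing_eq[OF C(2)] that by auto
  have "openin C (topspace C - {c \<in> topspace C. u c = v c})"
  proof (subst openin_subopen, intro ballI)
    fix c assume c: "c \<in> topspace C - {c \<in> topspace C. u c = v c}"
    then have cC: "c \<in> topspace C" and ne: "u c \<noteq> v c" by auto
    have "closedin C {d \<in> topspace C. u d \<in> {u c}}" "closedin C {d \<in> topspace C. u d \<in> {v c}}"
      by (rule closedin_continuous_map_preimage[OF cu pt(1)[OF cC]],
          rule closedin_continuous_map_preimage[OF cu pt(2)[OF cC]])
    moreover have "disjnt {d \<in> topspace C. u d \<in> {u c}} {d \<in> topspace C. u d \<in> {v c}}"
      using ne by (auto simp: disjnt_def)
    moreover have "normal_space C"
      using C compact_Hausdorff_or_regular_imp_normal_space by blast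
    ultimately obtain A B where AB: "openin C A" "openin C B" "{d \<in> topspace C. u d \<in> {u c}} \<subseteq> A"
        "{d \<in> topspace C. u d \<in> {v c}} \<subseteq> B" "disjnt A B"
      unfolding normal_space_def by meson
    \<comment> \<open>The points of \<open>X\<close> whose fibre under \<open>u\<close> lies in
      \<open>A\<close>; this set is open because \<open>u\<close> is a closed map.\<close>
    define M where "M A = topspace X - u ` (topspace C - A)" for A
    have M: "openin X (M A)" if "openin C A" for A
      unfolding M_def using test_map_closed_image[OF X u, of "topspace C - A"] that by blast
    let ?W = "{d \<in> topspace C. u d \<in> M A} \<inter> {d \<in> topspace C. v d \<in> M B}"
    have "openin C ?W"
      by (intro openin_Int openin_continuous_map_preimage[OF cu] openin_continuous_map_preimage[OF cv] M AB)
    moreover have "c \<in> ?W" using cC AB(3,4) uX by (auto simp: M_def)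
    moreover have "u d \<noteq> v d" if "d \<in> ?W" for d
    proof
      assume "u d = v d"
      then have "u d \<in> M A" "u d \<in> M B" "d \<in> topspace C" using that by auto
      then have "d \<in> A" "d \<in> B" by (auto simp: M_def)
      then show False using AB(5) by (auto simp: disjnt_def)
    qed
    ultimately show "\<exists>W. openin C W \<and> c \<in> W \<and> W \<subseteq> topspace C - {c \<in> topspace C. u c = v c}"
      by (intro exI[of _ ?W]) auto
  qed
  then show ?thesis by (simp add: closedin_def)
qed

text \<open>Pulled back along a test map \<open>u\<close>, the fixed set is the equalizer of
  \<open>s \<circ> u\<close> and \<open>u\<close>. So its complement is k-open, hence open.\<close>

lemma cgwh_fixed_closed:
  assumes X: "cgwh X" and s: "continuous_map X X s"
  shows "closedin X {x \<in> topspace X. s x = x}"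
proof -
  have "openin (kify X) (topspace X - {x \<in> topspace X. s x = x})"
    unfolding openin_kify k_open_def
  proof (intro conjI allI impI)
    fix C u assume u: "test_map C X u"
    then have "test_map C X (s \<circ> u)" using s by (auto simp: test_map_def intro: continuous_map_compose)
    from test_map_equalizer_closed[OF _ this u]
    have "closedin C {c \<in> topspace C. (s \<circ> u) c = u c}" using X by (simp add: cgwh_def)
    then have "openin C (topspace C - {c \<in> topspace C. (s \<circ> u) c = u c})" by blast
    moreover have "topspace C - {c \<in> topspace C. (s \<circ> u) c = u c}
        = {c \<in> topspace C. u c \<in> topspace X - {x \<in> topspace X. s x = x}}"
      using u by (auto simp: test_map_def continuous_map_def)
    ultimately show "openin C {c \<in> topspace C. u c \<in> topspace X - {x \<in> topspace X. s x = x}}" by simp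
  qed auto
  then show ?thesis using X by (auto simp: cgwh_def closedin_def)
qed

lemma cgwh_test_generated:
  fixes X :: "'a univ topology"
  assumes "cgwh X"
  shows "test_generated TYPE('a univ section_family set set) X"
proof -
  \<comment> \<open>Points are embedded as constant families over an arbitrary subspace; only
    injectivity matters for comparing tests.\<close>
  have "inj (\<lambda>(x :: 'a univ) (k :: nat) (z :: (nat \<Rightarrow> real) \<times> (nat \<Rightarrow> real coords set)). ({} :: real coords set, x))"
    by (auto simp: inj_def fun_eq_iff)
  from test_generated_inj[OF inj_image[OF inj_image[OF this]] test_generated_kify[of X]]
  show ?thesis using assms by (simp add: cgwh_def)
qed

section \<open>Assembly of the two halves\<close>

text \<open>The restriction along complexification before fixed points are taken, where the scalar
  half and the fixed-point half of the argument meet.\<close>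

definition restrict_scalars :: "(complex, 'a univ) fctr \<Rightarrow> (real, 'a univ) fctr" where
  "restrict_scalars F = \<lparr> Sp = (\<lambda>V. Sp F (ext V)), Pt = (\<lambda>V. Pt F (ext V)),
     Mp = (\<lambda>V W f. Mp F (ext V) (ext W) (cplx_mor V f)) \<rparr>"

lemma agree_restrict_scalars: "agree (restrict_scalars F) F"
  by (simp add: agree_def restrict_scalars_def)

lemma fixed_functor_c_star:
  "fixed_functor (restrict_scalars F) (\<lambda>V. \<sigma> (ext V)) (c_star_fixed (F, \<sigma>))"
  by (simp add: fixed_functor_def restrict_scalars_def)

lemma regular_action_restrict_scalars:
  assumes F: "reality_functor (F, \<sigma>)"
  shows "regular_action (restrict_scalars F) (\<lambda>V. \<sigma> (ext V))"
proof -
  have cf: "continuous_functor reality_object F" using F by simp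
  note ob = reality_object_ext
  have cg: "cgwh (Sp F V)" and pt: "Pt F V \<in> topspace (Sp F V)" if "reality_object V" for V
    using cf that by (auto simp: continuous_functor_def)
  have id: "Mp F V V (incl V) x = x" if "reality_object V" "x \<in> topspace (Sp F V)" for V x
    using cf that by (auto simp: continuous_functor_def)
  have comp: "Mp F V X (g \<circ> f) x = Mp F W X g (Mp F V W f x)"
    if "reality_object V" "reality_object W" "reality_object X" "f \<in> mor V W" "g \<in> mor W X" "x \<in> topspace (Sp F V)"
    for V W X f g x
    using cf that unfolding continuous_functor_def by blast
  have Mc: "continuous_map (Sp F V) (Sp F W) (Mp F V W f)" and Mpt: "Mp F V W f (Pt F V) = Pt F W"
    if V: "reality_object V" and W: "reality_object W" and f: "f \<in> mor V W" for V W f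
  proof -
    \<comment> \<open>Each morphism gives a point of the mapping space, and the points of
      \<open>based_mapping_space\<close> are continuous based maps.\<close>
    have "continuous_map (mor_space V W) (based_mapping_space (Sp F V) (Pt F V) (Sp F W) (Pt F W))
        (\<lambda>f. restrict (Mp F V W f) (topspace (Sp F V)))"
      using cf V W unfolding continuous_functor_def by blast
    then have "restrict (Mp F V W f) (topspace (Sp F V))
        \<in> topspace (based_mapping_space (Sp F V) (Pt F V) (Sp F W) (Pt F W))"
      using f by (auto simp: continuous_map_def mor_space_def)
    then have *: "continuous_map (Sp F V) (Sp F W) (restrict (Mp F V W f) (topspace (Sp F V)))"
      "restrict (Mp F V W f) (topspace (Sp F V)) (Pt F V) = Pt F W"
      by (simp_all add: based_mapping_space_def topspace_compact_open)
    show "continuous_map (Sp F V) (Sp F W) (Mp F V W f)" by (rule continuous_map_eq[OF *(1)]) simp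
    show "Mp F V W f (Pt F V) = Pt F W" using *(2) pt[OF V] by simp
  qed
  have \<sigma>: "continuous_map (Sp F V) (Sp F V) (\<sigma> V)" "\<sigma> V (Pt F V) = Pt F V"
    "\<And>x. x \<in> topspace (Sp F V) \<Longrightarrow> \<sigma> V (\<sigma> V x) = x" if "reality_object V" for V
    using F that by auto
  have conj: "Mp F V W (conjv \<circ> f \<circ> conjv) x = \<sigma> W (Mp F V W f (\<sigma> V x))"
    if "reality_object V" "reality_object W" "f \<in> mor V W" "x \<in> topspace (Sp F V)" for V W f x
    using F that by simp
  show ?thesis
  proof
    fix V :: "real coords set" assume V: "fd_subspace V"
    note s = fd_subspace_imp_subspace[OF V]
    show "Pt (restrict_scalars F) V \<in> topspace (Sp (restrict_scalars F) V)"
      using pt[OF ob[OF V]] by (simp add: restrict_scalars_def)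
    show "test_generated TYPE('a univ section_family set set) (Sp (restrict_scalars F) V)"
      using cgwh_test_generated[OF cg[OF ob[OF V]]] by (simp add: restrict_scalars_def)
    show "Mp (restrict_scalars F) V V (incl V) x = x" if "x \<in> topspace (Sp (restrict_scalars F) V)" for x
      using id[OF ob[OF V]] that by (simp add: restrict_scalars_def cplx_mor_incl[OF s])
    show "continuous_map (Sp (restrict_scalars F) V) (Sp (restrict_scalars F) V) (\<sigma> (ext V))"
      "\<sigma> (ext V) (Pt (restrict_scalars F) V) = Pt (restrict_scalars F) V"
      using \<sigma>(1,2)[OF ob[OF V]] by (simp_all add: restrict_scalars_def)
    show "closedin (Sp (restrict_scalars F) V) {x \<in> topspace (Sp (restrict_scalars F) V). \<sigma> (ext V) x = x}"
      using cgwh_fixed_closed[OF cg[OF ob[OF V]] \<sigma>(1)[OF ob[OF V]]] by (simp add: restrict_scalars_def)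
  next
    fix V W :: "real coords set" and f
    assume V: "fd_subspace V" and W: "fd_subspace W" and f: "f \<in> mor V W"
    note m = cplx_mor_in_mor[OF f V W]
    show "continuous_map (Sp (restrict_scalars F) V) (Sp (restrict_scalars F) W) (Mp (restrict_scalars F) V W f)"
      "Mp (restrict_scalars F) V W f (Pt (restrict_scalars F) V) = Pt (restrict_scalars F) W"
      using Mc[OF ob[OF V] ob[OF W] m] Mpt[OF ob[OF V] ob[OF W] m] by (simp_all add: restrict_scalars_def)
    fix x assume "x \<in> topspace (Sp (restrict_scalars F) V)"
    then have x: "x \<in> topspace (Sp F (ext V))" by (simp add: restrict_scalars_def)
    have sx: "\<sigma> (ext V) x \<in> topspace (Sp F (ext V))"
      using continuous_map_image_subset_topspace[OF \<sigma>(1)[OF ob[OF V]]] x by blast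
    \<comment> \<open>Equivariance is applied at the point \<sigma> x, where the inner involution
      cancels, and conjugation fixes the complexified morphism.\<close>
    show "\<sigma> (ext W) (Mp (restrict_scalars F) V W f x) = Mp (restrict_scalars F) V W f (\<sigma> (ext V) x)"
      using conj[OF ob[OF V] ob[OF W] m sx] \<sigma>(3)[OF ob[OF V] x]
        conjv_cplx_mor[OF f fd_subspace_imp_subspace[OF V]]
      by (simp add: restrict_scalars_def)
  next
    fix V W X :: "real coords set" and f g x
    assume fd: "fd_subspace V" "fd_subspace W" "fd_subspace X" and f: "f \<in> mor V W" and g: "g \<in> mor W X"
      and x: "x \<in> topspace (Sp (restrict_scalars F) V)"
    show "Mp (restrict_scalars F) W X g (Mp (restrict_scalars F) V W f x) = Mp (restrict_scalars F) V X (g \<circ> f) x"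
      using comp[OF ob[OF fd(1)] ob[OF fd(2)] ob[OF fd(3)] cplx_mor_in_mor[OF f fd(1,2)] cplx_mor_in_mor[OF g fd(2,3)]] x
      by (simp add: restrict_scalars_def cplx_mor_comp[OF f g fd])
  qed
qed

theorem corollary4p1p3:
  fixes F :: "'a univ reality_fctr" and n :: nat
  assumes "reality_functor F" and "fibrant_in_cofree_model F"
  shows "\<exists>\<alpha>. levelwise_weak_equivalence
           (c_star_fixed (D_reality n F)) (D_orthogonal n (c_star_fixed F)) \<alpha>"
proof -
  obtain E \<sigma> where F: "F = (E, \<sigma>)" by force
  let ?G = "restrict_scalars E" and ?\<sigma> = "\<lambda>V. \<sigma> (ext V)"
  interpret regular_action ?G ?\<sigma> using assms(1) unfolding F by (rule regular_action_restrict_scalars)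
  interpret realification ?G E
    by (intro realification.intro realification_axioms.intro regular_axioms agree_restrict_scalars)
  have fixed: "fixed_functor (D n ?G) (D_map n ?G ?\<sigma>) (D n (c_star_fixed F))"
    unfolding F by (rule fixed_functor_D[OF fixed_functor_c_star])
  have "levelwise_weak_equivalence (c_star_fixed (D_reality n F)) (D n (c_star_fixed F)) (\<lambda>V x. x)"
    unfolding levelwise_weak_equivalence_def
  proof (intro conjI allI impI ballI)
    fix V :: "real coords set" assume V: "fd_subspace V"
    show "Pt (c_star_fixed (D_reality n F)) V = Pt (D n (c_star_fixed F)) V"
      using fixed agreeD(2)[OF agree_D V, of n] by (simp add: F fixed_functor_def)
    \<comment> \<open>By agreement of scalars the left side consists of the fixed points of
      \<open>D n ?G\<close> at \<open>V\<close>, and these form the value of \<open>D n\<close> on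
      the fixed functor.\<close>
    have "Sp (c_star_fixed (D_reality n F)) V = Sp (D n (c_star_fixed F)) V"
      using fixed V agreeD(1)[OF agree_D V, of n] D_map_agree[of ?\<sigma> \<sigma> V n] by (simp add: F fixed_functor_def)
    then show "weak_equivalence (Sp (c_star_fixed (D_reality n F)) V) (Sp (D n (c_star_fixed F)) V) (\<lambda>x. x)"
      by (simp add: weak_equivalence_id)
  next
    fix V W :: "real coords set" and f x
    assume "fd_subspace V \<and> fd_subspace W" and "f \<in> mor V W"
    then show "Mp (c_star_fixed (D_reality n F)) V W f x = Mp (D n (c_star_fixed F)) V W f x"
      using fixed agreeD(3)[OF agree_D, of V W f n] by (simp add: F fixed_functor_def)
  qed
  then show ?thesis unfolding D_orthogonal_def by blast
qed

end
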